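(* Let $\mathbf{k}$ be a field of characteristic $0$ and let $\mathbf{e} = (e_1 < e_2 < \cdots < e_\ell)$ be an increasing sequence of positive integers. For every positive integer $r$ there is an integer $C_{\mathbf{e}}(r)$, depending only on $r$ and $\mathbf{e}$, such that for every finite-dimensional vector space $V$ (with $\dim V \ge e_\ell$) and every $\mathbf{d} = (d_1,\dots,d_\ell)$ of nonnegative integers, the prime ideal of $\mathrm{Sec}_{\mathbf{d},r}(\mathbf{F}(\mathbf{e},V))$ is generated by polynomials of degree $\le C_{\mathbf{e}}(r)$.
   Context: $\mathbf{F}(\mathbf{e},V)$ is the partial flag variety whose points are chains of subspaces $W_1 \subset \cdots \subset W_\ell \subset V$ with $\dim W_i = e_i$. Its Picard group is $\mathbf{Z}^\ell$, generated by line bundles $\mathcal{L}_1,\dots,\mathcal{L}_\ell$ corresponding to the fundamental weights $\omega_{e_1},\dots,\omega_{e_\ell}$ of $\mathbf{SL}(V)$; set $\mathcal{L}(\mathbf{d}) = \mathcal{L}_1^{\otimes d_1} \otimes \cdots \otimes \mathcal{L}_\ell^{\otimes d_\ell}$, which defines a map to the projective space $\mathbf{P}(\mathrm{H}^0(\mathbf{F}(\mathbf{e},V);\mathcal{L}(\mathbf{d}))^* )$ when all $d_i \ge 0$. $\mathrm{Sec}_{\mathbf{d},r}(\mathbf{F}(\mathbf{e},V))$ is the $r$th secant variety of the image of $\mathbf{F}(\mathbf{e},V)$ under this map, i.e. the Zariski closure (in the affine space $\mathrm{H}^0(\mathbf{F}(\mathbf{e},V);\mathcal{L}(\mathbf{d}))^*$)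 of the set of sums of $r$ points of the affine cone over the image. *)

theory Defs
  imports "HOL-Library.Poly_Mapping" "HOL-Combinatorics.Permutations"
begin

type_synonym ('v, 'k) mpoly = "('v \<Rightarrow>\<^sub>0 nat) \<Rightarrow>\<^sub>0 'k"

definition mpoly_vars :: "('v, 'k::zero) mpoly \<Rightarrow> 'v set" where
  "mpoly_vars p = (\<Union>m\<in>Poly_Mapping.keys p. Poly_Mapping.keys m)"

definition mpoly_eval :: "('v, 'k::comm_semiring_1) mpoly \<Rightarrow> ('v \<Rightarrow> 'k) \<Rightarrow> 'k" where
  "mpoly_eval p x = (\<Sum>m\<in>Poly_Mapping.keys p. Poly_Mapping.lookup p m * (\<Prod>v\<in>Poly_Mapping.keys m. x v ^ Poly_Mapping.lookup m v))"

definition mpoly_total_degree :: "('v, 'k::zero) mpoly \<Rightarrow> nat" where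
  "mpoly_total_degree p = Max (insert 0 ((\<lambda>m. \<Sum>v\<in>Poly_Mapping.keys m. Poly_Mapping.lookup m v) ` Poly_Mapping.keys p))"

definition poly_ring :: "'v set \<Rightarrow> ('v, 'k::zero) mpoly set" where
  "poly_ring X = {p. mpoly_vars p \<subseteq> X}"

definition ideal_gen_in :: "'v set \<Rightarrow> ('v, 'k::comm_ring_1) mpoly set \<Rightarrow> ('v, 'k) mpoly set" where
  "ideal_gen_in X G = {\<Sum>g\<in>F. q g * g | F q. finite F \<and> F \<subseteq> G \<and> (\<forall>g\<in>F. q g \<in> poly_ring X)}"

definition vanishing_ideal :: "'v set \<Rightarrow> ('v \<Rightarrow> 'k::comm_ring_1) set \<Rightarrow> ('v, 'k) mpoly set" where
  "vanishing_ideal X S = {p \<in> poly_ring X. \<forall>x\<in>S. mpoly_eval p x = 0}"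

definition generated_in_degree_le :: "'v set \<Rightarrow> ('v, 'k::comm_ring_1) mpoly set \<Rightarrow> nat \<Rightarrow> bool" where
  "generated_in_degree_le X I C \<longleftrightarrow>
     (\<exists>G. G \<subseteq> I \<and> (\<forall>g\<in>G. mpoly_total_degree g \<le> C) \<and> ideal_gen_in X G = I)"

definition minor :: "(nat \<Rightarrow> nat \<Rightarrow> 'k::comm_ring_1) \<Rightarrow> nat set \<Rightarrow> nat \<Rightarrow> 'k" where
  "minor M I k = (\<Sum>p\<in>{p. p permutes {..<k}}.
       of_int (sign p) * (\<Prod>i<k. M (sorted_list_of_set I ! i) (p i)))"

text \<open>Coordinates of the ambient space: J i j (for i < l, j < d_i) is an e_i-subset of
  {0..<n}, i.e. a Pluecker coordinate of the j-th factor of the i-th block in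
  the tensor product over i of (wedge^{e_i} V)^{tensor d_i}, V = k^n.\<close>
definition plucker_idx :: "nat list \<Rightarrow> nat list \<Rightarrow> nat \<Rightarrow> (nat \<Rightarrow> nat \<Rightarrow> nat set) set" where
  "plucker_idx e d n = {J.
     (\<forall>i<length e. \<forall>j<d ! i. J i j \<subseteq> {..<n} \<and> card (J i j) = e ! i) \<and>
     (\<forall>i j. \<not> (i < length e \<and> j < d ! i) \<longrightarrow> J i j = {})}"

text \<open>Point of the affine cone over the embedded flag variety: the flag is
  W_i = span of the first e_i columns of M; the point is c times the tensor
  product over i of (w_1 wedge ... wedge w_{e_i})^{tensor d_i}.\<close>
definition cone_point :: "nat list \<Rightarrow> nat list \<Rightarrow> 'k::comm_ring_1 \<Rightarrow> (nat \<Rightarrow> nat \<Rightarrow> 'k)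
    \<Rightarrow> (nat \<Rightarrow> nat \<Rightarrow> nat set) \<Rightarrow> 'k" where
  "cone_point e d c M J = c * (\<Prod>i<length e. \<Prod>j<d ! i. minor M (J i j) (e ! i))"

definition secant_set :: "nat list \<Rightarrow> nat list \<Rightarrow> nat \<Rightarrow> ((nat \<Rightarrow> nat \<Rightarrow> nat set) \<Rightarrow> 'k::comm_ring_1) set" where
  "secant_set e d r = {x. \<exists>c M. x = (\<lambda>J. \<Sum>t<r. cone_point e d (c t) (M t) J)}"

end

theory Submission
  imports Defs "HOL-Library.FuncSet" "HOL-Library.Sublist" "HOL-Library.Multiset_Order" "HOL-Library.Countable" "HOL-Computational_Algebra.Polynomial"
begin

text \<open>Polarization turns a form of degree m into a symmetric tensor with m rows, and in
  characteristic 0 the form vanishes on the r-th secant variety iff the tensor vanishes on all m-tuples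
  of cone points with at most r distinct entries. The space of such tensors, symmetric or not, is stable
  under multiplying the rows by fixed coordinates (which changes d) and under inserting constant rows
  (which changes m), so one looks for finitely many generators under these two operations, uniformly
  in d.

  For bounded dim V the tensors are indexed by words of monomials in finitely many Pluecker coordinates.
  Leading words are well-quasi-ordered by the lemmas of Dickson and Higman, and tensors with minimal
  leading words generate, as in the proof of Hilbert's basis theorem.

  The dimension of V is bounded by r times the largest flag dimension by an argument of Capelli type: if a
  weight vector involves more letters than that, then a nonzero multiple of it is an alternating sum,
  which is generated in bounded degree by the pigeonhole principle, plus polarizations of vectors of
  higher weight.\<close>

section \<open>Tensors vanishing at few distinct points\<close>

text \<open>The obstacle is that different \<open>d\<close> cannot be compared inside symmetric
  powers: changing \<open>d\<close> means multiplying every factor of every term, each by its own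
  monomial, and this makes sense only if the factors carry an order. Hence ordered rows and tensors
  without symmetry. Nothing is lost at the end, because forgetting the order of the rows turns an
  inserted constant row into multiplication by a coordinate, so generated tensors become members of
  the ideal generated by its elements of bounded degree.

  The number \<open>r * E\<close>, with \<open>E\<close> the largest flag dimension, counts the
  columns of r matrices: however large \<open>d\<close> and the dimension are, values at r points
  involve no more columns than that. So \<open>r * E + 1\<close> distinct letters force a
  coincidence, and only spaces with at most \<open>r * E\<close> letters contribute bounds of their
  own.

  The ambient space is a tensor product of exterior powers, larger than the dual of the space of
  sections. The linear equations cutting out the smaller space are generators of degree 1, which is
  why identifying coordinates asks for \<open>1 \<le> C\<close>.\<close>

text \<open>The rows outside S are ignored. Since \<open>\<tau>\<close> takes values below r, at most r distinct points are plugged in.\<close>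

definition vanishes :: "'x set \<Rightarrow> ('x \<Rightarrow> 'k::field_char_0) set \<Rightarrow> nat \<Rightarrow> nat set \<Rightarrow> nat set
    \<Rightarrow> ((nat \<Rightarrow> 'x) \<Rightarrow> 'k) \<Rightarrow> bool" where
  "vanishes X Z r R S F \<longleftrightarrow> (\<forall>z \<tau>. (\<forall>t<r. z t \<in> Z) \<longrightarrow> (\<forall>s. \<tau> s < r) \<longrightarrow>
     (\<Sum>x\<in>PiE R (\<lambda>_. X). F x * (\<Prod>s\<in>S. z (\<tau> s) (x s))) = 0)"

text \<open>Inserting constant rows is expressed without renumbering: on the row set
  \<open>R\<close>, such a tensor is a tensor in the rows of \<open>S\<close> times one fixed basis
  vector in each remaining row.\<close>

definition constant_off :: "'x set \<Rightarrow> nat set \<Rightarrow> nat set \<Rightarrow> (nat \<Rightarrow> 'x) \<Rightarrow> ((nat \<Rightarrow> 'x) \<Rightarrow> 'k::zero) \<Rightarrow> bool" where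
  "constant_off X R S c G \<longleftrightarrow> (\<forall>x\<in>PiE R (\<lambda>_. X). G x \<noteq> 0 \<longrightarrow> (\<forall>s\<in>R - S. x s = c s))"

text \<open>Sums of tensors that come from a vanishing tensor on at most C rows by inserting constant rows.\<close>

inductive generated :: "'x set \<Rightarrow> ('x \<Rightarrow> 'k::field_char_0) set \<Rightarrow> nat \<Rightarrow> nat \<Rightarrow> nat set
    \<Rightarrow> ((nat \<Rightarrow> 'x) \<Rightarrow> 'k) \<Rightarrow> bool" for X Z r C R where
  generated_zero: "(\<And>x. x \<in> PiE R (\<lambda>_. X) \<Longrightarrow> F x = 0) \<Longrightarrow> generated X Z r C R F"
| generated_step: "generated X Z r C R F \<Longrightarrow> S \<subseteq> R \<Longrightarrow> card S \<le> C \<Longrightarrow>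
    constant_off X R S c G \<Longrightarrow> vanishes X Z r R S G \<Longrightarrow> (\<And>x. x \<in> PiE R (\<lambda>_. X) \<Longrightarrow> H x = F x + G x) \<Longrightarrow> generated X Z r C R H"

definition bounded_gen :: "'x set \<Rightarrow> ('x \<Rightarrow> 'k::field_char_0) set \<Rightarrow> nat \<Rightarrow> nat \<Rightarrow> bool" where
  "bounded_gen X Z r C \<longleftrightarrow> (\<forall>m F. vanishes X Z r {..<m} {..<m} F \<longrightarrow> generated X Z r C {..<m} F)"

section \<open>Closure properties of vanishing and generated tensors\<close>

lemma vanishesD:
  assumes "vanishes X Z r R S F" "\<And>t. t < r \<Longrightarrow> z t \<in> Z" "\<And>s. \<tau> s < r"
  shows "(\<Sum>x\<in>PiE R (\<lambda>_. X). F x * (\<Prod>s\<in>S. z (\<tau> s) (x s))) = 0"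
  using assms unfolding vanishes_def by blast

lemma vanishesI:
  assumes "\<And>z \<tau>. (\<And>t. t < r \<Longrightarrow> z t \<in> Z) \<Longrightarrow> (\<And>s. \<tau> s < r) \<Longrightarrow>
    (\<Sum>x\<in>PiE R (\<lambda>_. X). F x * (\<Prod>s\<in>S. z (\<tau> s) (x s))) = 0"
  shows "vanishes X Z r R S F"
  using assms unfolding vanishes_def by blast

lemma vanishes_cmult: "vanishes X Z r R S F \<Longrightarrow> vanishes X Z r R S (\<lambda>x. a * F x)"
  unfolding vanishes_def by (simp add: mult.assoc flip: sum_distrib_left)

lemma vanishes_add: "vanishes X Z r R S F \<Longrightarrow> vanishes X Z r R S G \<Longrightarrow> vanishes X Z r R S (\<lambda>x. F x + G x)"
  unfolding vanishes_def by (simp add: distrib_right sum.distrib)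

lemma vanishes_diff: "vanishes X Z r R S F \<Longrightarrow> vanishes X Z r R S G \<Longrightarrow> vanishes X Z r R S (\<lambda>x. F x - G x)"
  using vanishes_add[of X Z r R S F "\<lambda>x. -1 * G x"] vanishes_cmult[of X Z r R S G "-1"] by simp

lemma generated_single:
  assumes "S \<subseteq> R" "card S \<le> C" "vanishes X Z r R S G" "constant_off X R S c G"
  shows "generated X Z r C R G"
  by (rule generated_step[where F = "\<lambda>_. 0" and S = S and G = G and c = c]) (use assms in \<open>auto intro: generated_zero\<close>)

lemma generated_cong:
  assumes "generated X Z r C R F" "\<And>x. x \<in> PiE R (\<lambda>_. X) \<Longrightarrow> F x = G x"
  shows "generated X Z r C R G"
proof -
  have "vanishes X Z r R {} (\<lambda>_. 0)" by (simp add: vanishes_def)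
  then show ?thesis
    by (rule_tac generated_step[where F = F and S = "{}" and G = "\<lambda>_. 0"])
      (use assms in \<open>auto simp: constant_off_def\<close>)
qed

lemma generated_add:
  assumes "generated X Z r C R F" "generated X Z r C R G"
  shows "generated X Z r C R (\<lambda>x. F x + G x)"
  using assms(2)
proof induction
  case (generated_zero G)
  then show ?case by (auto intro: generated_cong[OF assms(1)])
next
  case (generated_step G S c G' H)
  show ?case
    by (rule generated.generated_step[where F = "\<lambda>x. F x + G x" and S = S and G = G' and c = c])
      (use generated_step in \<open>auto simp: add.assoc\<close>)
qed

lemma generated_cmult:
  assumes "generated X Z r C R F"
  shows "generated X Z r C R (\<lambda>x. a * F x)"
  using assms
proof induction
  case (generated_zero G)
  then show ?case by (intro generated.generated_zero) auto
next
  case (generated_step G S c G' H)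
  show ?case
    by (rule generated.generated_step[where F = "\<lambda>x. a * G x" and S = S and G = "\<lambda>x. a * G' x" and c = c])
      (use generated_step in \<open>auto simp: distrib_left constant_off_def intro: vanishes_cmult\<close>)
qed

lemma generated_diff:
  assumes "generated X Z r C R F" "generated X Z r C R G"
  shows "generated X Z r C R (\<lambda>x. F x - G x)"
  using generated_add[OF assms(1) generated_cmult[OF assms(2), of "-1"]] by simp

lemma generated_sum:
  assumes "\<And>i. i \<in> I \<Longrightarrow> generated X Z r C R (F i)"
  shows "generated X Z r C R (\<lambda>x. \<Sum>i\<in>I. F i x)"
  using assms by (induction I rule: infinite_finite_induct) (auto intro: generated_zero generated_add)

lemma generated_mono:
  assumes "generated X Z r C R F" "C \<le> C'"
  shows "generated X Z r C' R F"
  using assms(1)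
proof induction
  case (generated_step G S c G' H)
  show ?case
    by (rule generated.generated_step[where F = G and S = S and G = G' and c = c])
      (use generated_step assms(2) in auto)
qed (rule generated.generated_zero)

lemma bounded_gen_mono: "bounded_gen X Z r C \<Longrightarrow> C \<le> C' \<Longrightarrow> bounded_gen X Z r C'"
  unfolding bounded_gen_def by (meson generated_mono)

text \<open>Cutting \<open>G\<close> according to its rows outside \<open>S\<close> gives finitely
  many slices, each of them a tensor in the rows \<open>S\<close> with constant rows inserted. This
  serves tensors whose cancellation takes place inside a few rows only.\<close>

lemma generated_slices:
  assumes "finite X" "finite R" "S \<subseteq> R" "card S \<le> C"
    and "\<And>c. vanishes X Z r R S (\<lambda>x. if \<forall>s\<in>R - S. x s = c s then G x else 0)"
  shows "generated X Z r C R G"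
proof -
  let ?P = "PiE (R - S) (\<lambda>_. X)"
  have fin: "finite ?P" using assms by (auto intro: finite_PiE)
  have "generated X Z r C R (\<lambda>x. \<Sum>c\<in>?P. if \<forall>s\<in>R - S. x s = c s then G x else 0)"
  proof (rule generated_sum)
    fix c
    show "generated X Z r C R (\<lambda>x. if \<forall>s\<in>R - S. x s = c s then G x else 0)"
      by (rule generated_single[where S = S and c = c]) (use assms in \<open>auto simp: constant_off_def split: if_splits\<close>)
  qed
  then show ?thesis
  proof (rule generated_cong)
    fix x assume x: "x \<in> PiE R (\<lambda>_. X)"
    have "(\<Sum>c\<in>?P. if \<forall>s\<in>R - S. x s = c s then G x else 0) =
        (\<Sum>c\<in>?P. if restrict x (R - S) = c then G x else 0)"
    proof (rule sum.cong[OF refl])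
      fix c assume c: "c \<in> ?P"
      have "(\<forall>s\<in>R - S. x s = c s) \<longleftrightarrow> restrict x (R - S) = c"
        using c by (auto simp: fun_eq_iff PiE_def extensional_def)
      then show "(if \<forall>s\<in>R - S. x s = c s then G x else 0) =
        (if restrict x (R - S) = c then G x else 0)" by simp
    qed
    also have "\<dots> = G x"
      using fin x by (subst sum.delta') (auto simp: PiE_def)
    finally show "(\<Sum>c\<in>?P. if \<forall>s\<in>R - S. x s = c s then G x else 0) = G x" .
  qed
qed

section \<open>Change of the index set\<close>

text \<open>The map on tensors that applies in every row the linear map taking the basis vector x to
  \<open>\<epsilon> x\<close> times the basis vector \<open>\<phi> x\<close>.\<close>

definition push :: "'x set \<Rightarrow> nat set \<Rightarrow> ('x \<Rightarrow> 'y) \<Rightarrow> ('x \<Rightarrow> 'k::field_char_0) \<Rightarrow>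
    ((nat \<Rightarrow> 'x) \<Rightarrow> 'k) \<Rightarrow> (nat \<Rightarrow> 'y) \<Rightarrow> 'k" where
  "push X R \<phi> \<epsilon> F y = (\<Sum>x\<in>PiE R (\<lambda>_. X).
     if (\<lambda>s\<in>R. \<phi> (x s)) = y then F x * (\<Prod>s\<in>R. \<epsilon> (x s)) else 0)"

lemma sum_push:
  assumes "finite X" "finite Y" "finite R" "\<And>x. x \<in> X \<Longrightarrow> \<epsilon> x \<noteq> 0 \<Longrightarrow> \<phi> x \<in> Y"
  shows "(\<Sum>y\<in>PiE R (\<lambda>_. Y). push X R \<phi> \<epsilon> F y * h y) =
    (\<Sum>x\<in>PiE R (\<lambda>_. X). F x * (\<Prod>s\<in>R. \<epsilon> (x s)) * h (\<lambda>s\<in>R. \<phi> (x s)))"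
proof -
  have fin: "finite (PiE R (\<lambda>_. Y))" using assms by (auto intro: finite_PiE)
  have "(\<Sum>y\<in>PiE R (\<lambda>_. Y). push X R \<phi> \<epsilon> F y * h y) =
     (\<Sum>x\<in>PiE R (\<lambda>_. X). \<Sum>y\<in>PiE R (\<lambda>_. Y).
        if (\<lambda>s\<in>R. \<phi> (x s)) = y then F x * (\<Prod>s\<in>R. \<epsilon> (x s)) * h y else 0)"
    unfolding push_def sum_distrib_right by (subst sum.swap) (auto intro!: sum.cong)
  also have "\<dots> = (\<Sum>x\<in>PiE R (\<lambda>_. X). F x * (\<Prod>s\<in>R. \<epsilon> (x s)) * h (\<lambda>s\<in>R. \<phi> (x s)))"
  proof (rule sum.cong[OF refl])
    fix x assume x: "x \<in> PiE R (\<lambda>_. X)"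
    have "(\<Prod>s\<in>R. \<epsilon> (x s)) = 0" if "(\<lambda>s\<in>R. \<phi> (x s)) \<notin> PiE R (\<lambda>_. Y)"
    proof -
      from that obtain s where s: "s \<in> R" "\<phi> (x s) \<notin> Y" by (auto simp: PiE_def)
      then have "\<epsilon> (x s) = 0" using assms(4)[of "x s"] x by (auto simp: PiE_def)
      then show ?thesis using s assms(3) by (auto intro: prod_zero)
    qed
    then show "(\<Sum>y\<in>PiE R (\<lambda>_. Y).
        if (\<lambda>s\<in>R. \<phi> (x s)) = y then F x * (\<Prod>s\<in>R. \<epsilon> (x s)) * h y else 0) =
        F x * (\<Prod>s\<in>R. \<epsilon> (x s)) * h (\<lambda>s\<in>R. \<phi> (x s))"
      using fin by (subst sum.delta') auto
  qed
  finally show ?thesis .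
qed

lemma push_nonzero:
  assumes "push X R \<phi> \<epsilon> F y \<noteq> 0"
  obtains x where "x \<in> PiE R (\<lambda>_. X)" "F x \<noteq> 0" "y = (\<lambda>s\<in>R. \<phi> (x s))"
proof -
  from assms obtain x where "x \<in> PiE R (\<lambda>_. X)"
    "(if (\<lambda>s\<in>R. \<phi> (x s)) = y then F x * (\<Prod>s\<in>R. \<epsilon> (x s)) else 0) \<noteq> 0"
    unfolding push_def by (rule sum.not_neutral_contains_not_neutral)
  then show ?thesis using that by (auto split: if_splits)
qed

lemma push_push:
  assumes "finite X" "finite Y" "finite R" "\<And>x. x \<in> X \<Longrightarrow> \<epsilon> x \<noteq> 0 \<Longrightarrow> \<phi> x \<in> Y"
  shows "push Y R \<sigma> \<epsilon>' (push X R \<phi> \<epsilon> F) u = push X R (\<lambda>x. \<sigma> (\<phi> x)) (\<lambda>x. \<epsilon> x * \<epsilon>' (\<phi> x)) F u"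
proof -
  have r: "(\<lambda>s\<in>R. \<sigma> (if s \<in> R then \<phi> (x s) else undefined)) = (\<lambda>s\<in>R. \<sigma> (\<phi> (x s)))" for x
    by auto
  have "push Y R \<sigma> \<epsilon>' (push X R \<phi> \<epsilon> F) u = (\<Sum>y\<in>PiE R (\<lambda>_. Y). push X R \<phi> \<epsilon> F y *
      (if (\<lambda>s\<in>R. \<sigma> (y s)) = u then \<Prod>s\<in>R. \<epsilon>' (y s) else 0))"
    unfolding push_def[of Y] by (intro sum.cong) auto
  also have "\<dots> = push X R (\<lambda>x. \<sigma> (\<phi> x)) (\<lambda>x. \<epsilon> x * \<epsilon>' (\<phi> x)) F u"
    by (subst sum_push[OF assms]) (auto simp: push_def r prod.distrib intro!: sum.cong)
  finally show ?thesis .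
qed

lemma push_id:
  assumes "finite X" "finite R" "\<And>x. x \<in> X \<Longrightarrow> \<phi> x = x" "\<And>x. x \<in> X \<Longrightarrow> \<epsilon> x = 1"
    "u \<in> PiE R (\<lambda>_. X)"
  shows "push X R \<phi> \<epsilon> F u = F u"
proof -
  have "push X R \<phi> \<epsilon> F u = (\<Sum>x\<in>PiE R (\<lambda>_. X). if x = u then F x else 0)"
    unfolding push_def
  proof (rule sum.cong[OF refl])
    fix x assume x: "x \<in> PiE R (\<lambda>_. X)"
    then have "(\<lambda>s\<in>R. \<phi> (x s)) = x" "(\<Prod>s\<in>R. \<epsilon> (x s)) = 1"
      using assms(3,4) by (auto simp: fun_eq_iff PiE_def extensional_def Pi_def)
    then show "(if (\<lambda>s\<in>R. \<phi> (x s)) = u then F x * (\<Prod>s\<in>R. \<epsilon> (x s)) else 0) =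
      (if x = u then F x else 0)" by (simp only: mult_1_right)
  qed
  also have "\<dots> = F u"
    using assms by (subst sum.delta) (auto intro: finite_PiE)
  finally show ?thesis .
qed

text \<open>The transposed map pulls each point of \<open>ZY\<close> back to a point of
  \<open>ZX\<close>, so evaluating the push at r points is evaluating \<open>F\<close> at their
  pullbacks. The scalars of the constant rows are the same for every term and come out as one
  factor.\<close>

lemma vanishes_push:
  assumes "finite X" "finite Y" "finite R" "\<And>x. x \<in> X \<Longrightarrow> \<epsilon> x \<noteq> 0 \<Longrightarrow> \<phi> x \<in> Y"
    and compat: "\<And>z'. z' \<in> ZY \<Longrightarrow> \<exists>z\<in>ZX. \<forall>x\<in>X. z x = \<epsilon> x * z' (\<phi> x)"
    and S: "S \<subseteq> R" and F: "vanishes X ZX r R S F"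
    and c: "constant_off X R S c F"
  shows "vanishes Y ZY r R S (push X R \<phi> \<epsilon> F)"
proof (rule vanishesI)
  fix z' and \<tau> :: "nat \<Rightarrow> nat"
  assume z': "\<And>t. t < r \<Longrightarrow> z' t \<in> ZY" and \<tau>: "\<And>s. \<tau> s < r"
  obtain z where z: "\<And>t. t < r \<Longrightarrow> z t \<in> ZX \<and> (\<forall>x\<in>X. z t x = \<epsilon> x * z' t (\<phi> x))"
    using compat[OF z'] by metis
  have "(\<Sum>y\<in>PiE R (\<lambda>_. Y). push X R \<phi> \<epsilon> F y * (\<Prod>s\<in>S. z' (\<tau> s) (y s))) =
    (\<Sum>x\<in>PiE R (\<lambda>_. X). F x * (\<Prod>s\<in>R. \<epsilon> (x s)) * (\<Prod>s\<in>S. z' (\<tau> s) ((\<lambda>s\<in>R. \<phi> (x s)) s)))"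
    by (rule sum_push[OF assms(1-4)])
  also have "\<dots> = (\<Sum>x\<in>PiE R (\<lambda>_. X). (\<Prod>s\<in>R - S. \<epsilon> (c s)) * (F x * (\<Prod>s\<in>S. z (\<tau> s) (x s))))"
  proof (rule sum.cong[OF refl])
    fix x assume x: "x \<in> PiE R (\<lambda>_. X)"
    show "F x * (\<Prod>s\<in>R. \<epsilon> (x s)) * (\<Prod>s\<in>S. z' (\<tau> s) ((\<lambda>s\<in>R. \<phi> (x s)) s)) =
      (\<Prod>s\<in>R - S. \<epsilon> (c s)) * (F x * (\<Prod>s\<in>S. z (\<tau> s) (x s)))"
    proof (cases "F x = 0")
      case False
      have "(\<Prod>s\<in>R. \<epsilon> (x s)) = (\<Prod>s\<in>R - S. \<epsilon> (c s)) * (\<Prod>s\<in>S. \<epsilon> (x s))"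
        using c x False by (subst prod.subset_diff[OF S \<open>finite R\<close>]) (simp add: constant_off_def)
      moreover have "(\<Prod>s\<in>S. z (\<tau> s) (x s)) = (\<Prod>s\<in>S. \<epsilon> (x s)) * (\<Prod>s\<in>S. z' (\<tau> s) (\<phi> (x s)))"
        unfolding prod.distrib[symmetric] using z[OF \<tau>] x S by (intro prod.cong) (auto simp: PiE_iff subset_iff)
      moreover have "(\<Prod>s\<in>S. z' (\<tau> s) ((\<lambda>s\<in>R. \<phi> (x s)) s)) = (\<Prod>s\<in>S. z' (\<tau> s) (\<phi> (x s)))"
        using S by (intro prod.cong) auto
      ultimately show ?thesis by simp
    qed auto
  qed
  also have "\<dots> = 0"
    using vanishesD[OF F, of z \<tau>] z \<tau> by (simp flip: sum_distrib_left)
  finally show "(\<Sum>y\<in>PiE R (\<lambda>_. Y). push X R \<phi> \<epsilon> F y * (\<Prod>s\<in>S. z' (\<tau> s) (y s))) = 0" .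
qed

text \<open>The map acts row by row, so it sends constant rows to constant rows and leaves
  \<open>S\<close> unchanged.\<close>

lemma generated_push:
  assumes "finite X" "finite Y" "finite R" "\<And>x. x \<in> X \<Longrightarrow> \<epsilon> x \<noteq> 0 \<Longrightarrow> \<phi> x \<in> Y"
    and compat: "\<And>z'. z' \<in> ZY \<Longrightarrow> \<exists>z\<in>ZX. \<forall>x\<in>X. z x = \<epsilon> x * z' (\<phi> x)"
    and F: "generated X ZX r C R F"
  shows "generated Y ZY r C R (push X R \<phi> \<epsilon> F)"
  using F
proof induction
  case (generated_zero F)
  then show ?case by (intro generated.generated_zero) (auto simp: push_def intro!: sum.neutral)
next
  case (generated_step F S c G H)
  show ?case
  proof (rule generated.generated_step[where F = "push X R \<phi> \<epsilon> F" and S = S and G = "push X R \<phi> \<epsilon> G"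
      and c = "\<lambda>s. \<phi> (c s)"])
    show "vanishes Y ZY r R S (push X R \<phi> \<epsilon> G)"
      by (rule vanishes_push[where ZX = ZX and c = c]) (use assms(1-5) generated_step.hyps(2,5,4) in auto)
    show "constant_off Y R S (\<lambda>s. \<phi> (c s)) (push X R \<phi> \<epsilon> G)"
      using generated_step.hyps(4) by (auto simp: constant_off_def elim!: push_nonzero)
  next
    fix y
    show "push X R \<phi> \<epsilon> H y = push X R \<phi> \<epsilon> F y + push X R \<phi> \<epsilon> G y"
      unfolding push_def sum.distrib[symmetric] using generated_step.hyps(6)
      by (intro sum.cong) (auto simp: distrib_right)
  qed (use generated_step in auto)
qed

text \<open>The hypothesis on the points is a linear relation between coordinates. Replacing labels
  one row at a time, each replacement changes the tensor by this relation in a single row, all other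
  rows being constant; one active row suffices, hence \<open>1 \<le> C\<close>.\<close>

lemma generated_push_diff:
  assumes "finite X" "finite R" "1 \<le> C" and \<psi>: "\<And>x. x \<in> X \<Longrightarrow> \<eta> x \<noteq> 0 \<Longrightarrow> \<psi> x \<in> X"
    and z: "\<And>z x. z \<in> Z \<Longrightarrow> x \<in> X \<Longrightarrow> z x = \<eta> x * z (\<psi> x)"
  shows "generated X Z r C R (\<lambda>u. F u - push X R \<psi> \<eta> F u)"
proof -
  let ?P = "PiE R (\<lambda>_. X)"
  have fin: "finite ?P" using assms by (auto intro: finite_PiE)
  \<comment> \<open>\<open>m T x\<close> is x after the replacement in the rows \<open>T\<close>;
    the induction over \<open>T\<close> telescopes from x to the fully replaced assignment.\<close>
  define m where "m T x = (\<lambda>s\<in>R. if s \<in> T then \<psi> (x s) else x s)" for T and x :: "nat \<Rightarrow> _"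
  have basis: "generated X Z r C R (\<lambda>u. (if x = u then 1 else 0) -
      (\<Prod>s\<in>T. \<eta> (x s)) * (if m T x = u then 1 else 0))"
    if x: "x \<in> ?P" and T: "T \<subseteq> R" for x T
    using finite_subset[OF T \<open>finite R\<close>] T
  proof (induction T)
    case empty
    have "m {} x = x" using x by (auto simp: m_def fun_eq_iff PiE_def extensional_def)
    then show ?case by (intro generated_zero) auto
  next
    case (insert s0 T)
    let ?D = "\<lambda>u. (if m T x = u then 1 else 0) - \<eta> (x s0) * (if m (insert s0 T) x = u then 1 else 0)"
    have s0: "s0 \<in> R" "x s0 \<in> X" using insert x by auto
    have "generated X Z r C R (\<lambda>u. (\<Prod>s\<in>T. \<eta> (x s)) * ?D u)"
    \<comment> \<open>\<open>\<psi>\<close> is known to stay in \<open>X\<close> only where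
      \<open>\<eta>\<close> is nonzero, so \<open>m T x\<close> may leave the index set exactly when
      this product vanishes.\<close>
    proof (cases "(\<Prod>s\<in>T. \<eta> (x s)) = 0")
      case True then show ?thesis by (intro generated_zero) auto
    next
      case False
      have mT: "m T x \<in> ?P"
        using False x \<psi> insert by (auto simp: m_def PiE_iff)
      have "generated X Z r C R ?D"
      proof (rule generated_single[where S = "{s0}" and c = "m T x"])
        show "vanishes X Z r R {s0} ?D"
        proof (rule vanishesI)
          fix z :: "nat \<Rightarrow> 'a \<Rightarrow> 'b" and \<tau> :: "nat \<Rightarrow> nat"
          assume zt: "\<And>t. t < r \<Longrightarrow> z t \<in> Z" and \<tau>: "\<And>s. \<tau> s < r"
          let ?z = "z (\<tau> s0)"
          have "(\<Sum>u\<in>?P. ?D u * (\<Prod>s\<in>{s0}. z (\<tau> s) (u s))) =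
            (\<Sum>u\<in>?P. if m T x = u then ?z (u s0) else 0) -
            (\<Sum>u\<in>?P. if m (insert s0 T) x = u then \<eta> (x s0) * ?z (u s0) else 0)"
            unfolding sum_subtractf[symmetric] by (intro sum.cong) (auto simp: left_diff_distrib)
          also have "\<dots> = ?z (m T x s0) -
             (if m (insert s0 T) x \<in> ?P then \<eta> (x s0) * ?z (m (insert s0 T) x s0) else 0)"
            using fin mT by (simp add: sum.delta')
          also have "m T x s0 = x s0" using insert s0 by (auto simp: m_def)
          also have "m (insert s0 T) x s0 = \<psi> (x s0)" using s0 by (auto simp: m_def)
          also have "?z (x s0) - (if m (insert s0 T) x \<in> ?P then \<eta> (x s0) * ?z (\<psi> (x s0)) else 0) = 0"
          proof (cases "\<eta> (x s0) = 0")
            case True then show ?thesis using z[OF zt[OF \<tau>] s0(2)] by simp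
          next
            case nz: False
            have "m (insert s0 T) x \<in> ?P"
              using mT \<psi>[OF s0(2) nz] s0 by (auto simp: m_def PiE_iff split: if_splits)
            then show ?thesis using z[OF zt[OF \<tau>] s0(2)] by simp
          qed
          finally show "(\<Sum>u\<in>?P. ?D u * (\<Prod>s\<in>{s0}. z (\<tau> s) (u s))) = 0" .
        qed
      qed (use s0 \<open>1 \<le> C\<close> in \<open>auto simp: m_def constant_off_def split: if_splits\<close>)
      then show ?thesis by (rule generated_cmult)
    qed
    moreover have "generated X Z r C R (\<lambda>u. (if x = u then 1 else 0) -
      (\<Prod>s\<in>T. \<eta> (x s)) * (if m T x = u then 1 else 0))" using insert by auto
    ultimately show ?case
      by (rule generated_cong[OF generated_add]) (use insert in \<open>auto simp: algebra_simps\<close>)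
  qed
  have "generated X Z r C R (\<lambda>u. \<Sum>x\<in>?P. F x * ((if x = u then 1 else 0) -
      (\<Prod>s\<in>R. \<eta> (x s)) * (if m R x = u then 1 else 0)))"
    by (intro generated_sum generated_cmult basis) auto
  then show ?thesis
  proof (rule generated_cong)
    fix u assume u: "u \<in> ?P"
    have "F u = (\<Sum>x\<in>?P. if x = u then F x else 0)" using fin u by (simp add: sum.delta)
    moreover have "m R x = (\<lambda>s\<in>R. \<psi> (x s))" for x by (auto simp: m_def)
    ultimately show "(\<Sum>x\<in>?P. F x * ((if x = u then 1 else 0) -
      (\<Prod>s\<in>R. \<eta> (x s)) * (if m R x = u then 1 else 0))) = F u - push X R \<psi> \<eta> F u"
      by (simp add: push_def flip: sum_subtractf) (auto intro!: sum.cong simp: algebra_simps)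
  qed
qed

text \<open>Extension by zero is the push along the inclusion with all scalars 1.\<close>

lemma generated_subset:
  assumes "finite X" "finite R" "X' \<subseteq> X" "generated X' Z r C R F"
    "\<And>x. x \<in> PiE R (\<lambda>_. X) \<Longrightarrow> x \<notin> PiE R (\<lambda>_. X') \<Longrightarrow> F x = 0"
  shows "generated X Z r C R F"
proof -
  have fX: "finite X'" using finite_subset[OF assms(3,1)] .
  have "generated X Z r C R (push X' R (\<lambda>x. x) (\<lambda>_. 1) F)"
    by (rule generated_push[where ZX = Z]) (use assms fX in auto)
  then show ?thesis
  proof (rule generated_cong)
    fix u assume u: "u \<in> PiE R (\<lambda>_. X)"
    have "(\<lambda>s\<in>R. x s) = x" if "x \<in> PiE R (\<lambda>_. X')" for x
      using that by (auto simp: fun_eq_iff PiE_def extensional_def)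
    then have "push X' R (\<lambda>x. x) (\<lambda>_. 1) F u = (\<Sum>x\<in>PiE R (\<lambda>_. X'). if x = u then F x else 0)"
      unfolding push_def by (intro sum.cong) auto
    then show "push X' R (\<lambda>x. x) (\<lambda>_. 1) F u = F u"
      using assms(5)[OF u] fX assms(2) by (auto simp: sum.delta finite_PiE)
  qed
qed

section \<open>Comparison of two coordinate systems on the same points\<close>

text \<open>A coordinate from \<open>X\<close> is a multiple of one from \<open>Y\<close>, possibly
  the zero multiple, so \<open>X\<close> may be redundant; \<open>\<sigma>\<close> picks a
  representative with nonzero scalar. Degree bounds pass both ways, which lets each argument use the
  indexing that suits it.\<close>

locale index_transfer =
  fixes X :: "'x set" and Y :: "'y set" and ZX :: "('x \<Rightarrow> 'k::field_char_0) set"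
    and ZY :: "('y \<Rightarrow> 'k) set" and \<phi> :: "'x \<Rightarrow> 'y" and \<epsilon> :: "'x \<Rightarrow> 'k" and \<sigma> :: "'y \<Rightarrow> 'x"
  assumes finX: "finite X" and finY: "finite Y"
    and \<phi>: "\<And>x. x \<in> X \<Longrightarrow> \<epsilon> x \<noteq> 0 \<Longrightarrow> \<phi> x \<in> Y"
    and \<sigma>: "\<And>y. y \<in> Y \<Longrightarrow> \<sigma> y \<in> X" and \<phi>\<sigma>: "\<And>y. y \<in> Y \<Longrightarrow> \<phi> (\<sigma> y) = y"
    and \<epsilon>\<sigma>: "\<And>y. y \<in> Y \<Longrightarrow> \<epsilon> (\<sigma> y) \<noteq> 0"
    and pull: "\<And>z'. z' \<in> ZY \<Longrightarrow> \<exists>z\<in>ZX. \<forall>x\<in>X. z x = \<epsilon> x * z' (\<phi> x)"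
    and factor: "\<And>z. z \<in> ZX \<Longrightarrow> \<exists>z'\<in>ZY. \<forall>x\<in>X. z x = \<epsilon> x * z' (\<phi> x)"
begin

lemma section_factor: "z \<in> ZX \<Longrightarrow> \<exists>z'\<in>ZY. \<forall>y\<in>Y. z' y = inverse (\<epsilon> (\<sigma> y)) * z (\<sigma> y)"
proof -
  assume "z \<in> ZX"
  then obtain z' where z': "z' \<in> ZY" "\<forall>x\<in>X. z x = \<epsilon> x * z' (\<phi> x)" using factor by blast
  have "z' y = inverse (\<epsilon> (\<sigma> y)) * z (\<sigma> y)" if "y \<in> Y" for y
    using z'(2) \<sigma>[OF that] \<phi>\<sigma>[OF that] \<epsilon>\<sigma>[OF that] by simp
  with z'(1) show ?thesis by blast
qed

text \<open>Lift along the section \<open>\<sigma>\<close>, decompose there and push down again: the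
  composite is the identity on \<open>Y\<close>, so no correction arises.\<close>

lemma bounded_gen_image:
  assumes "bounded_gen X ZX r C"
  shows "bounded_gen Y ZY r C"
  unfolding bounded_gen_def
proof (intro allI impI)
  fix m F assume F: "vanishes Y ZY r {..<m} {..<m} F"
  let ?L = "push Y {..<m} \<sigma> (\<lambda>y. inverse (\<epsilon> (\<sigma> y))) F"
  have "vanishes X ZX r {..<m} {..<m} ?L"
    by (rule vanishes_push[where ZX = ZY, OF finY finX]) (simp_all add: \<sigma> section_factor F constant_off_def)
  then have "generated X ZX r C {..<m} ?L" using assms by (auto simp: bounded_gen_def)
  then have "generated Y ZY r C {..<m} (push X {..<m} \<phi> \<epsilon> ?L)"
    by (intro generated_push[where ZX = ZX, OF finX finY]) (simp_all add: \<phi> pull)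
  then show "generated Y ZY r C {..<m} F"
  proof (rule generated_cong)
    fix u assume u: "u \<in> PiE {..<m} (\<lambda>_. Y)"
    have "push X {..<m} \<phi> \<epsilon> ?L u =
        push Y {..<m} (\<lambda>y. \<phi> (\<sigma> y)) (\<lambda>y. inverse (\<epsilon> (\<sigma> y)) * \<epsilon> (\<sigma> y)) F u"
      by (rule push_push[OF finY finX]) (simp_all add: \<sigma>)
    also have "\<dots> = F u"
      by (rule push_id[OF finY _ _ _ u]) (simp_all add: \<phi>\<sigma> \<epsilon>\<sigma>)
    finally show "push X {..<m} \<phi> \<epsilon> ?L u = F u" .
  qed
qed

text \<open>The round trip through \<open>Y\<close> replaces every coordinate by its representative.
  This is not the identity on tensors, but the difference consists of linear relations, which
  \<open>1 \<le> C\<close> admits.\<close>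

lemma bounded_gen_preimage:
  assumes "bounded_gen Y ZY r C" "1 \<le> C"
  shows "bounded_gen X ZX r C"
  unfolding bounded_gen_def
proof (intro allI impI)
  fix m F assume F: "vanishes X ZX r {..<m} {..<m} F"
  let ?P = "push X {..<m} \<phi> \<epsilon> F"
  let ?L = "push Y {..<m} \<sigma> (\<lambda>y. inverse (\<epsilon> (\<sigma> y))) ?P"
  have "vanishes Y ZY r {..<m} {..<m} ?P"
    by (rule vanishes_push[where ZX = ZX, OF finX finY]) (simp_all add: \<phi> pull F constant_off_def)
  then have "generated Y ZY r C {..<m} ?P" using assms by (auto simp: bounded_gen_def)
  then have 1: "generated X ZX r C {..<m} ?L"
    by (intro generated_push[where ZX = ZY, OF finY finX]) (simp_all add: \<sigma> section_factor)
  have L: "?L u = push X {..<m} (\<lambda>x. \<sigma> (\<phi> x)) (\<lambda>x. \<epsilon> x * inverse (\<epsilon> (\<sigma> (\<phi> x)))) F u" for u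
    by (rule push_push[OF finX finY]) (simp_all add: \<phi>)
  have 2: "generated X ZX r C {..<m} (\<lambda>u. F u - ?L u)"
    unfolding L
  proof (rule generated_push_diff[OF finX _ assms(2)])
    fix z x assume z: "z \<in> ZX" and x: "x \<in> X"
    obtain z' where z': "\<forall>x\<in>X. z x = \<epsilon> x * z' (\<phi> x)" using factor[OF z] by auto
    show "z x = \<epsilon> x * inverse (\<epsilon> (\<sigma> (\<phi> x))) * z (\<sigma> (\<phi> x))"
    proof (cases "\<epsilon> x = 0")
      case False
      with z' x \<sigma>[OF \<phi>[OF x False]] \<phi>\<sigma>[OF \<phi>[OF x False]] \<epsilon>\<sigma>[OF \<phi>[OF x False]]
      show ?thesis by simp
    qed (use z' x in simp)
  qed (simp_all add: \<phi> \<sigma>)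
  from generated_add[OF 1 2] show "generated X ZX r C {..<m} F" by simp
qed

end

section \<open>Letters, polarization and a Capelli-type identity\<close>

text \<open>A polynomial with infinitely many zeros has zero coefficients; characteristic 0 makes
  the field infinite.\<close>

lemma power_sum_vanish:
  fixes a :: "'i \<Rightarrow> 'k::field_char_0"
  assumes "finite I" "\<And>u. (\<Sum>i\<in>I. a i * u ^ \<nu> i) = 0"
  shows "(\<Sum>i | i \<in> I \<and> \<nu> i = j. a i) = 0"
proof -
  define p where "p = (\<Sum>i\<in>I. monom (a i) (\<nu> i))"
  have "poly p u = 0" for u
    using assms(2) by (simp add: p_def poly_sum poly_monom)
  then have "p = 0" using poly_all_0_iff_0 by blast
  then have "0 = coeff p j" by simp
  also have "\<dots> = (\<Sum>i | i \<in> I \<and> \<nu> i = j. a i)"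
    using assms(1) by (simp add: p_def coeff_sum coeff_monom sum.If_cases Int_def)
  finally show ?thesis by simp
qed

text \<open>Variables are separated one at a time: with the others fixed, the coefficient of each
  power of the new variable vanishes.\<close>

lemma multi_power_sum_vanish:
  fixes a :: "'i \<Rightarrow> 'k::field_char_0"
  assumes "finite T" "finite I" "\<And>u. (\<Sum>i\<in>I. a i * (\<Prod>t\<in>T. u t ^ \<nu> i t)) = 0"
  shows "(\<Sum>i | i \<in> I \<and> (\<forall>t\<in>T. \<nu> i t = \<mu> t). a i) = 0"
  using assms
proof (induction T arbitrary: I rule: finite_induct)
  case empty
  then show ?case by simp
next
  case (insert t T)
  let ?I = "{i \<in> I. \<nu> i t = \<mu> t}"
  have "(\<Sum>i\<in>?I. a i * (\<Prod>s\<in>T. u s ^ \<nu> i s)) = 0" for u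
  proof (rule power_sum_vanish[OF insert.prems(1)])
    fix v
    have "(\<Prod>s\<in>T. (u(t := v)) s ^ \<nu> i s) = (\<Prod>s\<in>T. u s ^ \<nu> i s)" for i
      using insert.hyps by (intro prod.cong) auto
    then show "(\<Sum>i\<in>I. a i * (\<Prod>s\<in>T. u s ^ \<nu> i s) * v ^ \<nu> i t) = 0"
      using insert.prems(2)[of "u(t := v)"] insert.hyps by (simp add: mult_ac)
  qed
  then have "(\<Sum>i | i \<in> ?I \<and> (\<forall>s\<in>T. \<nu> i s = \<mu> s). a i) = 0"
    using insert.prems(1) by (intro insert.IH) auto
  then show ?case by (simp add: conj_ac)
qed

text \<open>The hypothesis is an identically vanishing polynomial in u, and the conclusion is its
  derivative at 0 by the product rule. It passes from one-parameter groups to derivations.\<close>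

lemma linear_coeff_vanish:
  fixes c :: "'i \<Rightarrow> 'k::field_char_0"
  assumes "finite A" "\<And>u. (\<Sum>i\<in>I. c i * (\<Prod>p\<in>A. \<alpha> i p + u * \<beta> i p)) = 0"
  shows "(\<Sum>i\<in>I. c i * (\<Sum>p\<in>A. \<beta> i p * (\<Prod>p'\<in>A - {p}. \<alpha> i p'))) = 0"
proof -
  define f where "f = (\<Sum>i\<in>I. smult (c i) (\<Prod>p\<in>A. [:\<alpha> i p, \<beta> i p:]))"
  have "poly f u = 0" for u
    using assms(2) by (simp add: f_def poly_sum poly_prod mult_ac)
  then have "f = 0" using poly_all_0_iff_0 by blast
  then have "0 = poly (pderiv f) 0" by simp
  also have "\<dots> = (\<Sum>i\<in>I. c i * (\<Sum>p\<in>A. \<beta> i p * (\<Prod>p'\<in>A - {p}. \<alpha> i p')))"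
    by (simp add: f_def higher_pderiv_sum[of 1, unfolded funpow_0 One_nat_def funpow.simps o_id o_def id_def] pderiv_smult pderiv_prod poly_sum poly_prod pderiv_pCons mult_ac)
  finally show ?thesis by simp
qed

section \<open>Words with letters at positions\<close>

abbreviation letter :: "(nat \<Rightarrow> 'q \<Rightarrow> nat) \<Rightarrow> nat \<times> 'q \<Rightarrow> nat" where
  "letter x p \<equiv> x (fst p) (snd p)"

definition update :: "(nat \<Rightarrow> 'q \<Rightarrow> nat) \<Rightarrow> nat \<times> 'q \<Rightarrow> nat \<Rightarrow> nat \<Rightarrow> 'q \<Rightarrow> nat" where
  "update x p b = x(fst p := (x (fst p))(snd p := b))"

definition modify :: "(nat \<Rightarrow> 'q \<Rightarrow> nat) \<Rightarrow> (nat \<times> 'q) set \<Rightarrow> (nat \<Rightarrow> nat) \<Rightarrow> nat \<Rightarrow> 'q \<Rightarrow> nat" where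
  "modify x P \<sigma> = (\<lambda>s q. if (s, q) \<in> P then \<sigma> (x s q) else x s q)"

lemma letter_update: "letter (update x p b) p' = (if p' = p then b else letter x p')"
  by (cases p; cases p') (auto simp: update_def)

lemma letter_modify: "letter (modify x P \<sigma>) p = (if p \<in> P then \<sigma> (letter x p) else letter x p)"
  by (cases p) (auto simp: modify_def)

lemma letter_ext: "(\<And>p. letter x p = letter y p) \<Longrightarrow> x = y"
  by (auto simp: fun_eq_iff)

lemma update_update: "update (update x p a) p b = update x p b"
  by (rule letter_ext) (auto simp: letter_update)

lemma update_self: "letter x p = a \<Longrightarrow> update x p a = x"
  by (rule letter_ext) (auto simp: letter_update)

text \<open>A coordinate seen as a polynomial in the entries of a matrix: a letter selects the
  matrix row, and each term \<kappa> assigns to a position a column below \<open>E\<close>. The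
  number of positions is unrestricted; only the number of columns enters the bound.\<close>

locale word_points =
  fixes Pos :: "'q set" and K :: "'m set" and g :: "'m \<Rightarrow> 'k::field_char_0"
    and h :: "'m \<Rightarrow> 'q \<Rightarrow> nat" and E :: nat
  assumes finPos: "finite Pos" and finK: "finite K"
    and h_less: "\<And>\<kappa> q. \<kappa> \<in> K \<Longrightarrow> q \<in> Pos \<Longrightarrow> h \<kappa> q < E"
begin

definition word_coord :: "(nat \<Rightarrow> nat \<Rightarrow> 'k) \<Rightarrow> ('q \<Rightarrow> nat) \<Rightarrow> 'k" where
  "word_coord M w = (\<Sum>\<kappa>\<in>K. g \<kappa> * (\<Prod>q\<in>Pos. M (w q) (h \<kappa> q)))"

definition words :: "nat set \<Rightarrow> ('q \<Rightarrow> nat) set" where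
  "words L = PiE Pos (\<lambda>_. L)"

abbreviation "tens R n \<equiv> PiE R (\<lambda>_. words {..<n})"

lemma finite_words: "finite L \<Longrightarrow> finite (words L)"
  unfolding words_def using finPos by (auto intro: finite_PiE)

lemma finite_tens: "finite R \<Longrightarrow> finite (tens R n)"
  using finite_words by (auto intro: finite_PiE)

lemma tens_iff: "x \<in> PiE R (\<lambda>_. words L) \<longleftrightarrow>
   (\<forall>p\<in>R \<times> Pos. letter x p \<in> L) \<and> (\<forall>s\<in>R. \<forall>q. q \<notin> Pos \<longrightarrow> x s q = undefined) \<and>
   (\<forall>s. s \<notin> R \<longrightarrow> x s = undefined)"
  by (auto simp: words_def PiE_iff extensional_def)

lemma update_tens:
  assumes "x \<in> PiE R (\<lambda>_. words L)" "p \<in> R \<times> Pos" "b \<in> L"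
  shows "update x p b \<in> PiE R (\<lambda>_. words L)"
  using assms unfolding tens_iff by (auto simp: update_def)

lemma modify_tens:
  assumes "x \<in> PiE R (\<lambda>_. words L)" "P \<subseteq> R \<times> Pos" "\<And>p. p \<in> P \<Longrightarrow> \<sigma> (letter x p) \<in> L"
  shows "modify x P \<sigma> \<in> PiE R (\<lambda>_. words L)"
  using assms(1) unfolding tens_iff
  by (auto simp: modify_def fun_eq_iff dest: assms(3) subsetD[OF assms(2)])

lemma prod_word_coord:
  assumes "finite S"
  shows "(\<Prod>s\<in>S. word_coord (M s) (x s)) = (\<Sum>\<kappa>\<in>PiE S (\<lambda>_. K). (\<Prod>s\<in>S. g (\<kappa> s)) *
    (\<Prod>p\<in>S \<times> Pos. M (fst p) (letter x p) (h (\<kappa> (fst p)) (snd p))))"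
  unfolding word_coord_def
  by (subst prod_sum_PiE)
    (use assms finK finPos in \<open>auto simp: prod.distrib prod.cartesian_product' intro!: sum.cong\<close>)

lemma vanishes_wordsD:
  assumes "vanishes X (range word_coord) r R S F" "\<And>s. \<tau> s < r"
  shows "(\<Sum>x\<in>PiE R (\<lambda>_. X). F x * (\<Prod>s\<in>S. word_coord (M (\<tau> s)) (x s))) = 0"
  using vanishesD[OF assms(1), of "\<lambda>t. word_coord (M t)" \<tau>] assms(2) by auto

lemma vanishes_wordsI:
  assumes "\<And>M \<tau>. (\<And>s. \<tau> s < r) \<Longrightarrow>
     (\<Sum>x\<in>PiE R (\<lambda>_. X). F x * (\<Prod>s\<in>S. word_coord (M (\<tau> s)) (x s))) = 0"
  shows "vanishes X (range word_coord) r R S F"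
proof (rule vanishesI)
  fix z and \<tau> :: "nat \<Rightarrow> nat"
  assume z: "\<And>t. t < r \<Longrightarrow> z t \<in> range word_coord" and \<tau>: "\<And>s. \<tau> s < r"
  then have "\<forall>t<r. \<exists>M. z t = word_coord M" by blast
  then obtain M where M: "\<And>t. t < r \<Longrightarrow> z t = word_coord (M t)" by metis
  have "(\<Sum>x\<in>PiE R (\<lambda>_. X). F x * (\<Prod>s\<in>S. z (\<tau> s) (x s))) =
     (\<Sum>x\<in>PiE R (\<lambda>_. X). F x * (\<Prod>s\<in>S. word_coord (M (\<tau> s)) (x s)))"
    using M[OF \<tau>] by simp
  also have "\<dots> = 0" using assms \<tau> by blast
  finally show "(\<Sum>x\<in>PiE R (\<lambda>_. X). F x * (\<Prod>s\<in>S. z (\<tau> s) (x s))) = 0" .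
qed

section \<open>Polarization operators\<close>

text \<open>On basis tensors this turns one occurrence of b into a, summed over the occurrences: the
  action of an elementary matrix of the general linear Lie algebra. The formula looks reversed
  because it gives the coefficient at the new word x.\<close>

definition polarize :: "nat set \<Rightarrow> nat \<Rightarrow> nat \<Rightarrow> ((nat \<Rightarrow> 'q \<Rightarrow> nat) \<Rightarrow> 'k) \<Rightarrow> (nat \<Rightarrow> 'q \<Rightarrow> nat) \<Rightarrow> 'k" where
  "polarize S a b F x = (\<Sum>p\<in>S \<times> Pos. if letter x p = a then F (update x p b) else 0)"

lemma sum_update_swap:
  assumes R: "finite R" and p: "p \<in> R \<times> Pos" and "a < n" "b < n"
  shows "(\<Sum>x\<in>tens R n. if letter x p = a then f (update x p b) x else 0) =
    (\<Sum>x\<in>tens R n. if letter x p = b then f x (update x p a) else 0)"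
proof -
  have "(\<Sum>x | x \<in> tens R n \<and> letter x p = a. f (update x p b) x) =
      (\<Sum>x | x \<in> tens R n \<and> letter x p = b. f x (update x p a))"
    by (rule sum.reindex_bij_witness[of _ "\<lambda>x. update x p a" "\<lambda>x. update x p b"])
      (use assms update_tens[OF _ p, of _ "{..<n}"] in \<open>auto simp: update_update update_self letter_update simp del: PiE_iff\<close>)
  then show ?thesis
    using finite_tens[OF R] by (simp add: sum.If_cases Int_def)
qed

text \<open>The set of points is stable under row operations on the matrices. Adding u times row a
  to row b keeps the evaluation zero for all u, and the coefficient of u is the evaluation of the
  polarized tensor.\<close>

lemma vanishes_polarize:
  assumes R: "finite R" and S: "S \<subseteq> R" and ab: "a < n" "b < n"
    and F: "vanishes (words {..<n}) (range word_coord) r R S F"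
  shows "vanishes (words {..<n}) (range word_coord) r R S (polarize S a b F)"
proof (rule vanishes_wordsI)
  fix M :: "nat \<Rightarrow> nat \<Rightarrow> nat \<Rightarrow> 'k" and \<tau> :: "nat \<Rightarrow> nat" assume \<tau>: "\<And>s. \<tau> s < r"
  have fS: "finite S" using finite_subset[OF S R] .
  let ?A = "S \<times> Pos" and ?L = "PiE S (\<lambda>_. K)"
  define m where "m \<kappa> p c = M (\<tau> (fst p)) c (h (\<kappa> (fst p)) (snd p))"
    for \<kappa> :: "nat \<Rightarrow> 'm" and p :: "nat \<times> 'q" and c
  define G where "G \<kappa> = (\<Prod>s\<in>S. g (\<kappa> s))" for \<kappa> :: "nat \<Rightarrow> 'm"
  define ev where "ev y = (\<Prod>s\<in>S. word_coord (M (\<tau> s)) (y s))" for y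
  have ev: "ev y = (\<Sum>\<kappa>\<in>?L. G \<kappa> * (\<Prod>p\<in>?A. m \<kappa> p (letter y p)))" for y
    unfolding ev_def prod_word_coord[OF fS, of "\<lambda>s. M (\<tau> s)"] by (simp add: m_def G_def)
  let ?\<alpha> = "\<lambda>i p. m (snd i) p (letter (fst i) p)"
  let ?\<beta> = "\<lambda>i p. if letter (fst i) p = b then m (snd i) p a else 0"
  have "(\<Sum>i\<in>tens R n \<times> ?L. F (fst i) * G (snd i) * (\<Prod>p\<in>?A. ?\<alpha> i p + u * ?\<beta> i p)) = 0" for u
  proof -
    define M' where "M' t c k = M t c k + u * (if c = b then M t a k else 0)" for t c k
    have "0 = (\<Sum>x\<in>tens R n. F x * (\<Prod>s\<in>S. word_coord (M' (\<tau> s)) (x s)))"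
      using vanishes_wordsD[OF F \<tau>] by simp
    also have "\<dots> = (\<Sum>x\<in>tens R n. \<Sum>\<kappa>\<in>?L. F x * G \<kappa> *
        (\<Prod>p\<in>?A. m \<kappa> p (letter x p) + u * (if letter x p = b then m \<kappa> p a else 0)))"
      unfolding prod_word_coord[OF fS, of "\<lambda>s. M' (\<tau> s)"]
      by (simp add: m_def G_def M'_def sum_distrib_left mult.assoc cong: if_cong)
    finally show ?thesis
      unfolding sum.cartesian_product'[of _ "tens R n" ?L] fst_conv snd_conv by simp
  qed
  from linear_coeff_vanish[OF _ this]
  have "0 = (\<Sum>i\<in>tens R n \<times> ?L. F (fst i) * G (snd i) *
     (\<Sum>p\<in>?A. ?\<beta> i p * (\<Prod>p'\<in>?A - {p}. ?\<alpha> i p')))"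
    using fS finPos by simp
  also have "\<dots> = (\<Sum>x\<in>tens R n. \<Sum>\<kappa>\<in>?L. F x * G \<kappa> *
     (\<Sum>p\<in>?A. if letter x p = b then \<Prod>p'\<in>?A. m \<kappa> p' (letter (update x p a) p') else 0))"
    unfolding sum.cartesian_product'[of _ "tens R n" ?L] fst_conv snd_conv
  proof (intro sum.cong refl arg_cong2[of _ _ _ _ "(*)"])
    fix x \<kappa> p assume p: "p \<in> ?A"
    have "(\<Prod>p'\<in>?A. m \<kappa> p' (letter (update x p a) p')) =
        m \<kappa> p (letter (update x p a) p) * (\<Prod>p'\<in>?A - {p}. m \<kappa> p' (letter (update x p a) p'))"
      using p fS finPos by (intro prod.remove) auto
    also have "\<dots> = m \<kappa> p a * (\<Prod>p'\<in>?A - {p}. m \<kappa> p' (letter x p'))"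
      by (simp add: letter_update)
    finally show "(if letter x p = b then m \<kappa> p a else 0) * (\<Prod>p'\<in>?A - {p}. m \<kappa> p' (letter x p')) =
        (if letter x p = b then \<Prod>p'\<in>?A. m \<kappa> p' (letter (update x p a) p') else 0)" by simp
  qed
  also have "\<dots> = (\<Sum>x\<in>tens R n. \<Sum>p\<in>?A. if letter x p = b then F x * ev (update x p a) else 0)"
  proof (rule sum.cong[OF refl])
    fix x
    have "(\<Sum>\<kappa>\<in>?L. F x * G \<kappa> *
      (\<Sum>p\<in>?A. if letter x p = b then \<Prod>p'\<in>?A. m \<kappa> p' (letter (update x p a) p') else 0)) =
      (\<Sum>p\<in>?A. \<Sum>\<kappa>\<in>?L. if letter x p = b then F x * (G \<kappa> * (\<Prod>p'\<in>?A. m \<kappa> p' (letter (update x p a) p'))) else 0)"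
      by (subst sum.swap) (auto simp: sum_distrib_left mult.assoc intro!: sum.cong)
    also have "\<dots> = (\<Sum>p\<in>?A. if letter x p = b then F x * ev (update x p a) else 0)"
      unfolding ev by (intro sum.cong) (auto simp: sum_distrib_left)
    finally show "(\<Sum>\<kappa>\<in>?L. F x * G \<kappa> *
      (\<Sum>p\<in>?A. if letter x p = b then \<Prod>p'\<in>?A. m \<kappa> p' (letter (update x p a) p') else 0)) =
      (\<Sum>p\<in>?A. if letter x p = b then F x * ev (update x p a) else 0)" .
  qed
  also have "\<dots> = (\<Sum>p\<in>?A. \<Sum>x\<in>tens R n. if letter x p = b then F x * ev (update x p a) else 0)"
    by (rule sum.swap)
  \<comment> \<open>Moves the change of letter from the evaluated word over to the
    coefficient.\<close>
  also have "\<dots> = (\<Sum>p\<in>?A. \<Sum>x\<in>tens R n. if letter x p = a then F (update x p b) * ev x else 0)"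
  proof (rule sum.cong[OF refl])
    fix p assume "p \<in> ?A"
    then have p: "p \<in> R \<times> Pos" using S by auto
    show "(\<Sum>x\<in>tens R n. if letter x p = b then F x * ev (update x p a) else 0) =
       (\<Sum>x\<in>tens R n. if letter x p = a then F (update x p b) * ev x else 0)"
      using sum_update_swap[OF R p ab, of "\<lambda>y x. F y * ev x"] by simp
  qed
  also have "\<dots> = (\<Sum>x\<in>tens R n. polarize S a b F x * ev x)"
    by (subst sum.swap) (auto simp: polarize_def sum_distrib_right intro!: sum.cong)
  finally show "(\<Sum>x\<in>tens R n. polarize S a b F x * (\<Prod>s\<in>S. word_coord (M (\<tau> s)) (x s))) = 0"
    by (simp add: ev_def)
qed

text \<open>Leibniz rule: positions in the rows \<open>S\<close> polarize the vanishing part, while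
  a position in a constant row merely changes the inserted constant. Neither increases the number of
  active rows.\<close>

lemma generated_polarize:
  assumes R: "finite R" and ab: "a < n" "b < n"
    and F: "generated (words {..<n}) (range word_coord) r C R F"
  shows "generated (words {..<n}) (range word_coord) r C R (polarize R a b F)"
  using F
proof induction
  case (generated_zero F)
  show ?case
  proof (rule generated.generated_zero)
    fix x assume x: "x \<in> tens R n"
    have "F (update x p b) = 0" if "p \<in> R \<times> Pos" for p
      using generated_zero update_tens[OF x that] ab by blast
    then show "polarize R a b F x = 0" by (simp add: polarize_def sum.neutral)
  qed
next
  case (generated_step F S c G H)
  let ?g = "generated (words {..<n}) (range word_coord) r C R"
  have fS: "finite S" using finite_subset[OF generated_step.hyps(2) R] .
  have G0: "x s = c s" if "x \<in> tens R n" "G x \<noteq> 0" "s \<in> R - S" for x s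
    using generated_step.hyps(4) that by (auto simp: constant_off_def)
  have update_in: "update x p b \<in> tens R n" if "x \<in> tens R n" "p \<in> R \<times> Pos" for x p
    using update_tens[OF that] ab by auto
  have "?g (polarize S a b G)"
  proof (rule generated_single[where S = S and c = c])
    show "vanishes (words {..<n}) (range word_coord) r R S (polarize S a b G)"
      by (rule vanishes_polarize[OF R generated_step.hyps(2) ab generated_step.hyps(5)])
    show "constant_off (words {..<n}) R S c (polarize S a b G)"
      unfolding constant_off_def
    proof (intro ballI impI)
      fix x s assume x: "x \<in> tens R n" and nz: "polarize S a b G x \<noteq> 0" and s: "s \<in> R - S"
      from nz obtain p where p: "p \<in> S \<times> Pos" "(if letter x p = a then G (update x p b) else 0) \<noteq> 0"
        unfolding polarize_def by (rule sum.not_neutral_contains_not_neutral)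
      have pR: "p \<in> R \<times> Pos" using p generated_step.hyps(2) by auto
      have "update x p b s = c s"
        by (rule G0[OF update_in[OF x pR] _ s]) (use p(2) in \<open>simp split: if_splits\<close>)
      moreover have "s \<noteq> fst p" using p s by auto
      ultimately show "x s = c s" by (simp add: update_def)
    qed
  qed (use generated_step.hyps(2,3) in simp_all)
  \<comment> \<open>Each position outside \<open>S\<close> gives a tensor whose constant row carries
    a instead of b there, or zero if the constant had no b at that place.\<close>
  moreover have "?g (\<lambda>x. \<Sum>p\<in>(R - S) \<times> Pos. if letter x p = a then G (update x p b) else 0)"
  proof (rule generated_sum)
    fix p assume p: "p \<in> (R - S) \<times> Pos"
    then have pR: "p \<in> R \<times> Pos" by auto
    show "?g (\<lambda>x. if letter x p = a then G (update x p b) else 0)"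
    proof (rule generated_single[where S = S and c = "update c p a"])
      show "vanishes (words {..<n}) (range word_coord) r R S (\<lambda>x. if letter x p = a then G (update x p b) else 0)"
      proof (rule vanishes_wordsI)
        fix M :: "nat \<Rightarrow> nat \<Rightarrow> nat \<Rightarrow> 'k" and \<tau> :: "nat \<Rightarrow> nat" assume \<tau>: "\<And>s. \<tau> s < r"
        define ev where "ev y = (\<Prod>s\<in>S. word_coord (M (\<tau> s)) (y s))" for y
        have ev: "ev (update x p a) = ev x" for x
          unfolding ev_def using p by (intro prod.cong) (auto simp: update_def)
        have "(\<Sum>x\<in>tens R n. (if letter x p = a then G (update x p b) else 0) * ev x) =
          (\<Sum>x\<in>tens R n. if letter x p = a then G (update x p b) * ev x else 0)"
          by (intro sum.cong) auto
        also have "\<dots> = (\<Sum>x\<in>tens R n. if letter x p = b then G x * ev x else 0)"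
          using sum_update_swap[OF R pR ab, of "\<lambda>y x. G y * ev x"] by (simp add: ev cong: if_cong)
        also have "\<dots> = (\<Sum>x\<in>tens R n. if letter c p = b then G x * ev x else 0)"
        proof (intro sum.cong refl)
          fix x assume x: "x \<in> tens R n"
          have "letter x p = letter c p" if "G x \<noteq> 0" 
          by (rule fun_cong[OF G0[OF x that]]) (use p in auto)
          then show "(if letter x p = b then G x * ev x else 0) = (if letter c p = b then G x * ev x else 0)"
            by (cases "G x = 0") auto
        qed
        also have "\<dots> = 0"
          using vanishes_wordsD[where \<tau> = \<tau> and M = M, OF generated_step.hyps(5) \<tau>]
          by (cases "letter c p = b") (simp_all add: ev_def)
        finally show "(\<Sum>x\<in>tens R n. (if letter x p = a then G (update x p b) else 0) *
           (\<Prod>s\<in>S. word_coord (M (\<tau> s)) (x s))) = 0" by (simp add: ev_def)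
      qed
      show "constant_off (words {..<n}) R S (update c p a) (\<lambda>x. if letter x p = a then G (update x p b) else 0)"
        unfolding constant_off_def
      proof (intro ballI impI)
        fix x s assume x: "x \<in> tens R n" and s: "s \<in> R - S"
          and nz: "(if letter x p = a then G (update x p b) else 0) \<noteq> 0"
        from nz have a: "letter x p = a" and nz': "G (update x p b) \<noteq> 0" by (simp_all split: if_splits)
        have "update x p b s = c s" by (rule G0[OF update_in[OF x pR] nz' s])
        moreover have "update y p a s = (if s = fst p then (y s)(snd p := a) else y s)" for y
          by (simp add: update_def)
        ultimately have "update (update x p b) p a s = update c p a s" by presburger
        then show "x s = update c p a s" by (simp add: update_update update_self[where x = x and p = p, OF a])
      qed
    qed (use generated_step.hyps(2,3) in simp_all)
  qed
  ultimately have "?g (\<lambda>x. polarize R a b F x + (polarize S a b G x +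
      (\<Sum>p\<in>(R - S) \<times> Pos. if letter x p = a then G (update x p b) else 0)))"
    by (rule generated_add[OF generated_step.IH generated_add])
  then show ?case
  proof (rule generated_cong)
    fix x assume x: "x \<in> tens R n"
    have un: "R \<times> Pos = S \<times> Pos \<union> (R - S) \<times> Pos" using generated_step.hyps(2) by auto
    have "polarize R a b G x = polarize S a b G x +
        (\<Sum>p\<in>(R - S) \<times> Pos. if letter x p = a then G (update x p b) else 0)"
      unfolding polarize_def un using R fS finPos by (intro sum.union_disjoint) auto
    moreover have "polarize R a b H x = polarize R a b F x + polarize R a b G x"
      unfolding polarize_def sum.distrib[symmetric]
      by (intro sum.cong refl) (use generated_step.hyps(6)[OF update_in[OF x]] in simp)
    ultimately show "polarize R a b F x + (polarize S a b G x +
      (\<Sum>p\<in>(R - S) \<times> Pos. if letter x p = a then G (update x p b) else 0)) = polarize R a b H x" by simp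
  qed
qed

text \<open>The normally ordered product of the polarizations \<open>polarize R a (\<sigma> a)\<close> for a in A: the letters
  are replaced at distinct positions P, one for each element of A.\<close>

definition replace :: "nat set \<Rightarrow> (nat \<Rightarrow> nat) \<Rightarrow> nat set \<Rightarrow> ((nat \<Rightarrow> 'q \<Rightarrow> nat) \<Rightarrow> 'k) \<Rightarrow> (nat \<Rightarrow> 'q \<Rightarrow> nat) \<Rightarrow> 'k" where
  "replace R \<sigma> A F x = (\<Sum>P | P \<subseteq> R \<times> Pos \<and> bij_betw (letter x) P A. F (modify x P \<sigma>))"

lemma finite_subsets: "finite R \<Longrightarrow> finite {P. P \<subseteq> R \<times> Pos \<and> Q P}"
  using finPos by (auto intro: finite_subset[of _ "Pow (R \<times> Pos)"])

lemma replace_empty: "finite R \<Longrightarrow> replace R \<sigma> {} F x = F x"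
proof -
  have "{P. P \<subseteq> R \<times> Pos \<and> bij_betw (letter x) P {}} = {{}}" by (auto simp: bij_betw_def)
  moreover have "modify x {} \<sigma> = x" by (auto simp: modify_def)
  ultimately show ?thesis by (simp add: replace_def)
qed

lemma replace_cong:
  assumes "\<And>a. a \<in> A \<Longrightarrow> \<sigma> a = \<sigma>' a"
  shows "replace R \<sigma> A F x = replace R \<sigma>' A F x"
  unfolding replace_def
proof (rule sum.cong[OF refl])
  fix P assume "P \<in> {P. P \<subseteq> R \<times> Pos \<and> bij_betw (letter x) P A}"
  then have "letter x p \<in> A" if "p \<in> P" for p using that by (auto simp: bij_betw_def)
  then have "modify x P \<sigma> = modify x P \<sigma>'" using assms by (intro letter_ext) (auto simp: letter_modify)
  then show "F (modify x P \<sigma>) = F (modify x P \<sigma>')" by simp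
qed

text \<open>After replacement at \<open>P\<close>, the polarization for a hits either a position
  outside \<open>P\<close>, which extends \<open>P\<close>, or a letter that the replacement has
  just produced, which happens when \<open>\<sigma> c = a\<close>. Such a c ends up as
  \<open>\<sigma> a\<close>, and these contractions are subtracted.\<close>

lemma replace_insert:
  assumes R: "finite R" and A: "finite A" "a \<notin> A"
  shows "replace R \<sigma> (insert a A) F x = replace R \<sigma> A (polarize R a (\<sigma> a) F) x -
    (\<Sum>c | c \<in> A \<and> \<sigma> c = a. replace R (\<sigma>(c := \<sigma> a)) A F x)"
proof -
  let ?Q = "R \<times> Pos"
  let ?B = "\<lambda>A. {P. P \<subseteq> ?Q \<and> bij_betw (letter x) P A}"
  have fQ: "finite ?Q" using R finPos by auto
  have inner: "polarize R a (\<sigma> a) F (modify x P \<sigma>) =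
      (\<Sum>p | p \<in> ?Q - P \<and> letter x p = a. F (modify x (insert p P) \<sigma>)) +
      (\<Sum>c | c \<in> A \<and> \<sigma> c = a. F (modify x P (\<sigma>(c := \<sigma> a))))"
    if P: "P \<in> ?B A" for P
  proof -
    have sub: "P \<subseteq> ?Q" and bij: "bij_betw (letter x) P A" using P by auto
    have "polarize R a (\<sigma> a) F (modify x P \<sigma>) =
      (\<Sum>p\<in>?Q - P. if letter (modify x P \<sigma>) p = a then F (update (modify x P \<sigma>) p (\<sigma> a)) else 0) +
      (\<Sum>p\<in>P. if letter (modify x P \<sigma>) p = a then F (update (modify x P \<sigma>) p (\<sigma> a)) else 0)"
      unfolding polarize_def by (rule sum.subset_diff[OF sub fQ])
    also have "(\<Sum>p\<in>?Q - P. if letter (modify x P \<sigma>) p = a then F (update (modify x P \<sigma>) p (\<sigma> a)) else 0) =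
      (\<Sum>p\<in>?Q - P. if letter x p = a then F (modify x (insert p P) \<sigma>) else 0)"
    proof (rule sum.cong[OF refl])
      fix p assume p: "p \<in> ?Q - P"
      have "update (modify x P \<sigma>) p (\<sigma> a) = modify x (insert p P) \<sigma>" if "letter x p = a"
        by (rule letter_ext) (use p that in \<open>auto simp: letter_update letter_modify\<close>)
      then show "(if letter (modify x P \<sigma>) p = a then F (update (modify x P \<sigma>) p (\<sigma> a)) else 0) =
        (if letter x p = a then F (modify x (insert p P) \<sigma>) else 0)"
        using p by (simp add: letter_modify)
    qed
    also have "\<dots> = (\<Sum>p | p \<in> ?Q - P \<and> letter x p = a. F (modify x (insert p P) \<sigma>))"
      using fQ by (simp add: sum.If_cases Int_def)
    also have "(\<Sum>p\<in>P. if letter (modify x P \<sigma>) p = a then F (update (modify x P \<sigma>) p (\<sigma> a)) else 0) =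
      (\<Sum>p\<in>P. (\<lambda>c. if \<sigma> c = a then F (modify x P (\<sigma>(c := \<sigma> a))) else 0) (letter x p))"
    proof (rule sum.cong[OF refl])
      fix p assume p: "p \<in> P"
      have "letter x p' = letter x p \<longleftrightarrow> p' = p" if "p' \<in> P" for p'
        using bij p that by (auto simp: bij_betw_def inj_on_def)
      then have "update (modify x P \<sigma>) p (\<sigma> a) = modify x P (\<sigma>(letter x p := \<sigma> a))"
        by (intro letter_ext) (use p in \<open>simp add: letter_update letter_modify\<close>)
      then show "(if letter (modify x P \<sigma>) p = a then F (update (modify x P \<sigma>) p (\<sigma> a)) else 0) =
        (\<lambda>c. if \<sigma> c = a then F (modify x P (\<sigma>(c := \<sigma> a))) else 0) (letter x p)"
        using p by (simp add: letter_modify)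
    qed
    also have "\<dots> = (\<Sum>c\<in>A. if \<sigma> c = a then F (modify x P (\<sigma>(c := \<sigma> a))) else 0)"
      by (rule sum.reindex_bij_betw[OF bij])
    also have "\<dots> = (\<Sum>c | c \<in> A \<and> \<sigma> c = a. F (modify x P (\<sigma>(c := \<sigma> a))))"
      using A by (simp add: sum.If_cases Int_def)
    finally show ?thesis .
  qed
  have "replace R \<sigma> A (polarize R a (\<sigma> a) F) x =
     (\<Sum>P\<in>?B A. \<Sum>p | p \<in> ?Q - P \<and> letter x p = a. F (modify x (insert p P) \<sigma>)) +
     (\<Sum>P\<in>?B A. \<Sum>c | c \<in> A \<and> \<sigma> c = a. F (modify x P (\<sigma>(c := \<sigma> a))))"
    unfolding replace_def sum.distrib[symmetric] by (rule sum.cong[OF refl inner])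
  also have "(\<Sum>P\<in>?B A. \<Sum>c | c \<in> A \<and> \<sigma> c = a. F (modify x P (\<sigma>(c := \<sigma> a)))) =
     (\<Sum>c | c \<in> A \<and> \<sigma> c = a. replace R (\<sigma>(c := \<sigma> a)) A F x)"
    unfolding replace_def by (rule sum.swap)
  also have "(\<Sum>P\<in>?B A. \<Sum>p | p \<in> ?Q - P \<and> letter x p = a. F (modify x (insert p P) \<sigma>)) =
     (\<Sum>(P, p)\<in>Sigma (?B A) (\<lambda>P. {p. p \<in> ?Q - P \<and> letter x p = a}). F (modify x (insert p P) \<sigma>))"
    by (rule sum.Sigma) (use fQ finite_subsets[OF R] in simp_all)
  also have "\<dots> = (\<Sum>P\<in>?B (insert a A). F (modify x P \<sigma>))"
  \<comment> \<open>Pairs of a set \<open>P\<close> and a new position p correspond to the sets for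
    \<open>insert a A\<close>: p is recovered as the unique position carrying a.\<close>
  proof (rule sum.reindex_bij_witness[of _
        "\<lambda>P. (P - {inv_into P (letter x) a}, inv_into P (letter x) a)" "\<lambda>(P, p). insert p P"], goal_cases)
    case (1 i)
    then obtain P p where i: "i = (P, p)" and P: "P \<subseteq> ?Q" "bij_betw (letter x) P A"
      and p: "p \<in> ?Q" "p \<notin> P" "letter x p = a" by (elim SigmaE) blast
    have inj: "inj_on (letter x) (insert p P)"
      using P p A by (auto simp: bij_betw_def)
    then have "inv_into (insert p P) (letter x) a = p"
      using inv_into_f_f[OF inj, of p] p by simp
    moreover have "insert p P - {p} = P" using p by auto
    ultimately show ?case by (simp add: i)
  next
    case (2 i)
    then obtain P p where i: "i = (P, p)" and P: "P \<subseteq> ?Q" "bij_betw (letter x) P A"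
      and p: "p \<in> ?Q" "p \<notin> P" "letter x p = a" by (elim SigmaE) blast
    have "bij_betw (letter x) (insert p P) (insert (letter x p) A)"
      using notIn_Un_bij_betw[of p P "letter x" A] P p A by simp
    then show ?case using P p by (simp add: i)
  next
    case (3 P)
    then have "inv_into P (letter x) a \<in> P" by (intro inv_into_into) (simp add: bij_betw_def)
    then show ?case by (simp add: insert_absorb)
  next
    case (4 P)
    then have P: "P \<subseteq> ?Q" "bij_betw (letter x) P (insert a A)" by auto
    let ?p = "inv_into P (letter x) a"
    have "a \<in> letter x ` P" using P by (simp add: bij_betw_def)
    then have p: "?p \<in> P" "letter x ?p = a" by (rule inv_into_into, rule f_inv_into_f)
    have "letter x ` (P - {?p}) = letter x ` P - letter x ` {?p}"
      by (rule inj_on_image_set_diff[of _ P]) (use P p in \<open>auto simp: bij_betw_def\<close>)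
    also have "\<dots> = A" using P(2) p A by (simp add: bij_betw_def)
    finally have "bij_betw (letter x) (P - {?p}) A"
      using P(2) unfolding bij_betw_def by (blast intro: inj_on_diff)
    moreover have "P - {?p} \<subseteq> ?Q" "?p \<in> ?Q" using P(1) p(1) by blast+
    ultimately show ?case using p(2) by simp
  next
    case (5 i)
    then show ?case by (cases i) simp
  qed
  finally show ?thesis unfolding replace_def by simp
qed

text \<open>The contractions in the recursion turn \<open>\<sigma>\<close> into maps that need not
  be permutations, so arbitrary maps into the letters are allowed.\<close>

lemma generated_replace:
  assumes R: "finite R" and A: "finite A" "A \<subseteq> {..<n}" and \<sigma>: "\<And>a. a \<in> A \<Longrightarrow> \<sigma> a < n"
    and F: "generated (words {..<n}) (range word_coord) r C R F"
  shows "generated (words {..<n}) (range word_coord) r C R (replace R \<sigma> A F)"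
  using A \<sigma> F
proof (induction A arbitrary: \<sigma> F rule: finite_induct)
  case empty
  show ?case by (rule generated_cong[OF empty.prems(3)]) (simp add: replace_empty R)
next
  case (insert a A)
  have "generated (words {..<n}) (range word_coord) r C R (\<lambda>x. replace R \<sigma> A (polarize R a (\<sigma> a) F) x -
    (\<Sum>c | c \<in> A \<and> \<sigma> c = a. replace R (\<sigma>(c := \<sigma> a)) A F x))"
    using insert.prems by (intro generated_diff generated_sum insert.IH generated_polarize R) auto
  then show ?case by (rule generated_cong) (simp add: replace_insert[OF R insert.hyps])
qed

text \<open>Splitting off the smallest letter a of A leaves a polarization that raises the weight, except for
  a contraction that shortens the cycle of a by one and flips the sign of the permutation. Hence all
  permutations contribute with the same sign.\<close>

lemma replace_permutation:
  assumes R: "finite R" and A: "finite A" "A \<subseteq> {..<n}" and \<sigma>: "\<sigma> permutes A"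
    and pos: "\<And>a. a \<in> A \<Longrightarrow> 0 < \<alpha> a"
    and weight: "\<And>x a. x \<in> tens R n \<Longrightarrow> F x \<noteq> 0 \<Longrightarrow> a \<in> A \<Longrightarrow> card {p \<in> R \<times> Pos. letter x p = a} = \<alpha> a"
    and raise: "\<And>a b. a < b \<Longrightarrow> b < n \<Longrightarrow> generated (words {..<n}) (range word_coord) r C R (polarize R a b F)"
  shows "\<exists>k\<ge>1. generated (words {..<n}) (range word_coord) r C R
     (\<lambda>x. of_int (sign \<sigma>) * replace R \<sigma> A F x - of_nat k * F x)"
  using A \<sigma> pos weight
proof (induction "card A" arbitrary: A \<sigma>)
  case 0
  have A: "A = {}" using 0(1,2) by simp
  have \<sigma>: "\<sigma> = id" using 0(4) unfolding A permutes_empty .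
  show ?case
    unfolding A \<sigma> replace_empty[OF R] by (intro exI[of _ 1] conjI generated_zero) simp_all
next
  case (Suc N)
  let ?g = "generated (words {..<n}) (range word_coord) r C R"
  \<comment> \<open>With the smallest letter split off first, \<open>\<sigma> a\<close> is larger
    whenever it differs from a, so that \<open>raise\<close> applies.\<close>
  define a where "a = Min A"
  define B where "B = A - {a}"
  have "A \<noteq> {}" using Suc.hyps(2) by auto
  then have a: "a \<in> A" and amin: "\<And>b. b \<in> A \<Longrightarrow> a \<le> b"
    using Suc.prems(1) by (auto simp: a_def)
  have B: "A = insert a B" "a \<notin> B" "finite B" "B \<subseteq> {..<n}" "N = card B"
    using a Suc.prems Suc.hyps(2) by (auto simp: B_def)
  have IH: "\<exists>k\<ge>1. ?g (\<lambda>x. of_int (sign \<tau>) * replace R \<tau> B F x - of_nat k * F x)"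
    if "\<tau> permutes B" for \<tau>
  proof (rule Suc.hyps(1)[OF B(5,3,4) that])
    show "0 < \<alpha> b" if "b \<in> B" for b using Suc.prems(4) B(1) that by blast
    show "card {p \<in> R \<times> Pos. letter x p = b} = \<alpha> b" if "x \<in> tens R n" "F x \<noteq> 0" "b \<in> B" for x b
      using Suc.prems(5) B(1) that by blast
  qed
  have inj: "inj \<sigma>" using Suc.prems(3) by (rule permutes_inj)
  show ?case
  proof (cases "\<sigma> a = a")
    \<comment> \<open>For a fixed point the operator counts the occurrences of a, so it is the
      scalar \<open>\<alpha> a\<close> on a weight vector, and there is no contraction.\<close>
    case True
    have \<sigma>B: "\<sigma> permutes B"
      by (rule permutes_superset[OF Suc.prems(3)]) (auto simp: B_def True)
    obtain k where k: "k \<ge> 1" "?g (\<lambda>x. of_int (sign \<sigma>) * replace R \<sigma> B F x - of_nat k * F x)"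
      using IH[OF \<sigma>B] by auto
    have "\<sigma> c \<noteq> a" if "c \<in> B" for c
      using injD[OF inj, of c a] True B(2) that by auto
    then have "{c \<in> B. \<sigma> c = a} = {}" by auto
    then have rep: "replace R \<sigma> A F x = replace R \<sigma> B (polarize R a a F) x" for x
      unfolding B(1) replace_insert[OF R B(3,2)] using True by (simp del: Collect_empty_eq)
    have pol: "polarize R a a F x = of_nat (\<alpha> a) * F x" if "x \<in> tens R n" for x
    proof -
      have "polarize R a a F x = (\<Sum>p\<in>R \<times> Pos. if letter x p = a then F x else 0)"
        unfolding polarize_def by (intro sum.cong) (auto simp: update_self)
      also have "\<dots> = of_nat (card {p \<in> R \<times> Pos. letter x p = a}) * F x"
        using R finPos by (simp add: sum.If_cases Int_def)
      finally show ?thesis using Suc.prems(5)[OF that _ a] by (cases "F x = 0") auto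
    qed
    have rep': "replace R \<sigma> A F x = of_nat (\<alpha> a) * replace R \<sigma> B F x" if x: "x \<in> tens R n" for x
      unfolding rep unfolding replace_def sum_distrib_left
    proof (rule sum.cong[OF refl])
      fix P assume P: "P \<in> {P. P \<subseteq> R \<times> Pos \<and> bij_betw (letter x) P B}"
      have "modify x P \<sigma> \<in> tens R n"
      proof (rule modify_tens[OF x])
        fix p assume "p \<in> P"
        then have "letter x p \<in> B" using P by (auto simp: bij_betw_def)
        then show "\<sigma> (letter x p) \<in> {..<n}" using permutes_in_image[OF \<sigma>B] B(4) by blast
      qed (use P in auto)
      then show "polarize R a a F (modify x P \<sigma>) = of_nat (\<alpha> a) * F (modify x P \<sigma>)" by (rule pol)
    qed
    have "?g (\<lambda>x. of_nat (\<alpha> a) * (of_int (sign \<sigma>) * replace R \<sigma> B F x - of_nat k * F x))"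
      by (rule generated_cmult[OF k(2)])
    then have "?g (\<lambda>x. of_int (sign \<sigma>) * replace R \<sigma> A F x - of_nat (\<alpha> a * k) * F x)"
      by (rule generated_cong) (simp add: rep' algebra_simps)
    moreover have "\<alpha> a * k \<ge> 1" using Suc.prems(4)[OF a] k(1) by simp
    ultimately show ?thesis by blast
  next
    case False
    define c where "c = inv \<sigma> a"
    have \<sigma>c: "\<sigma> c = a" using permutes_inverses[OF Suc.prems(3)] by (simp add: c_def)
    have cA: "c \<in> A" using a permutes_in_image[OF Suc.prems(3), of c] by (simp add: \<sigma>c)
    have cB: "c \<in> B" using cA \<sigma>c False B(1) by auto
    have c_only: "{c' \<in> B. \<sigma> c' = a} = {c}"
    proof (intro set_eqI iffI)
      fix c' assume "c' \<in> {c' \<in> B. \<sigma> c' = a}"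
      then show "c' \<in> {c}" using injD[OF inj, of c' c] \<sigma>c by simp
    qed (use cB \<sigma>c in simp)
    \<comment> \<open>\<open>\<tau>\<close> is \<open>\<sigma>\<close> with a cut out of its cycle:
      the predecessor c of a is sent to \<open>\<sigma> a\<close>, which is exactly what the
      contraction does on \<open>B\<close>.\<close>
    define \<tau> where "\<tau> = transpose a (\<sigma> a) \<circ> \<sigma>"
    have \<sigma>aA: "\<sigma> a \<in> A" using a permutes_in_image[OF Suc.prems(3), of a] by simp
    have \<tau>A: "\<tau> permutes A"
      unfolding \<tau>_def by (rule permutes_compose[OF Suc.prems(3) permutes_swap_id[OF a \<sigma>aA]])
    have \<tau>B: "\<tau> permutes B"
      by (rule permutes_superset[OF \<tau>A]) (auto simp: B_def \<tau>_def)
    have sgn: "sign \<tau> = - sign \<sigma>"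
    proof -
      have "permutation \<sigma>" using Suc.prems(1,3) permutation_permutes by blast
      then show ?thesis
        unfolding \<tau>_def sign_compose[OF permutation_swap_id \<open>permutation \<sigma>\<close>]
        using False by (simp add: sign_swap_id)
    qed
    obtain k where k: "k \<ge> 1" "?g (\<lambda>x. of_int (sign \<tau>) * replace R \<tau> B F x - of_nat k * F x)"
      using IH[OF \<tau>B] by auto
    have \<tau>eq: "\<tau> b = (\<sigma>(c := \<sigma> a)) b" if "b \<in> B" for b
    proof (cases "b = c")
      case True
      then show ?thesis by (simp add: \<tau>_def \<sigma>c)
    next
      case bc: False
      have "\<sigma> b \<noteq> a" using bc injD[OF inj, of b c] \<sigma>c by metis
      moreover have "\<sigma> b \<noteq> \<sigma> a" using that B(2) injD[OF inj, of b a] by metis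
      ultimately show ?thesis using bc by (simp add: \<tau>_def transpose_apply_other)
    qed
    have "?g (polarize R a (\<sigma> a) F)"
      using amin[OF \<sigma>aA] False \<sigma>aA Suc.prems(2) by (intro raise) auto
    then have "?g (replace R \<sigma> B (polarize R a (\<sigma> a) F))"
      using B(3,4) permutes_in_image[OF Suc.prems(3)] Suc.prems(2)
      by (intro generated_replace R) (auto simp only: B(1))
    from generated_add[OF generated_cmult[OF this, of "of_int (sign \<sigma>)"] k(2)]
    have "?g (\<lambda>x. of_int (sign \<sigma>) * replace R \<sigma> A F x - of_nat k * F x)"
    proof (rule generated_cong)
      fix x
      have eq: "replace R \<sigma> A F x = replace R \<sigma> B (polarize R a (\<sigma> a) F) x - replace R \<tau> B F x"
        unfolding B(1) replace_insert[OF R B(3,2)] c_only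
        using replace_cong[of B \<tau> "\<sigma>(c := \<sigma> a)" R F x] \<tau>eq by simp
      show "of_int (sign \<sigma>) * replace R \<sigma> B (polarize R a (\<sigma> a) F) x +
          (of_int (sign \<tau>) * replace R \<tau> B F x - of_nat k * F x) =
          of_int (sign \<sigma>) * replace R \<sigma> A F x - of_nat k * F x"
        unfolding eq sgn by (simp add: right_diff_distrib)
    qed
    with k(1) show ?thesis by blast
  qed
qed

text \<open>Each row pairs with one of r points, each with E columns, so two of the more than \<open>r * E\<close> positions
  P pair with the same column, and exchanging their letters changes the sign.\<close>

lemma generated_alternating_sum:
  assumes R: "finite R" and A: "finite A" "A \<subseteq> {..<n}" and card: "r * E < card A" "card A \<le> C"
  shows "generated (words {..<n}) (range word_coord) r C R
    (\<lambda>x. \<Sum>\<sigma> | \<sigma> permutes A. of_int (sign \<sigma>) * replace R \<sigma> A F x)"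
proof -
  let ?g = "generated (words {..<n}) (range word_coord) r C R" and ?\<SS> = "{\<sigma>. \<sigma> permutes A}"
  \<comment> \<open>The contribution of one set \<open>P\<close> of replaced positions. Each
    \<open>P\<close> is treated separately, because it meets at most \<open>card A\<close>
    rows.\<close>
  define \<theta> where "\<theta> P x = (if bij_betw (letter x) P A
     then \<Sum>\<sigma>\<in>?\<SS>. of_int (sign \<sigma>) * F (modify x P \<sigma>) else 0)" for P x
  have fQ: "finite (R \<times> Pos)" using R finPos by simp
  have "?g (\<theta> P)" if P: "P \<subseteq> R \<times> Pos" for P
  proof (cases "card P = card A")
    case False
    then have "\<theta> P x = 0" for x using bij_betw_same_card[of "letter x" P A] by (auto simp: \<theta>_def)
    then show ?thesis by (intro generated_zero)
  next
    case cP: True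
    let ?S = "fst ` P"
    have fP: "finite P" using finite_subset[OF P fQ] .
    have S: "?S \<subseteq> R" using P by auto
    have cS: "card ?S \<le> C" using card_image_le[OF fP, of fst] card cP by simp
    have fS: "finite ?S" using fP by simp
    show ?thesis
    proof (rule generated_slices[OF finite_words R S cS])
      fix c
      define sl where "sl x = (if \<forall>s\<in>R - ?S. x s = c s then \<theta> P x else 0)" for x
      have "vanishes (words {..<n}) (range word_coord) r R ?S sl"
      proof (rule vanishes_wordsI)
        fix M :: "nat \<Rightarrow> nat \<Rightarrow> nat \<Rightarrow> 'k" and \<tau> :: "nat \<Rightarrow> nat" assume \<tau>: "\<And>s. \<tau> s < r"
        have vanish: "(\<Sum>x\<in>tens R n. sl x * (\<Prod>p\<in>?S \<times> Pos.
             M (\<tau> (fst p)) (letter x p) (h (\<kappa> (fst p)) (snd p)))) = 0"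
          if \<kappa>: "\<kappa> \<in> PiE ?S (\<lambda>_. K)" for \<kappa>
        proof -
          \<comment> \<open>The point and the column that a position is paired with. For fixed
            \<open>\<kappa>\<close> they do not depend on the letters, so they can be compared
            before x is chosen.\<close>
          define col where "col p = (\<tau> (fst p), h (\<kappa> (fst p)) (snd p))" for p :: "nat \<times> 'q"
          have "\<not> inj_on col P"
          proof
            assume "inj_on col P"
            moreover have "col ` P \<subseteq> {..<r} \<times> {..<E}"
            proof
              fix y assume "y \<in> col ` P"
              then obtain p where p: "p \<in> P" "y = col p" by auto
              have "\<kappa> (fst p) \<in> K" using \<kappa> p(1) by (auto simp: PiE_def Pi_def)
              moreover have "snd p \<in> Pos" using P p(1) by auto
              ultimately show "y \<in> {..<r} \<times> {..<E}" using p(2) \<tau> h_less by (simp add: col_def)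
            qed
            ultimately have "card P \<le> card ({..<r} \<times> {..<E})" by (intro card_inj_on_le[of col]) auto
            then show False using card cP by simp
          qed
          then obtain p1 p2 where pp: "p1 \<in> P" "p2 \<in> P" "p1 \<noteq> p2" "col p1 = col p2"
            by (auto simp: inj_on_def)
          define t where "t = transpose p1 p2"
          define T where "T x = (\<lambda>s q. letter x (t (s, q)))" for x :: "nat \<Rightarrow> 'q \<Rightarrow> nat"
          have valT: "letter (T x) p = letter x (t p)" for x p by (simp add: T_def)
          have tt: "t (t p) = p" for p by (simp add: t_def)
          have TT: "T (T x) = x" for x by (rule letter_ext) (simp add: valT tt)
          have tP: "t permutes P" unfolding t_def by (rule permutes_swap_id[OF pp(1,2)])
          have tSP: "t permutes ?S \<times> Pos" by (rule permutes_subset[OF tP]) (use P in force)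
          have tRP: "t permutes R \<times> Pos" by (rule permutes_subset[OF tP P])
          have t_out: "t p = p" if "p \<notin> P" for p using tP that by (rule permutes_not_in)
          have T_in: "T x \<in> tens R n" if x: "x \<in> tens R n" for x
            unfolding tens_iff
          proof (intro conjI ballI allI impI)
            fix p assume "p \<in> R \<times> Pos"
            then have tp: "t p \<in> R \<times> Pos" using permutes_in_image[OF tRP] by blast
            show "letter (T x) p \<in> {..<n}"
              unfolding valT by (rule bspec[OF conjunct1[OF x[unfolded tens_iff]] tp])
          next
            fix s q assume "s \<in> R" "q \<notin> Pos"
            then have "t (s, q) = (s, q)" using P by (intro t_out) auto
            then show "T x s q = undefined" using x \<open>s \<in> R\<close> \<open>q \<notin> Pos\<close> unfolding tens_iff by (simp add: T_def)
          next
            fix s assume s: "s \<notin> R"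
            then have "t (s, q) = (s, q)" for q using P by (intro t_out) auto
            then have "T x s = x s" by (auto simp: T_def)
            then show "T x s = undefined" using x s unfolding tens_iff by simp
          qed
          let ?m = "\<lambda>x. \<Prod>p\<in>?S \<times> Pos. M (\<tau> (fst p)) (letter x p) (h (\<kappa> (fst p)) (snd p))"
          have m: "?m (T x) = ?m x" for x
          proof -
            have ct: "col (t p) = col p" for p
              using pp(4) by (cases "p = p1 \<or> p = p2") (auto simp: t_def)
            have "?m x = (\<Prod>p\<in>?S \<times> Pos. M (\<tau> (fst (t p))) (letter x (t p)) (h (\<kappa> (fst (t p))) (snd (t p))))"
              by (rule prod.reindex_bij_betw[OF permutes_imp_bij[OF tSP], symmetric])
            also have "\<dots> = ?m (T x)"
              unfolding valT using ct by (intro prod.cong refl) (simp add: col_def)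
            finally show ?thesis by simp
          qed
          have \<theta>: "\<theta> P (T x) = - \<theta> P x" for x
          proof (cases "bij_betw (letter x) P A")
            case True
            have "letter (T x) = letter x \<circ> t" by (auto simp: valT)
            then have bT: "bij_betw (letter (T x)) P A"
              using bij_betw_trans[OF permutes_imp_bij[OF tP] True] by simp
            define u where "u = transpose (letter x p1) (letter x p2)"
            have inA: "letter x p1 \<in> A" "letter x p2 \<in> A" using True pp by (auto simp: bij_betw_def)
            have ne: "letter x p1 \<noteq> letter x p2" using True pp by (auto simp: bij_betw_def inj_on_def)
            have uA: "u permutes A" unfolding u_def by (rule permutes_swap_id[OF inA])
            have u: "u (letter x p) = letter x (t p)" if "p \<in> P" for p
            proof -
              have "letter x p = letter x p1 \<longleftrightarrow> p = p1" "letter x p = letter x p2 \<longleftrightarrow> p = p2"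
                using True pp that by (auto simp: bij_betw_def inj_on_def)
              then show ?thesis by (auto simp: u_def t_def transpose_def)
            qed
            \<comment> \<open>Exchanging the letters at two positions of \<open>P\<close> amounts to
              composing \<open>\<sigma>\<close> with the transposition of these letters, so the sum
              over permutations can be reindexed at the cost of a sign.\<close>
            have mod: "modify (T x) P \<sigma> = modify x P (\<sigma> \<circ> u)" for \<sigma>
              by (rule letter_ext) (simp add: letter_modify valT u t_out)
            have "(\<Sum>\<sigma>\<in>?\<SS>. of_int (sign \<sigma>) * F (modify x P \<sigma>)) =
              (\<Sum>\<sigma>\<in>?\<SS>. of_int (sign (\<sigma> \<circ> u)) * F (modify x P (\<sigma> \<circ> u)))"
              by (rule sum_permutations_compose_right[OF uA])
            also have "\<dots> = (\<Sum>\<sigma>\<in>?\<SS>. - (of_int (sign \<sigma>) * F (modify (T x) P \<sigma>)))"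
            proof (rule sum.cong[OF refl])
              fix \<sigma> assume "\<sigma> \<in> ?\<SS>"
              then have "permutation \<sigma>" using A(1) permutation_permutes by blast
              then have "sign (\<sigma> \<circ> u) = - sign \<sigma>"
                using ne by (subst sign_compose) (auto simp: u_def permutation_swap_id sign_swap_id)
              then show "of_int (sign (\<sigma> \<circ> u)) * F (modify x P (\<sigma> \<circ> u)) =
                - (of_int (sign \<sigma>) * F (modify (T x) P \<sigma>))" by (simp add: mod)
            qed
            finally show ?thesis using True bT by (simp add: \<theta>_def sum_negf)
          next
            case False
            have "letter x = letter (T x) \<circ> t" by (auto simp: valT tt)
            then have "\<not> bij_betw (letter (T x)) P A"
              using bij_betw_trans[OF permutes_imp_bij[OF tP], of "letter (T x)" A] False by auto
            with False show ?thesis by (simp add: \<theta>_def)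
          qed
          have rows: "T x s = x s" if "s \<in> R - ?S" for x s
          proof
            fix q
            have "(s, q) \<notin> P" using that by force
            then show "T x s q = x s q" by (simp add: T_def t_out)
          qed
          have sl: "sl (T x) = - sl x" for x
            by (simp add: sl_def \<theta> rows)
          have "(\<Sum>x\<in>tens R n. sl x * ?m x) = (\<Sum>x\<in>tens R n. sl (T x) * ?m (T x))"
            by (rule sum.reindex_bij_witness[of _ T T]) (use T_in TT in simp_all)
          also have "\<dots> = - (\<Sum>x\<in>tens R n. sl x * ?m x)"
            unfolding sl m by (simp add: sum_negf)
          finally show ?thesis by (simp add: equal_neg_zero)
        qed
        have "(\<Sum>x\<in>tens R n. sl x * (\<Prod>s\<in>?S. word_coord (M (\<tau> s)) (x s))) =
           (\<Sum>\<kappa>\<in>PiE ?S (\<lambda>_. K). \<Sum>x\<in>tens R n. (\<Prod>s\<in>?S. g (\<kappa> s)) * (sl x *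
             (\<Prod>p\<in>?S \<times> Pos. M (\<tau> (fst p)) (letter x p) (h (\<kappa> (fst p)) (snd p)))))"
          unfolding prod_word_coord[OF fS, of "\<lambda>s. M (\<tau> s)"] sum_distrib_left
          by (subst sum.swap) (simp add: mult_ac)
        also have "\<dots> = 0"
          unfolding sum_distrib_left[symmetric] by (rule sum.neutral) (simp add: vanish)
        finally show "(\<Sum>x\<in>tens R n. sl x * (\<Prod>s\<in>?S. word_coord (M (\<tau> s)) (x s))) = 0" .
      qed
      then show "vanishes (words {..<n}) (range word_coord) r R ?S (\<lambda>x. if \<forall>s\<in>R - ?S. x s = c s then \<theta> P x else 0)"
        by (simp add: sl_def[abs_def])
    qed simp
  qed
  then have "?g (\<lambda>x. \<Sum>P\<in>Pow (R \<times> Pos). \<theta> P x)" by (intro generated_sum) auto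
  then show ?thesis
  proof (rule generated_cong)
    fix x
    have "(\<Sum>P\<in>Pow (R \<times> Pos). \<theta> P x) = (\<Sum>P | P \<subseteq> R \<times> Pos \<and> bij_betw (letter x) P A.
        \<Sum>\<sigma>\<in>?\<SS>. of_int (sign \<sigma>) * F (modify x P \<sigma>))"
      using fQ by (simp add: \<theta>_def sum.If_cases Int_def)
    also have "\<dots> = (\<Sum>\<sigma>\<in>?\<SS>. of_int (sign \<sigma>) * replace R \<sigma> A F x)"
      unfolding replace_def sum_distrib_left by (rule sum.swap)
    finally show "(\<Sum>P\<in>Pow (R \<times> Pos). \<theta> P x) = (\<Sum>\<sigma>\<in>?\<SS>. of_int (sign \<sigma>) * replace R \<sigma> A F x)" .
  qed
qed

section \<open>Weight spaces and reduction to few letters\<close>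

definition weight :: "nat set \<Rightarrow> (nat \<Rightarrow> 'q \<Rightarrow> nat) \<Rightarrow> nat \<Rightarrow> nat" where
  "weight R x a = card {p \<in> R \<times> Pos. letter x p = a}"

text \<open>Scaling row a of every matrix by \<open>u a\<close> preserves the set of points and
  multiplies the term of x by the monomial in u whose exponents are the weight of x. Comparing
  coefficients isolates one weight.\<close>

lemma vanishes_weight:
  assumes R: "finite R" and F: "vanishes (words {..<n}) (range word_coord) r R R F"
  shows "vanishes (words {..<n}) (range word_coord) r R R (\<lambda>x. if \<forall>a<n. weight R x a = \<alpha> a then F x else 0)"
proof (rule vanishes_wordsI)
  fix M :: "nat \<Rightarrow> nat \<Rightarrow> nat \<Rightarrow> 'k" and \<tau> :: "nat \<Rightarrow> nat" assume \<tau>: "\<And>s. \<tau> s < r"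
  define ev where "ev x = (\<Prod>s\<in>R. word_coord (M (\<tau> s)) (x s))" for x
  have fQ: "finite (R \<times> Pos)" using R finPos by simp
  have scale: "(\<Prod>s\<in>R. word_coord (\<lambda>c k. u c * M (\<tau> s) c k) (x s)) = ev x * (\<Prod>a\<in>{..<n}. u a ^ weight R x a)"
    if x: "x \<in> tens R n" for u x
  proof -
    have sub: "letter x ` (R \<times> Pos) \<subseteq> {..<n}" using x unfolding tens_iff by auto
    have "(\<Prod>p\<in>R \<times> Pos. u (letter x p)) = (\<Prod>a\<in>{..<n}. \<Prod>p | p \<in> R \<times> Pos \<and> letter x p = a. u (letter x p))"
      by (rule prod.group[OF fQ _ sub, symmetric]) simp
    also have "\<dots> = (\<Prod>a\<in>{..<n}. u a ^ weight R x a)"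
      by (simp add: weight_def)
    finally show ?thesis
      unfolding ev_def prod_word_coord[OF R, of "\<lambda>s. M (\<tau> s)"] prod_word_coord[OF R, of "\<lambda>s c k. u c * M (\<tau> s) c k"]
      by (simp add: prod.distrib sum_distrib_left mult_ac)
  qed
  have "(\<Sum>x\<in>tens R n. F x * ev x * (\<Prod>a\<in>{..<n}. u a ^ weight R x a)) = 0" for u
    using vanishes_wordsD[where \<tau> = \<tau> and M = "\<lambda>t c k. u c * M t c k", OF F \<tau>]
    by (simp add: scale mult_ac)
  from multi_power_sum_vanish[OF _ finite_tens[OF R] this, of \<alpha>]
  have "(\<Sum>x | x \<in> tens R n \<and> (\<forall>a\<in>{..<n}. weight R x a = \<alpha> a). F x * ev x) = 0" by simp
  also have "(\<Sum>x | x \<in> tens R n \<and> (\<forall>a\<in>{..<n}. weight R x a = \<alpha> a). F x * ev x) =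
     (\<Sum>x\<in>tens R n. if \<forall>a<n. weight R x a = \<alpha> a then F x * ev x else 0)"
    using finite_tens[OF R] by (simp add: sum.If_cases Int_def Ball_def)
  also have "\<dots> = (\<Sum>x\<in>tens R n. (if \<forall>a<n. weight R x a = \<alpha> a then F x else 0) * ev x)"
    by (intro sum.cong) auto
  finally show "(\<Sum>x\<in>tens R n. (if \<forall>a<n. weight R x a = \<alpha> a then F x else 0) *
     (\<Prod>s\<in>R. word_coord (M (\<tau> s)) (x s))) = 0" by (simp add: ev_def)
qed

lemma generated_weights:
  assumes R: "finite R" and
    "\<And>\<alpha>. generated (words {..<n}) (range word_coord) r C R (\<lambda>x. if \<forall>a<n. weight R x a = \<alpha> a then F x else 0)"
  shows "generated (words {..<n}) (range word_coord) r C R F"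
proof -
  let ?w = "\<lambda>x. restrict (weight R x) {..<n}"
  let ?W = "?w ` tens R n"
  have "generated (words {..<n}) (range word_coord) r C R
     (\<lambda>x. \<Sum>\<alpha>\<in>?W. if \<forall>a<n. weight R x a = \<alpha> a then F x else 0)"
    by (intro generated_sum assms(2))
  then show ?thesis
  proof (rule generated_cong)
    fix x assume x: "x \<in> tens R n"
    have "(\<Sum>\<alpha>\<in>?W. if \<forall>a<n. weight R x a = \<alpha> a then F x else 0) =
        (\<Sum>\<alpha>\<in>?W. if \<alpha> = ?w x then F x else 0)"
    proof (rule sum.cong[OF refl])
      fix \<alpha> assume "\<alpha> \<in> ?W"
      then have "(\<forall>a<n. weight R x a = \<alpha> a) \<longleftrightarrow> \<alpha> = ?w x" by (auto simp: fun_eq_iff)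
      then show "(if \<forall>a<n. weight R x a = \<alpha> a then F x else 0) = (if \<alpha> = ?w x then F x else 0)"
        by simp
    qed
    also have "\<dots> = F x" using finite_tens[OF R] x by (subst sum.delta) auto
    finally show "(\<Sum>\<alpha>\<in>?W. if \<forall>a<n. weight R x a = \<alpha> a then F x else 0) = F x" .
  qed
qed

text \<open>Induction on the sum of the letters, which polarization from b to a smaller letter a decreases.\<close>

theorem bounded_gen_words:
  assumes base: "\<And>L. L \<subseteq> {..<n} \<Longrightarrow> card L \<le> r * E \<Longrightarrow> bounded_gen (words L) (range word_coord) r C"
    and C: "r * E + 1 \<le> C"
  shows "bounded_gen (words {..<n}) (range word_coord) r C"
  unfolding bounded_gen_def
proof (intro allI impI)
  fix m F assume F: "vanishes (words {..<n}) (range word_coord) r {..<m} {..<m} F"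
  define R where "R = {..<m}"
  have R: "finite R" by (simp add: R_def)
  let ?g = "generated (words {..<n}) (range word_coord) r C R"
  let ?J = "vanishes (words {..<n}) (range word_coord) r R R"
  define height where "height x = (\<Sum>p\<in>R \<times> Pos. letter x p)" for x
  have fQ: "finite (R \<times> Pos)" using R finPos by simp
  \<comment> \<open>\<open>\<mu>\<close> is a strict bound on the height of the words in the
    support, and the induction runs over this bound.\<close>
  have main: "?g F" if "?J F" "\<And>x. x \<in> tens R n \<Longrightarrow> F x \<noteq> 0 \<Longrightarrow> height x < \<mu>" for \<mu> F
    using that
  proof (induction \<mu> arbitrary: F)
    case 0
    then show ?case by (intro generated_zero) auto
  next
    case (Suc \<mu> F0)
    show ?case
    proof (rule generated_weights[OF R])
      fix \<alpha>
      define F where "F x = (if \<forall>a<n. weight R x a = \<alpha> a then F0 x else 0)" for x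
      have JF: "?J F" unfolding F_def by (rule vanishes_weight[OF R Suc.prems(1)])
      have htF: "height x < Suc \<mu>" if "x \<in> tens R n" "F x \<noteq> 0" for x
        using Suc.prems(2)[OF that(1)] that(2) by (auto simp: F_def split: if_splits)
      have wtF: "weight R x a = \<alpha> a" if "F x \<noteq> 0" "a < n" for x a
        using that by (auto simp: F_def split: if_splits)
      \<comment> \<open>The letters that a word of weight \<alpha> really contains; \<open>F\<close>
        lives on the words over \<open>L\<close>.\<close>
      define L where "L = {a. a < n \<and> 0 < \<alpha> a}"
      have fL: "finite L" "L \<subseteq> {..<n}" by (auto simp: L_def)
      have "?g F"
      proof (cases "card L \<le> r * E")
        case True
        have supp: "x \<in> PiE R (\<lambda>_. words L)" if x: "x \<in> tens R n" and nz: "F x \<noteq> 0" for x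
        proof -
          have "letter x p \<in> L" if p: "p \<in> R \<times> Pos" for p
          proof -
            have lt: "letter x p < n" using x p unfolding tens_iff by auto
            have "finite {p' \<in> R \<times> Pos. letter x p' = letter x p}" using fQ by simp
            then have "0 < weight R x (letter x p)"
              unfolding weight_def card_gt_0_iff using p by blast
            then show ?thesis using wtF[OF nz lt] lt by (simp add: L_def)
          qed
          then show ?thesis using x unfolding tens_iff by blast
        qed
        have sub: "words L \<subseteq> words {..<n}" using fL(2) by (auto simp: words_def PiE_def Pi_def)
        have zero: "F x = 0" if "x \<in> tens R n" "x \<notin> PiE R (\<lambda>_. words L)" for x
          using supp that by blast
        have "vanishes (words L) (range word_coord) r R R F"
        proof (rule vanishesI)
          fix z and \<tau> :: "nat \<Rightarrow> nat"
          assume z: "\<And>t. t < r \<Longrightarrow> z t \<in> range word_coord" and \<tau>: "\<And>s. \<tau> s < r"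
          have "(\<Sum>x\<in>PiE R (\<lambda>_. words L). F x * (\<Prod>s\<in>R. z (\<tau> s) (x s))) =
             (\<Sum>x\<in>tens R n. F x * (\<Prod>s\<in>R. z (\<tau> s) (x s)))"
          proof (rule sum.mono_neutral_left)
            show "PiE R (\<lambda>_. words L) \<subseteq> tens R n" using sub by (intro PiE_mono)
            show "\<forall>x\<in>tens R n - PiE R (\<lambda>_. words L). F x * (\<Prod>s\<in>R. z (\<tau> s) (x s)) = 0"
              using zero by simp
          qed (rule finite_tens[OF R])
          then show "(\<Sum>x\<in>PiE R (\<lambda>_. words L). F x * (\<Prod>s\<in>R. z (\<tau> s) (x s))) = 0"
            using vanishesD[where z = z and \<tau> = \<tau>, OF JF z \<tau>] by simp
        qed
        then have "generated (words L) (range word_coord) r C R F"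
          using base[OF fL(2) True] by (simp add: bounded_gen_def R_def)
        then show ?thesis by (rule generated_subset[OF finite_words[OF finite_lessThan] R sub]) (use zero in auto)
      next
        case False
        \<comment> \<open>One letter more than r points have columns: enough for the pigeonhole, and
          still at most \<open>C\<close> rows.\<close>
        then obtain A where A: "A \<subseteq> L" "card A = r * E + 1"
          using obtain_subset_with_card_n[of "r * E + 1" L] by auto
        have fA: "finite A" "A \<subseteq> {..<n}" using A(1) fL finite_subset by blast+
        \<comment> \<open>The induction hypothesis applies, since polarization to a smaller letter
          lowers the height of every word in the support.\<close>
        have raise: "?g (polarize R a b F)" if ab: "a < b" "b < n" for a b
        proof (rule Suc.IH)
          show "?J (polarize R a b F)" using ab by (intro vanishes_polarize R JF) auto
          fix x assume x: "x \<in> tens R n" and nz: "polarize R a b F x \<noteq> 0"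
          from nz obtain p where p: "p \<in> R \<times> Pos" "(if letter x p = a then F (update x p b) else 0) \<noteq> 0"
            unfolding polarize_def by (rule sum.not_neutral_contains_not_neutral)
          then have p': "letter x p = a" "F (update x p b) \<noteq> 0" by (simp_all split: if_splits)
          have "update x p b \<in> tens R n" using update_tens[OF x p(1)] ab by auto
          then have "height (update x p b) < Suc \<mu>" using p'(2) by (rule htF)
          moreover have "height x < height (update x p b)"
            unfolding height_def by (rule sum_strict_mono_ex1[OF fQ]) (use p p' ab in \<open>auto simp: letter_update\<close>)
          ultimately show "height x < \<mu>" by simp
        qed
        let ?\<SS> = "{\<sigma>. \<sigma> permutes A}"
        have "\<exists>k. k \<ge> 1 \<and> ?g (\<lambda>x. of_int (sign \<sigma>) * replace R \<sigma> A F x - of_nat k * F x)"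
          if "\<sigma> \<in> ?\<SS>" for \<sigma>
        proof (rule replace_permutation[OF R fA _ _ _ raise, where \<alpha> = \<alpha>])
          show "card {p \<in> R \<times> Pos. letter x p = a} = \<alpha> a" if "F x \<noteq> 0" "a \<in> A" for x a
            using wtF[OF that(1), of a] that(2) fA(2) by (auto simp: weight_def)
        qed (use that A(1) in \<open>auto simp: L_def\<close>)
        then have "\<forall>\<sigma>\<in>?\<SS>. \<exists>k. k \<ge> 1 \<and>
          ?g (\<lambda>x. of_int (sign \<sigma>) * replace R \<sigma> A F x - of_nat k * F x)" by blast
        from bchoice[OF this] obtain k where "\<forall>\<sigma>\<in>?\<SS>. k \<sigma> \<ge> 1 \<and>
          ?g (\<lambda>x. of_int (sign \<sigma>) * replace R \<sigma> A F x - of_nat (k \<sigma>) * F x)" by (elim exE)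
        then have k: "k \<sigma> \<ge> 1"
          "?g (\<lambda>x. of_int (sign \<sigma>) * replace R \<sigma> A F x - of_nat (k \<sigma>) * F x)"
          if "\<sigma> \<in> ?\<SS>" for \<sigma> using that by blast+
        \<comment> \<open>Subtracting the two generated sums below leaves
          \<open>of_nat N * F\<close>. The identity permutation alone contributes at least 1, so N
          is positive and invertible in characteristic 0.\<close>
        define N where "N = (\<Sum>\<sigma>\<in>?\<SS>. k \<sigma>)"
        have id: "id \<in> ?\<SS>" using permutes_id by blast
        have "N \<ge> k id" unfolding N_def
          by (rule member_le_sum[OF id _ finite_permutations[OF fA(1)]]) simp
        then have N: "(of_nat N :: 'k) \<noteq> 0" using k(1)[OF id] by simp
        have 1: "?g (\<lambda>x. \<Sum>\<sigma>\<in>?\<SS>. of_int (sign \<sigma>) * replace R \<sigma> A F x)"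
          using A(2) C by (intro generated_alternating_sum R fA) auto
        have 2: "?g (\<lambda>x. \<Sum>\<sigma>\<in>?\<SS>. of_int (sign \<sigma>) * replace R \<sigma> A F x - of_nat (k \<sigma>) * F x)"
          by (intro generated_sum k(2))
        from generated_cmult[OF generated_diff[OF 1 2], of "1 / of_nat N"]
        show ?thesis
        proof (rule generated_cong)
          fix x
          have "(\<Sum>\<sigma>\<in>?\<SS>. of_int (sign \<sigma>) * replace R \<sigma> A F x - of_nat (k \<sigma>) * F x) =
            (\<Sum>\<sigma>\<in>?\<SS>. of_int (sign \<sigma>) * replace R \<sigma> A F x) - of_nat N * F x"
            by (simp add: sum_subtractf N_def sum_distrib_right)
          then show "1 / of_nat N * ((\<Sum>\<sigma>\<in>?\<SS>. of_int (sign \<sigma>) * replace R \<sigma> A F x) -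
            (\<Sum>\<sigma>\<in>?\<SS>. of_int (sign \<sigma>) * replace R \<sigma> A F x - of_nat (k \<sigma>) * F x)) = F x"
            using N by simp
        qed
      qed
      then show "?g (\<lambda>x. if \<forall>a<n. weight R x a = \<alpha> a then F0 x else 0)"
        by (simp add: F_def[abs_def])
    qed
  qed
  have "finite (height ` tens R n)" using finite_tens[OF R] by simp
  then obtain \<mu> where \<mu>: "\<forall>y\<in>height ` tens R n. y < \<mu>"
    unfolding finite_nat_set_iff_bounded by (elim exE)
  have "?g F"
  proof (rule main)
    show "?J F" unfolding R_def by (rule F)
    show "height x < \<mu>" if "x \<in> tens R n" for x using \<mu> that by simp
  qed
  then show "generated (words {..<n}) (range word_coord) r C {..<m} F" unfolding R_def .
qed

end

section \<open>Well-quasi-orders and leading words\<close>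

text \<open>Every sequence has a monotone subsequence, and a decreasing sequence of natural numbers
  is eventually constant.\<close>

lemma nat_seq_incseq_subseq:
  fixes s :: "nat \<Rightarrow> nat"
  obtains \<phi> where "strict_mono \<phi>" "incseq (s \<circ> \<phi>)"
proof -
  obtain \<phi> where \<phi>: "strict_mono \<phi>" "monoseq (\<lambda>n. s (\<phi> n))" using seq_monosub by blast
  show ?thesis
  proof (cases "incseq (\<lambda>n. s (\<phi> n))")
    case True
    then show ?thesis using that \<phi>(1) by (simp add: o_def)
  next
    case False
    then have dec: "decseq (\<lambda>n. s (\<phi> n))" using \<phi>(2) by (simp add: monoseq_iff)
    obtain N where N: "\<And>n. s (\<phi> N) \<le> s (\<phi> n)"
      using ex_has_least_nat[of "\<lambda>_. True" 0 "\<lambda>n. s (\<phi> n)"] by blast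
    have const: "s (\<phi> (n + N)) = s (\<phi> N)" for n
      using N[of "n + N"] decseqD[OF dec, of N "n + N"] by simp
    have "strict_mono (\<lambda>n. \<phi> (n + N))" using \<phi>(1) by (simp add: strict_mono_def)
    moreover have "incseq (s \<circ> (\<lambda>n. \<phi> (n + N)))" by (simp add: incseq_def const)
    ultimately show ?thesis by (rule that)
  qed
qed

text \<open>The sequence is thinned out once for each element of \<open>A\<close>; monotonicity
  obtained earlier survives. A whole subsequence is produced, because the lemma on words compares
  all heads along it.\<close>

lemma dickson_multiset:
  fixes f :: "nat \<Rightarrow> 'a multiset"
  assumes "finite A" "\<And>i. set_mset (f i) \<subseteq> A"
  obtains \<phi> :: "nat \<Rightarrow> nat" where "strict_mono \<phi>" "\<And>i j. i \<le> j \<Longrightarrow> f (\<phi> i) \<subseteq># f (\<phi> j)"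
proof -
  have "\<exists>\<phi>. strict_mono \<phi> \<and> (\<forall>v\<in>B. incseq (\<lambda>i. count (f (\<phi> i)) v))" if "finite B" for B
    using that
  proof induction
    case empty
    show ?case by (intro exI[of _ id]) (simp add: strict_mono_def)
  next
    case (insert v B)
    then obtain \<phi> where \<phi>: "strict_mono \<phi>" "\<And>v. v \<in> B \<Longrightarrow> incseq (\<lambda>i. count (f (\<phi> i)) v)" by blast
    obtain \<psi> where \<psi>: "strict_mono \<psi>" "incseq ((\<lambda>i. count (f (\<phi> i)) v) \<circ> \<psi>)"
      by (rule nat_seq_incseq_subseq)
    have "incseq (\<lambda>i. count (f (\<phi> (\<psi> i))) w)" if "w \<in> B" for w
      using \<phi>(2)[OF that] strict_mono_leD[OF \<psi>(1)] unfolding incseq_def by blast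
    with \<phi>(1) \<psi> show ?case
      by (intro exI[of _ "\<phi> \<circ> \<psi>"]) (auto simp: o_def strict_mono_def)
  qed
  from this[OF assms(1)] obtain \<phi> where \<phi>: "strict_mono \<phi>"
    "\<And>v. v \<in> A \<Longrightarrow> incseq (\<lambda>i. count (f (\<phi> i)) v)" by blast
  have "f (\<phi> i) \<subseteq># f (\<phi> j)" if "i \<le> j" for i j
  proof (rule mset_subset_eqI)
    fix v
    show "count (f (\<phi> i)) v \<le> count (f (\<phi> j)) v"
    proof (cases "v \<in> A")
      case True
      then show ?thesis using incseqD[OF \<phi>(2) that] by blast
    next
      case False
      then have "v \<notin># f (\<phi> i)" using assms(2) by blast
      then show ?thesis by (simp add: not_in_iff)
    qed
  qed
  then show ?thesis by (rule that[OF \<phi>(1)])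
qed

text \<open>Nash-Williams' minimal bad sequence argument.\<close>

lemma higman:
  assumes subseq: "\<And>f :: nat \<Rightarrow> 'a. (\<And>i. f i \<in> A) \<Longrightarrow>
      \<exists>\<phi> :: nat \<Rightarrow> nat. strict_mono \<phi> \<and> (\<forall>i j. i < j \<longrightarrow> P (f (\<phi> i)) (f (\<phi> j)))"
    and F: "\<And>i. set (F i) \<subseteq> A"
  shows "\<exists>i j :: nat. i < j \<and> list_emb P (F i) (F j)"
proof (rule ccontr)
  define bad where "bad f \<longleftrightarrow> (\<forall>i. set (f i) \<subseteq> A) \<and> (\<forall>i j. i < j \<longrightarrow> \<not> list_emb P (f i) (f j))"
    for f :: "nat \<Rightarrow> 'a list"
  \<comment> \<open>f' keeps the first n terms of f and has the shortest possible n-th term among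
    bad sequences doing so. Iteration gives the minimal bad sequence on the diagonal.\<close>
  define Q where "Q n f f' \<longleftrightarrow> bad f' \<and> (\<forall>i<n. f' i = f i) \<and>
      (\<forall>f''. bad f'' \<and> (\<forall>i<n. f'' i = f i) \<longrightarrow> length (f' n) \<le> length (f'' n))"
    for n and f f' :: "nat \<Rightarrow> 'a list"
  assume "\<not> ?thesis"
  then have "bad F" using F by (auto simp: bad_def)
  moreover have "\<exists>f'. bad f' \<and> Q n f f'" if "bad f" for f n
  proof -
    have "bad f \<and> (\<forall>i<n. f i = f i)" using that by simp
    from ex_has_least_nat[of "\<lambda>f'. bad f' \<and> (\<forall>i<n. f' i = f i)", OF this, of "\<lambda>f'. length (f' n)"]
    show ?thesis unfolding Q_def by simp
  qed
  ultimately obtain G where G: "\<And>n. bad (G n)" "\<And>n. Q n (G n) (G (Suc n))"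
    using dependent_nat_choice[of "\<lambda>_. bad" Q] by blast
  define g where "g n = G (Suc n) n" for n
  have stable: "G m i = g i" if "i < m" for m i
    using that
  proof (induction m)
    case (Suc m)
    then show ?case using G(2)[of m] by (cases "i = m") (auto simp: g_def Q_def)
  qed simp
  have gA: "set (g i) \<subseteq> A" for i using G(1)[of "Suc i"] by (simp add: g_def bad_def)
  have gbad: "\<not> list_emb P (g i) (g j)" if "i < j" for i j
    using G(1)[of "Suc j"] stable[of i "Suc j"] stable[of j "Suc j"] that
    unfolding bad_def by (metis less_Suc_eq)
  have gmin: "length (g n) \<le> length (f n)" if "bad f" "\<And>i. i < n \<Longrightarrow> f i = g i" for f n
  proof -
    have "\<forall>i<n. f i = G n i" using that(2) stable by simp
    then show ?thesis using G(2)[of n] that(1) unfolding Q_def g_def by blast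
  qed
  have ne: "g n \<noteq> []" for n using gbad[of n "Suc n"] by auto
  have "hd (g n) \<in> A" for n using gA[of n] ne[of n] hd_in_set by blast
  from subseq[of "\<lambda>n. hd (g n)", OF this] obtain \<phi> :: "nat \<Rightarrow> nat" where \<phi>0: "strict_mono \<phi>"
    "\<forall>i j. i < j \<longrightarrow> P (hd (g (\<phi> i))) (hd (g (\<phi> j)))" by (elim exE conjE)
  note \<phi> = \<phi>0(1) \<phi>0(2)[rule_format]
  have mono: "\<phi> 0 \<le> \<phi> i" for i using strict_mono_leD[OF \<phi>(1)] by simp
  \<comment> \<open>The sequence contradicting minimality: g up to the first chosen index, then the
    tails of the words whose heads increase.\<close>
  define f where "f i = (if i < \<phi> 0 then g i else tl (g (\<phi> (i - \<phi> 0))))" for i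
  have cons: "g n = hd (g n) # tl (g n)" for n using ne[of n] by simp
  have "bad f"
    unfolding bad_def
  proof (intro conjI allI impI)
    fix i
    show "set (f i) \<subseteq> A"
      using gA[of i] gA[of "\<phi> (i - \<phi> 0)"] list.set_sel(2)[OF ne] by (auto simp: f_def)
  next
    fix i j :: nat assume ij: "i < j"
    consider "j < \<phi> 0" | "i < \<phi> 0" "\<phi> 0 \<le> j" | "\<phi> 0 \<le> i" by linarith
    then show "\<not> list_emb P (f i) (f j)"
    proof cases
      case 1
      then show ?thesis using gbad[OF ij] ij by (simp add: f_def)
    next
      case 2
      let ?k = "\<phi> (j - \<phi> 0)"
      have "i < ?k" using 2(1) mono[of "j - \<phi> 0"] by linarith
      from gbad[OF this] have "\<not> list_emb P (g i) (tl (g ?k))"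
        using list_emb_Cons[of P "g i" "tl (g ?k)" "hd (g ?k)"] cons[of ?k] by metis
      then show ?thesis using 2 by (simp add: f_def)
    next
      case 3
      let ?k = "i - \<phi> 0" and ?l = "j - \<phi> 0"
      have kl: "?k < ?l" using 3 ij by simp
      have "\<not> list_emb P (g (\<phi> ?k)) (g (\<phi> ?l))"
        using strict_monoD[OF \<phi>(1) kl] by (rule gbad)
      then have "\<not> list_emb P (tl (g (\<phi> ?k))) (tl (g (\<phi> ?l)))"
        using list_emb_Cons2[of P, OF \<phi>(2)[OF kl]] cons by metis
      then show ?thesis using 3 ij by (simp add: f_def)
    qed
  qed
  then have "length (g (\<phi> 0)) \<le> length (f (\<phi> 0))" by (rule gmin) (simp add: f_def)
  also have "\<dots> < length (g (\<phi> 0))" using ne[of "\<phi> 0"] by (simp add: f_def)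
  finally show False by simp
qed

text \<open>Used to place the rows of a shorter tensor, in order, among the rows of a longer
  one.\<close>

lemma list_emb_index:
  assumes "list_emb P xs ys"
  shows "\<exists>f. (\<forall>i j. i < j \<longrightarrow> j < length xs \<longrightarrow> f i < f j) \<and>
    (\<forall>i<length xs. f i < length ys \<and> P (xs ! i) (ys ! f i))"
  using assms
proof induction
  case (list_emb_Cons xs ys y)
  then obtain f where "(\<forall>i j. i < j \<longrightarrow> j < length xs \<longrightarrow> f i < f j) \<and>
    (\<forall>i<length xs. f i < length ys \<and> P (xs ! i) (ys ! f i))" by blast
  then show ?case by (intro exI[of _ "\<lambda>i. Suc (f i)"]) auto
next
  case (list_emb_Cons2 x y xs ys)
  then obtain f where f: "\<And>i j. i < j \<Longrightarrow> j < length xs \<Longrightarrow> f i < f j"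
    "\<And>i. i < length xs \<Longrightarrow> f i < length ys \<and> P (xs ! i) (ys ! f i)" by blast
  let ?f = "case_nat 0 (\<lambda>i. Suc (f i))"
  have "?f i < ?f j" if "i < j" "j < length (x # xs)" for i j
    using that f(1) by (auto split: nat.split)
  moreover have "?f i < length (y # ys) \<and> P ((x # xs) ! i) ((y # ys) ! ?f i)"
    if "i < length (x # xs)" for i
    using that f(2) list_emb_Cons2.hyps(1) by (auto split: nat.split)
  ultimately show ?case by blast
qed simp

text \<open>The constant rows contribute a factor common to all terms of the sum.\<close>

lemma vanishes_rows:
  assumes R: "finite R" "S \<subseteq> R" and F: "vanishes X Z r R S F" "constant_off X R S c F"
  shows "vanishes X Z r R R F"
proof (rule vanishesI)
  fix z and \<tau> :: "nat \<Rightarrow> nat" assume z: "\<And>t. t < r \<Longrightarrow> z t \<in> Z" and \<tau>: "\<And>s. \<tau> s < r"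
  have "(\<Sum>x\<in>PiE R (\<lambda>_. X). F x * (\<Prod>s\<in>R. z (\<tau> s) (x s))) =
     (\<Sum>x\<in>PiE R (\<lambda>_. X). (\<Prod>s\<in>R - S. z (\<tau> s) (c s)) * (F x * (\<Prod>s\<in>S. z (\<tau> s) (x s))))"
  proof (rule sum.cong[OF refl])
    fix x assume x: "x \<in> PiE R (\<lambda>_. X)"
    show "F x * (\<Prod>s\<in>R. z (\<tau> s) (x s)) =
      (\<Prod>s\<in>R - S. z (\<tau> s) (c s)) * (F x * (\<Prod>s\<in>S. z (\<tau> s) (x s)))"
    proof (cases "F x = 0")
      case False
      then have "\<forall>s\<in>R - S. x s = c s" using F(2) x unfolding constant_off_def by blast
      then show ?thesis by (simp add: prod.subset_diff[OF R(2,1)])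
    qed simp
  qed
  also have "\<dots> = 0" using vanishesD[where z = z and \<tau> = \<tau>, OF F(1) z \<tau>] by (simp flip: sum_distrib_left)
  finally show "(\<Sum>x\<in>PiE R (\<lambda>_. X). F x * (\<Prod>s\<in>R. z (\<tau> s) (x s))) = 0" .
qed

section \<open>Lexicographic order and leading words\<close>

definition seq_less :: "nat \<Rightarrow> (nat \<Rightarrow> 'a::linorder) \<Rightarrow> (nat \<Rightarrow> 'a) \<Rightarrow> bool" where
  "seq_less m u v \<longleftrightarrow> (\<exists>i<m. u i < v i \<and> (\<forall>j<i. u j = v j))"

lemma seq_less_irrefl: "\<not> seq_less m u u"
  by (simp add: seq_less_def)

lemma seq_less_trans:
  assumes "seq_less m u v" "seq_less m v w"
  shows "seq_less m u w"
proof -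
  obtain i j where i: "i < m" "u i < v i" "\<And>k. k < i \<Longrightarrow> u k = v k"
    and j: "j < m" "v j < w j" "\<And>k. k < j \<Longrightarrow> v k = w k"
    using assms unfolding seq_less_def by blast
  have "u (min i j) < w (min i j)"
    using i(2) j(2) i(3)[of j] j(3)[of i] by (cases i j rule: linorder_cases) (auto simp: min_def)
  moreover have "\<forall>k<min i j. u k = w k" using i(3) j(3) by simp
  ultimately show ?thesis using i(1) unfolding seq_less_def by (intro exI[of _ "min i j"]) simp
qed

text \<open>Both functions are \<open>undefined\<close> outside the rows, so the first difference
  lies among the rows.\<close>

lemma seq_less_total:
  assumes "u \<in> PiE {..<m} U" "v \<in> PiE {..<m} V" "u \<noteq> v"
  shows "seq_less m u v \<or> seq_less m v u"
proof -
  define i where "i = (LEAST i. u i \<noteq> v i)"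
  have "\<exists>i. u i \<noteq> v i" using assms(3) by auto
  then have i: "u i \<noteq> v i" unfolding i_def by (rule LeastI_ex)
  have less: "u j = v j" if "j < i" for j using not_less_Least[of j] that unfolding i_def by blast
  have "i < m"
    using i PiE_arb[OF assms(1), of i] PiE_arb[OF assms(2), of i] by (cases "i < m") simp_all
  with i less show ?thesis unfolding seq_less_def by (metis linorder_neqE)
qed

definition leading :: "'y set \<Rightarrow> nat \<Rightarrow> ((nat \<Rightarrow> 'y::linorder) \<Rightarrow> 'k::zero) \<Rightarrow> (nat \<Rightarrow> 'y) \<Rightarrow> bool" where
  "leading Y m F x \<longleftrightarrow> x \<in> PiE {..<m} (\<lambda>_. Y) \<and> F x \<noteq> 0 \<and>
     (\<forall>y\<in>PiE {..<m} (\<lambda>_. Y). F y \<noteq> 0 \<longrightarrow> y \<noteq> x \<longrightarrow> seq_less m y x)"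

text \<open>Otherwise there is for each bound a word into which no word up to that length embeds.
  Letting the bounds outgrow the lengths already met yields a sequence without any embedded
  pair.\<close>

lemma finite_basis:
  fixes L :: "'a list set"
  assumes "\<And>F :: nat \<Rightarrow> 'a list. (\<And>i. F i \<in> L) \<Longrightarrow> \<exists>i j. i < j \<and> list_emb P (F i) (F j)"
  shows "\<exists>C. \<forall>ys\<in>L. \<exists>xs\<in>L. length xs \<le> C \<and> list_emb P xs ys"
proof (rule ccontr)
  assume "\<not> ?thesis"
  then have "\<forall>C. \<exists>ys. ys \<in> L \<and> (\<forall>xs\<in>L. length xs \<le> C \<longrightarrow> \<not> list_emb P xs ys)" by blast
  from choice[OF this] obtain y where y: "\<And>C. y C \<in> L"
    "\<And>C xs. xs \<in> L \<Longrightarrow> length xs \<le> C \<Longrightarrow> \<not> list_emb P xs (y C)" by blast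
  define c where "c = rec_nat 0 (\<lambda>_ k. max k (length (y k)))"
  have c: "c (Suc n) = max (c n) (length (y (c n)))" for n by (simp add: c_def)
  have mono: "incseq c" by (rule incseq_SucI) (simp add: c)
  obtain i j where ij: "i < j" "list_emb P (y (c i)) (y (c j))"
    using assms[of "\<lambda>n. y (c n)"] y(1) by blast
  have "length (y (c i)) \<le> c (Suc i)" by (simp add: c)
  also have "\<dots> \<le> c j" using incseqD[OF mono] ij(1) by simp
  finally show False using y(2)[OF y(1)] ij(2) by blast
qed

text \<open>The order on multisets is compatible with addition, so multiplying rows and inserting
  constant rows takes leading words to leading words. Uniformity in d comes from putting the leading
  words of all d into one set before the length bound is extracted.\<close>

theorem bounded_gen_multisets:
  fixes Y :: "'d \<Rightarrow> 'a::linorder multiset set" and Z :: "('a multiset \<Rightarrow> 'k::field_char_0) set"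
  assumes A: "finite A" "\<And>d a. d \<in> D \<Longrightarrow> a \<in> Y d \<Longrightarrow> set_mset a \<subseteq> A"
    and finY: "\<And>d. d \<in> D \<Longrightarrow> finite (Y d)"
    and shift: "\<And>d d' a b c. d \<in> D \<Longrightarrow> d' \<in> D \<Longrightarrow> a \<in> Y d \<Longrightarrow> a + b \<in> Y d' \<Longrightarrow> c \<in> Y d \<Longrightarrow> c + b \<in> Y d'"
    and Z: "\<And>z a b. z \<in> Z \<Longrightarrow> z (a + b) = z a * z b"
  shows "\<exists>C. \<forall>d\<in>D. bounded_gen (Y d) Z r C"
proof -
  define leads where "leads = {map x [0..<m] | x m. \<exists>d\<in>D. \<exists>F. vanishes (Y d) Z r {..<m} {..<m} F \<and> leading (Y d) m F x}"
  have "\<exists>C. \<forall>ys\<in>leads. \<exists>xs\<in>leads. length xs \<le> C \<and> list_emb (\<subseteq>#) xs ys"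
  proof (rule finite_basis, rule higman[where A = "{a. set_mset a \<subseteq> A}"])
    fix F :: "nat \<Rightarrow> 'a multiset list" and i
    assume "\<And>i. F i \<in> leads"
    then have "F i \<in> leads" .
    then show "set (F i) \<subseteq> {a. set_mset a \<subseteq> A}"
      using A(2) unfolding leads_def leading_def by (fastforce simp: PiE_iff)
  next
    fix f :: "nat \<Rightarrow> 'a multiset" assume "\<And>i. f i \<in> {a. set_mset a \<subseteq> A}"
    then have "set_mset (f i) \<subseteq> A" for i by blast
    from dickson_multiset[of A f, OF A(1) this] obtain \<phi> :: "nat \<Rightarrow> nat"
      where \<phi>: "strict_mono \<phi>" "\<And>i j. i \<le> j \<Longrightarrow> f (\<phi> i) \<subseteq># f (\<phi> j)" by auto
    then show "\<exists>\<phi> :: nat \<Rightarrow> nat. strict_mono \<phi> \<and> (\<forall>i j. i < j \<longrightarrow> f (\<phi> i) \<subseteq># f (\<phi> j))"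
      by (intro exI[of _ \<phi>]) (simp add: less_imp_le)
  qed
  then obtain C where C: "\<And>ys. ys \<in> leads \<Longrightarrow> \<exists>xs\<in>leads. length xs \<le> C \<and> list_emb (\<subseteq>#) xs ys"
    by blast
  have "bounded_gen (Y d) Z r C" if d: "d \<in> D" for d
    unfolding bounded_gen_def
  proof (intro allI impI)
    fix m F assume F: "vanishes (Y d) Z r {..<m} {..<m} F"
    let ?\<Omega> = "PiE {..<m} (\<lambda>_. Y d)"
    let ?J = "vanishes (Y d) Z r {..<m} {..<m}" and ?g = "generated (Y d) Z r C {..<m}"
    have fin: "finite ?\<Omega>" using finY[OF d] by (auto intro: finite_PiE)
    \<comment> \<open>The place in the finite lexicographic order, for an induction on the leading
      word.\<close>
    define rank where "rank y = card {x \<in> ?\<Omega>. seq_less m x y}" for y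
    have rank_mono: "rank u < rank v" if "u \<in> ?\<Omega>" "seq_less m u v" for u v
      unfolding rank_def
    proof (rule psubset_card_mono)
      show "{x \<in> ?\<Omega>. seq_less m x u} \<subset> {x \<in> ?\<Omega>. seq_less m x v}"
        using that seq_less_irrefl[of m u] by (blast intro: seq_less_trans)
    qed (use fin in simp)
    have "?g F" if "?J F" "\<And>y. y \<in> ?\<Omega> \<Longrightarrow> F y \<noteq> 0 \<Longrightarrow> rank y < k" for k F
      using that
    proof (induction k arbitrary: F)
      case 0
      then show ?case by (intro generated_zero) blast
    next
      case (Suc k F)
      show ?case
      proof (cases "\<exists>y\<in>?\<Omega>. F y \<noteq> 0 \<and> rank y = k")
        case False
        then show ?thesis using Suc.prems by (intro Suc.IH) (auto simp: less_Suc_eq)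
      next
        case True
        then obtain y where y: "y \<in> ?\<Omega>" "F y \<noteq> 0" "rank y = k" by blast
        have y_max: "seq_less m u y" if u: "u \<in> ?\<Omega>" "F u \<noteq> 0" "u \<noteq> y" for u
        proof -
          have "\<not> seq_less m y u"
            using rank_mono[OF y(1), of u] Suc.prems(2)[OF u(1,2)] y(3) by linarith
          then show ?thesis using seq_less_total[OF u(1) y(1) u(3)] by blast
        qed
        then have "leading (Y d) m F y" using y by (simp add: leading_def)
        then have "map y [0..<m] \<in> leads" using d Suc.prems(1) unfolding leads_def by blast
        then obtain xs where xs: "xs \<in> leads" "length xs \<le> C" "list_emb (\<subseteq>#) xs (map y [0..<m])"
          using C by blast
        then obtain x n d0 G where x: "xs = map x [0..<n]" and d0: "d0 \<in> D"
          and G: "vanishes (Y d0) Z r {..<n} {..<n} G" "leading (Y d0) n G x"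
          unfolding leads_def by blast
        let ?\<Psi> = "PiE {..<n} (\<lambda>_. Y d0)"
        have fin0: "finite ?\<Psi>" using finY[OF d0] by (auto intro: finite_PiE)
        have xin: "x \<in> ?\<Psi>" and Gx: "G x \<noteq> 0" using G(2) by (auto simp: leading_def)
        obtain f where f: "\<And>i j. i < j \<Longrightarrow> j < n \<Longrightarrow> f i < f j" "\<And>i. i < n \<Longrightarrow> f i < m"
          "\<And>i. i < n \<Longrightarrow> x i \<subseteq># y (f i)"
        proof -
          from list_emb_index[OF xs(3)] obtain f where
            f1: "\<forall>i j. i < j \<longrightarrow> j < n \<longrightarrow> f i < f j" and
            f2: "\<forall>i<n. f i < m \<and> map x [0..<n] ! i \<subseteq># map y [0..<m] ! f i"
            unfolding x by (auto simp del: nth_map nth_map_upt)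
          show thesis
          proof (rule that[of f])
            show "x i \<subseteq># y (f i)" if "i < n" for i
              using f2 that by (metis add_0 diff_zero nth_map_upt)
          qed (use f1 f2 in auto)
        qed
        define S where "S = f ` {..<n}"
        define g where "g = inv_into {..<n} f"
        have injf: "inj_on f {..<n}"
          by (rule linorder_inj_onI') (use f(1) in fastforce)
        have gf: "g (f i) = i" if "i < n" for i
          unfolding g_def using injf that by (intro inv_into_f_f) auto
        have S: "S \<subseteq> {..<m}" using f(2) by (auto simp: S_def)
        \<comment> \<open>The monomial by which row i of the smaller leading word has to be
          multiplied to give row \<open>f i\<close> of y.\<close>
        define b where "b i = y (f i) - x i" for i
        have xb: "x i + b i = y (f i)" if "i < n" for i
          unfolding b_def using f(3)[OF that] by simp
        \<comment> \<open>Row i is multiplied by \<open>b i\<close> and placed at row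
          \<open>f i\<close>; the remaining rows are filled with those of y.\<close>
        define \<psi> where "\<psi> v = (\<lambda>s\<in>{..<m}. if s \<in> S then v (g s) + b (g s) else y s)" for v
        have \<psi>f: "\<psi> v (f i) = v i + b i" if "i < n" for v i
          using that f(2) by (simp add: \<psi>_def S_def gf)
        have \<psi>o: "\<psi> v s = y s" if "s < m" "s \<notin> S" for v s using that by (simp add: \<psi>_def)
        have \<psi>_in: "\<psi> v \<in> ?\<Omega>" if v: "v \<in> ?\<Psi>" for v
        proof -
          have "\<psi> v s \<in> Y d" if s: "s < m" for s
          proof (cases "s \<in> S")
            case True
            then obtain i where i: "i < n" "s = f i" by (auto simp: S_def)
            have "x i + b i \<in> Y d" using xb[OF i(1)] y(1) f(2)[OF i(1)] by auto
            then show ?thesis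
              unfolding i(2) \<psi>f[OF i(1)]
              by (rule shift[OF d0 d, rotated]) (use xin v i(1) in auto)
          next
            case False
            then show ?thesis using \<psi>o s y(1) by auto
          qed
          then show ?thesis by (simp add: PiE_iff \<psi>_def)
        qed
        have \<psi>x: "\<psi> x = y"
        proof
          fix s
          show "\<psi> x s = y s"
          proof (cases "s < m")
            case True
            then show ?thesis
              using \<psi>o[OF True] by (cases "s \<in> S") (auto simp: S_def \<psi>f xb)
          next
            case False
            then show ?thesis using y(1) by (auto simp: \<psi>_def PiE_def extensional_def)
          qed
        qed
        have \<psi>_eq: "v = x" if "v \<in> ?\<Psi>" "\<psi> v = y" for v
        proof (rule PiE_ext[OF that(1) xin])
          fix i assume "i \<in> {..<n}"
          then have "v i + b i = x i + b i" using \<psi>f[of i v] xb[of i] that(2) by simp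
          then show "v i = x i" by simp
        qed
        \<comment> \<open>Since f is increasing, the first difference of v and x becomes the first
          difference of the images, and adding \<open>b i\<close> keeps the strict
          inequality.\<close>
        have \<psi>_less: "seq_less m (\<psi> v) y" if vx: "seq_less n v x" for v
        proof -
          obtain i where i: "i < n" "v i < x i" "\<And>j. j < i \<Longrightarrow> v j = x j"
            using vx unfolding seq_less_def by blast
          have "\<psi> v (f i) < y (f i)"
            unfolding \<psi>f[OF i(1)] xb[OF i(1), symmetric] using i(2) by simp
          moreover have "\<psi> v s = y s" if s: "s < f i" for s
          proof (cases "s \<in> S")
            case True
            then obtain j where j: "j < n" "s = f j" by (auto simp: S_def)
            have "j < i" using s f(1)[of i j] j i(1) by (cases i j rule: linorder_cases) auto
            then show ?thesis using j by (simp add: \<psi>f i(3) xb)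
          next
            case False
            then show ?thesis using \<psi>o s f(2)[OF i(1)] by simp
          qed
          ultimately show ?thesis using f(2)[OF i(1)] unfolding seq_less_def by blast
        qed
        \<comment> \<open>\<open>G\<close> transported by \<open>\<psi>\<close>: a tensor with
          leading word y and leading coefficient \<open>G x\<close>, active only in the rows
          \<open>S\<close>.\<close>
        define H where "H u = (\<Sum>v\<in>?\<Psi>. if \<psi> v = u then G v else 0)" for u
        have H_nz: "\<exists>v\<in>?\<Psi>. G v \<noteq> 0 \<and> u = \<psi> v" if "H u \<noteq> 0" for u
        proof -
          from that obtain v where "v \<in> ?\<Psi>" "(if \<psi> v = u then G v else 0) \<noteq> 0"
            unfolding H_def by (rule sum.not_neutral_contains_not_neutral)
          then show ?thesis by (auto split: if_splits)
        qed
        have Hy: "H y = G x"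
        proof -
          have "H y = (\<Sum>v\<in>?\<Psi>. if v = x then G v else 0)"
            unfolding H_def
          proof (rule sum.cong[OF refl])
            fix v assume v: "v \<in> ?\<Psi>"
            have "\<psi> v = y \<longleftrightarrow> v = x" using \<psi>_eq[OF v] \<psi>x by metis
            then show "(if \<psi> v = y then G v else 0) = (if v = x then G v else 0)" by simp
          qed
          then show ?thesis using fin0 xin by (simp add: sum.delta)
        qed
        have sum_H: "(\<Sum>u\<in>?\<Omega>. H u * h u) = (\<Sum>v\<in>?\<Psi>. G v * h (\<psi> v))" for h
        proof -
          have "(\<Sum>u\<in>?\<Omega>. H u * h u) = (\<Sum>v\<in>?\<Psi>. \<Sum>u\<in>?\<Omega>. if \<psi> v = u then G v * h u else 0)"
            unfolding H_def sum_distrib_right by (subst sum.swap) (auto intro!: sum.cong)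
          also have "\<dots> = (\<Sum>v\<in>?\<Psi>. G v * h (\<psi> v))"
            using fin \<psi>_in by (intro sum.cong refl) (simp add: sum.delta')
          finally show ?thesis .
        qed
        have H_S: "vanishes (Y d) Z r {..<m} S H"
        proof (rule vanishesI)
          fix z and \<tau> :: "nat \<Rightarrow> nat" assume z: "\<And>t. t < r \<Longrightarrow> z t \<in> Z" and \<tau>: "\<And>s. \<tau> s < r"
          have "(\<Sum>u\<in>?\<Omega>. H u * (\<Prod>s\<in>S. z (\<tau> s) (u s))) =
             (\<Sum>v\<in>?\<Psi>. G v * (\<Prod>s\<in>S. z (\<tau> s) (\<psi> v s)))" by (rule sum_H)
          also have "\<dots> = (\<Sum>v\<in>?\<Psi>. (\<Prod>i<n. z (\<tau> (f i)) (b i)) * (G v * (\<Prod>i<n. z (\<tau> (f i)) (v i))))"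
          proof (rule sum.cong[OF refl])
            fix v
            have "(\<Prod>s\<in>S. z (\<tau> s) (\<psi> v s)) = (\<Prod>i<n. z (\<tau> (f i)) (v i + b i))"
              unfolding S_def by (subst prod.reindex[OF injf]) (simp add: \<psi>f)
            then show "G v * (\<Prod>s\<in>S. z (\<tau> s) (\<psi> v s)) =
              (\<Prod>i<n. z (\<tau> (f i)) (b i)) * (G v * (\<Prod>i<n. z (\<tau> (f i)) (v i)))"
              by (simp add: Z[OF z[OF \<tau>]] prod.distrib)
          qed
          also have "\<dots> = 0"
            using vanishesD[where z = z and \<tau> = "\<lambda>i. \<tau> (f i)", OF G(1) z \<tau>] by (simp flip: sum_distrib_left)
          finally show "(\<Sum>u\<in>?\<Omega>. H u * (\<Prod>s\<in>S. z (\<tau> s) (u s))) = 0" .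
        qed
        have H_off: "constant_off (Y d) {..<m} S y H"
          unfolding constant_off_def
        proof (intro ballI impI)
          fix u s assume "H u \<noteq> 0" "s \<in> {..<m} - S"
          then show "u s = y s" using H_nz[of u] \<psi>o[of s] by auto
        qed
        have "card S \<le> C" using card_image_le[of "{..<n}" f] xs(2) by (simp add: S_def x)
        then have gH: "?g H" by (intro generated_single[OF S _ H_S H_off])
        \<comment> \<open>The leading terms cancel, so every word left in the support precedes
          y.\<close>
        define F' where "F' u = F u - F y / G x * H u" for u
        have "?g F'"
        proof (rule Suc.IH)
          show "?J F'"
            unfolding F'_def
            by (intro vanishes_diff vanishes_cmult Suc.prems(1) vanishes_rows[OF _ S H_S H_off]) simp
          fix u assume u: "u \<in> ?\<Omega>" "F' u \<noteq> 0"
          have "F' y = 0" using Gx by (simp add: F'_def Hy)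
          then have uy: "u \<noteq> y" using u(2) by blast
          have "seq_less m u y"
          proof (cases "F u = 0")
            case True
            then have "H u \<noteq> 0" using u(2) by (auto simp: F'_def)
            then obtain v where v: "v \<in> ?\<Psi>" "G v \<noteq> 0" "u = \<psi> v" using H_nz by blast
            then have "seq_less n v x" using uy \<psi>x G(2) unfolding leading_def by blast
            then show ?thesis using \<psi>_less v(3) by simp
          next
            case False
            then show ?thesis using y_max u(1) uy by simp
          qed
          from rank_mono[OF u(1) this] show "rank u < k" using y(3) by simp
        qed
        from generated_add[OF this generated_cmult[OF gH, of "F y / G x"]] show ?thesis
          by (simp add: F'_def)
      qed
    qed
    moreover obtain k where "\<forall>i\<in>rank ` ?\<Omega>. i < k"
      using fin finite_nat_set_iff_bounded[of "rank ` ?\<Omega>"] by auto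
    ultimately show "?g F" using F by (meson imageI)
  qed
  then show ?thesis by blast
qed

section \<open>From tensors to ideals\<close>

definition monom_eval :: "('v \<Rightarrow>\<^sub>0 nat) \<Rightarrow> ('v \<Rightarrow> 'k::comm_semiring_1) \<Rightarrow> 'k" where
  "monom_eval m x = (\<Prod>v\<in>Poly_Mapping.keys m. x v ^ Poly_Mapping.lookup m v)"

lemma monom_eval_superset:
  assumes "finite V" "Poly_Mapping.keys m \<subseteq> V"
  shows "monom_eval m x = (\<Prod>v\<in>V. x v ^ Poly_Mapping.lookup m v)"
  unfolding monom_eval_def
  by (rule prod.mono_neutral_left) (use assms in \<open>auto simp: in_keys_iff\<close>)

lemma monom_eval_0 [simp]: "monom_eval 0 x = 1"
  by (simp add: monom_eval_def)

lemma monom_eval_add: "monom_eval (m + n) x = monom_eval m x * monom_eval n x"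
proof -
  let ?V = "Poly_Mapping.keys m \<union> Poly_Mapping.keys n"
  have "monom_eval (m + n) x = (\<Prod>v\<in>?V. x v ^ Poly_Mapping.lookup (m + n) v)"
    by (rule monom_eval_superset) (use keys_add[of m n] in auto)
  also have "\<dots> = monom_eval m x * monom_eval n x"
    by (simp add: monom_eval_superset[of ?V] lookup_add power_add prod.distrib)
  finally show ?thesis .
qed

lemma monom_eval_single: "monom_eval (Poly_Mapping.single v 1) x = x v"
  by (simp add: monom_eval_def)

lemma monom_eval_sum: "monom_eval (\<Sum>i\<in>I. f i) x = (\<Prod>i\<in>I. monom_eval (f i) x)"
  by (induction I rule: infinite_finite_induct) (simp_all add: monom_eval_add)

lemma mpoly_eval_superset:
  assumes "finite V" "Poly_Mapping.keys p \<subseteq> V"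
  shows "mpoly_eval p x = (\<Sum>m\<in>V. Poly_Mapping.lookup p m * monom_eval m x)"
  unfolding mpoly_eval_def monom_eval_def[symmetric]
  by (rule sum.mono_neutral_left) (use assms in \<open>auto simp: in_keys_iff\<close>)

lemma mpoly_eval_0 [simp]: "mpoly_eval 0 x = 0"
  by (simp add: mpoly_eval_def)

lemma mpoly_eval_add: "mpoly_eval (p + q) x = mpoly_eval p x + mpoly_eval q x"
proof -
  let ?V = "Poly_Mapping.keys p \<union> Poly_Mapping.keys q"
  have "mpoly_eval (p + q) x = (\<Sum>m\<in>?V. Poly_Mapping.lookup (p + q) m * monom_eval m x)"
    by (rule mpoly_eval_superset) (use keys_add[of p q] in auto)
  also have "\<dots> = mpoly_eval p x + mpoly_eval q x"
    by (simp add: mpoly_eval_superset[of ?V] lookup_add distrib_right sum.distrib)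
  finally show ?thesis .
qed

lemma mpoly_eval_sum: "mpoly_eval (\<Sum>i\<in>I. f i) x = (\<Sum>i\<in>I. mpoly_eval (f i) x)"
  by (induction I rule: infinite_finite_induct) (simp_all add: mpoly_eval_add)

lemma mpoly_eval_single: "mpoly_eval (Poly_Mapping.single m a) x = a * monom_eval m x"
  by (cases "a = 0") (simp_all add: mpoly_eval_def monom_eval_def)

lemma mpoly_eq_sum_single:
  "p = (\<Sum>m\<in>Poly_Mapping.keys p. Poly_Mapping.single m (Poly_Mapping.lookup p m))"
proof (rule poly_mapping_eqI)
  fix k
  show "Poly_Mapping.lookup p k =
    Poly_Mapping.lookup (\<Sum>m\<in>Poly_Mapping.keys p. Poly_Mapping.single m (Poly_Mapping.lookup p m)) k"
    by (simp add: lookup_sum lookup_single when_def in_keys_iff)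
qed

lemma mpoly_eval_mult:
  fixes p q :: "('v, 'k::comm_semiring_1) mpoly"
  shows "mpoly_eval (p * q) x = mpoly_eval p x * mpoly_eval q x"
proof -
  have "p * q = (\<Sum>m\<in>Poly_Mapping.keys p. \<Sum>n\<in>Poly_Mapping.keys q.
      Poly_Mapping.single (m + n) (Poly_Mapping.lookup p m * Poly_Mapping.lookup q n))"
    by (subst mpoly_eq_sum_single[of p], subst mpoly_eq_sum_single[of q])
      (simp add: sum_product mult_single)
  then have "mpoly_eval (p * q) x = (\<Sum>m\<in>Poly_Mapping.keys p. \<Sum>n\<in>Poly_Mapping.keys q.
      (Poly_Mapping.lookup p m * monom_eval m x) * (Poly_Mapping.lookup q n * monom_eval n x))"
    by (simp add: mpoly_eval_sum mpoly_eval_single monom_eval_add mult_ac)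
  also have "\<dots> = mpoly_eval p x * mpoly_eval q x"
    unfolding mpoly_eval_def monom_eval_def[symmetric] by (simp add: sum_product)
  finally show ?thesis .
qed

lemma poly_ring_0 [simp]: "0 \<in> poly_ring X"
  by (simp add: poly_ring_def mpoly_vars_def)

lemma poly_ring_add: "p \<in> poly_ring X \<Longrightarrow> q \<in> poly_ring X \<Longrightarrow> p + q \<in> poly_ring X"
  using keys_add[of p q] unfolding poly_ring_def mpoly_vars_def by blast

lemma poly_ring_sum: "(\<And>i. i \<in> I \<Longrightarrow> f i \<in> poly_ring X) \<Longrightarrow> (\<Sum>i\<in>I. f i) \<in> poly_ring X"
  by (induction I rule: infinite_finite_induct) (simp_all add: poly_ring_add)

lemma poly_ring_single: "Poly_Mapping.keys m \<subseteq> X \<Longrightarrow> Poly_Mapping.single m a \<in> poly_ring X"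
  by (cases "a = 0") (auto simp: poly_ring_def mpoly_vars_def)

lemma poly_ring_mult:
  assumes "p \<in> poly_ring X" "q \<in> poly_ring X"
  shows "p * q \<in> poly_ring X"
proof -
  have "Poly_Mapping.keys k \<subseteq> X" if k: "k \<in> Poly_Mapping.keys (p * q)" for k
  proof -
    obtain a b where ab: "k = a + b" "a \<in> Poly_Mapping.keys p" "b \<in> Poly_Mapping.keys q"
      using keys_mult[of p q] k by blast
    then have "Poly_Mapping.keys a \<subseteq> X" "Poly_Mapping.keys b \<subseteq> X"
      using assms by (auto simp: poly_ring_def mpoly_vars_def)
    then show ?thesis using keys_add[of a b] ab(1) by blast
  qed
  then show ?thesis by (auto simp: poly_ring_def mpoly_vars_def)
qed

lemma ideal_gen_in_0: "0 \<in> ideal_gen_in X G"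
  unfolding ideal_gen_in_def by (rule CollectI, rule exI[of _ "{}"]) simp

lemma ideal_gen_in_mult:
  assumes "q \<in> poly_ring X" "g \<in> G"
  shows "q * g \<in> ideal_gen_in X G"
  unfolding ideal_gen_in_def
  by (rule CollectI, rule exI[of _ "{g}"], rule exI[of _ "\<lambda>_. q"]) (use assms in simp)

lemma ideal_gen_in_add:
  assumes "p \<in> ideal_gen_in X G" "q \<in> ideal_gen_in X G"
  shows "p + q \<in> ideal_gen_in X G"
proof -
  obtain A a where A: "p = (\<Sum>g\<in>A. a g * g)" "finite A" "A \<subseteq> G" "\<forall>g\<in>A. a g \<in> poly_ring X"
    using assms(1) unfolding ideal_gen_in_def by blast
  obtain B b where B: "q = (\<Sum>g\<in>B. b g * g)" "finite B" "B \<subseteq> G" "\<forall>g\<in>B. b g \<in> poly_ring X"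
    using assms(2) unfolding ideal_gen_in_def by blast
  let ?c = "\<lambda>g. (if g \<in> A then a g else 0) + (if g \<in> B then b g else 0)"
  have "p = (\<Sum>g\<in>A \<union> B. (if g \<in> A then a g else 0) * g)"
    unfolding A(1) by (rule sum.mono_neutral_cong_left) (use A(2) B(2) in auto)
  moreover have "q = (\<Sum>g\<in>A \<union> B. (if g \<in> B then b g else 0) * g)"
    unfolding B(1) by (rule sum.mono_neutral_cong_left) (use A(2) B(2) in auto)
  ultimately have "p + q = (\<Sum>g\<in>A \<union> B. ?c g * g)"
    by (simp add: distrib_right sum.distrib)
  moreover have "\<forall>g\<in>A \<union> B. ?c g \<in> poly_ring X"
    using A(4) B(4) by (auto intro!: poly_ring_add)
  ultimately show ?thesis
    unfolding ideal_gen_in_def using A(2,3) B(2,3)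
    by (intro CollectI exI[of _ "A \<union> B"] exI[of _ ?c]) auto
qed

lemma ideal_gen_in_sum:
  "(\<And>i. i \<in> I \<Longrightarrow> f i \<in> ideal_gen_in X G) \<Longrightarrow> (\<Sum>i\<in>I. f i) \<in> ideal_gen_in X G"
  by (induction I rule: infinite_finite_induct) (simp_all add: ideal_gen_in_add ideal_gen_in_0)

section \<open>Forms of degree m from tensors with m rows\<close>

definition row_monom :: "nat set \<Rightarrow> (nat \<Rightarrow> 'v) \<Rightarrow> 'v \<Rightarrow>\<^sub>0 nat" where
  "row_monom S x = (\<Sum>s\<in>S. Poly_Mapping.single (x s) 1)"

definition monom_degree :: "('v \<Rightarrow>\<^sub>0 nat) \<Rightarrow> nat" where
  "monom_degree m = (\<Sum>v\<in>Poly_Mapping.keys m. Poly_Mapping.lookup m v)"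

lemma monom_degree_superset:
  assumes "finite V" "Poly_Mapping.keys m \<subseteq> V"
  shows "monom_degree m = (\<Sum>v\<in>V. Poly_Mapping.lookup m v)"
  unfolding monom_degree_def
  by (rule sum.mono_neutral_left) (use assms in \<open>auto simp: in_keys_iff\<close>)

lemma monom_degree_add: "monom_degree (m + n) = monom_degree m + monom_degree n"
proof -
  let ?V = "Poly_Mapping.keys m \<union> Poly_Mapping.keys n"
  have "monom_degree (m + n) = (\<Sum>v\<in>?V. Poly_Mapping.lookup (m + n) v)"
    by (rule monom_degree_superset) (use keys_add[of m n] in auto)
  also have "\<dots> = monom_degree m + monom_degree n"
    by (simp add: monom_degree_superset[of ?V] lookup_add sum.distrib)
  finally show ?thesis .
qed

lemma monom_degree_row_monom: "finite S \<Longrightarrow> monom_degree (row_monom S x) = card S"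
  by (induction S rule: finite_induct)
    (simp_all add: row_monom_def monom_degree_add, simp_all add: monom_degree_def)

lemma keys_row_monom: "Poly_Mapping.keys (row_monom S x) \<subseteq> x ` S"
  using keys_sum[of "\<lambda>s. Poly_Mapping.single (x s) (1::nat)" S] by (auto simp: row_monom_def)

lemma monom_eval_row_monom: "monom_eval (row_monom S x) v = (\<Prod>s\<in>S. v (x s))"
  by (simp add: row_monom_def monom_eval_sum monom_eval_single[simplified])

text \<open>List the variables of the monomial with multiplicity, one in each row.\<close>

lemma row_monom_surj:
  assumes "Poly_Mapping.keys \<mu> \<subseteq> X" "monom_degree \<mu> = m"
  shows "\<exists>x\<in>PiE {..<m} (\<lambda>_. X). row_monom {..<m} x = \<mu>"
  using assms
proof (induction m arbitrary: \<mu>)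
  case 0
  then have "\<mu> = 0"
    by (intro poly_mapping_eqI) (auto simp: monom_degree_def in_keys_iff)
  then show ?case by (simp add: row_monom_def)
next
  case (Suc m)
  have "Poly_Mapping.keys \<mu> \<noteq> {}"
    using Suc.prems(2) unfolding monom_degree_def by (metis sum.empty nat.distinct(1))
  then obtain v where v: "v \<in> Poly_Mapping.keys \<mu>" by blast
  define \<nu> where "\<nu> = \<mu> - Poly_Mapping.single v 1"
  have \<mu>: "\<mu> = \<nu> + Poly_Mapping.single v 1"
    using v by (intro poly_mapping_eqI)
      (auto simp: \<nu>_def lookup_add lookup_minus lookup_single when_def in_keys_iff)
  have "Poly_Mapping.keys \<nu> \<subseteq> X"
    using Suc.prems(1) by (auto simp: \<mu> in_keys_iff lookup_add subset_iff)
  moreover have "monom_degree \<nu> = m"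
    using Suc.prems(2) unfolding \<mu> monom_degree_add by (simp add: monom_degree_def)
  ultimately obtain x where x: "x \<in> PiE {..<m} (\<lambda>_. X)" "row_monom {..<m} x = \<nu>"
    using Suc.IH by blast
  let ?y = "x(m := v)"
  have "?y \<in> PiE {..<Suc m} (\<lambda>_. X)"
    using x(1) v Suc.prems(1) by (auto simp: PiE_iff extensional_def less_Suc_eq)
  moreover have "row_monom {..<Suc m} ?y = \<mu>"
  proof -
    have "row_monom {..<m} ?y = row_monom {..<m} x"
      unfolding row_monom_def by (intro sum.cong) auto
    then show ?thesis using x(2) by (simp add: row_monom_def \<mu>)
  qed
  ultimately show ?case by blast
qed

text \<open>The passage from ordered tensors to commuting variables. Rows outside \<open>S\<close>
  contribute no variable, so the form has degree \<open>card S\<close> rather than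
  \<open>card R\<close>.\<close>

definition tensor_poly :: "'v set \<Rightarrow> nat set \<Rightarrow> nat set \<Rightarrow> ((nat \<Rightarrow> 'v) \<Rightarrow> 'k::comm_semiring_1) \<Rightarrow> ('v, 'k) mpoly" where
  "tensor_poly X R S F = (\<Sum>x\<in>PiE R (\<lambda>_. X). Poly_Mapping.single (row_monom S x) (F x))"

lemma mpoly_eval_tensor_poly:
  "mpoly_eval (tensor_poly X R S F) v = (\<Sum>x\<in>PiE R (\<lambda>_. X). F x * (\<Prod>s\<in>S. v (x s)))"
  by (simp add: tensor_poly_def mpoly_eval_sum mpoly_eval_single monom_eval_row_monom)

lemma tensor_poly_in_ring: "S \<subseteq> R \<Longrightarrow> tensor_poly X R S F \<in> poly_ring X"
  unfolding tensor_poly_def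
proof (intro poly_ring_sum poly_ring_single)
  fix x assume "S \<subseteq> R" "x \<in> PiE R (\<lambda>_. X)"
  then show "Poly_Mapping.keys (row_monom S x) \<subseteq> X" using keys_row_monom[of S x] by fastforce
qed

lemma mpoly_total_degree_tensor_poly:
  assumes "finite S"
  shows "mpoly_total_degree (tensor_poly X R S F) \<le> card S"
proof -
  have "monom_degree m = card S" if m: "m \<in> Poly_Mapping.keys (tensor_poly X R S F)" for m
  proof -
    obtain x where "m \<in> Poly_Mapping.keys (Poly_Mapping.single (row_monom S x) (F x))"
      using m keys_sum[of "\<lambda>x. Poly_Mapping.single (row_monom S x) (F x)" "PiE R (\<lambda>_. X)"]
      unfolding tensor_poly_def by blast
    then have "m = row_monom S x" by (simp split: if_splits)
    then show ?thesis using assms by (simp add: monom_degree_row_monom)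
  qed
  then show ?thesis
    unfolding mpoly_total_degree_def monom_degree_def[symmetric] by (intro Max.boundedI) auto
qed

text \<open>An inserted constant row becomes multiplication by a variable: here generation of
  tensors turns into membership in an ideal.\<close>

lemma tensor_poly_factor:
  fixes F :: "(nat \<Rightarrow> 'v) \<Rightarrow> 'k::field_char_0"
  assumes R: "finite R" "S \<subseteq> R" and F: "constant_off X R S c F"
  shows "tensor_poly X R R F = Poly_Mapping.single (row_monom (R - S) c) 1 * tensor_poly X R S F"
  unfolding tensor_poly_def sum_distrib_left mult_single
proof (rule sum.cong[OF refl])
  fix x assume x: "x \<in> PiE R (\<lambda>_. X)"
  show "Poly_Mapping.single (row_monom R x) (F x) =
    Poly_Mapping.single (row_monom (R - S) c + row_monom S x) (1 * F x)"
  proof (cases "F x = 0")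
    case False
    then have "\<forall>s\<in>R - S. x s = c s" using F x unfolding constant_off_def by blast
    then have "row_monom R x = row_monom (R - S) c + row_monom S x"
      unfolding row_monom_def by (subst sum.subset_diff[OF R(2,1)]) simp
    then show ?thesis by simp
  qed simp
qed

text \<open>Expanding the product chooses one of the r points for every row, which is how the choice
  functions \<open>\<tau>\<close> arise.\<close>

lemma prod_linear_combination:
  fixes z :: "nat \<Rightarrow> 'v \<Rightarrow> 'k::field_char_0"
  assumes "finite S"
  shows "(\<Sum>x\<in>P. F x * (\<Prod>s\<in>S. \<Sum>t<r. c t * z t (x s))) =
    (\<Sum>\<tau>\<in>PiE S (\<lambda>_. {..<r}). (\<Prod>s\<in>S. c (\<tau> s)) * (\<Sum>x\<in>P. F x * (\<Prod>s\<in>S. z (\<tau> s) (x s))))"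
  using assms
  by (subst prod_sum_PiE)
    (simp_all add: sum_distrib_left prod.distrib mult_ac sum.swap[of _ _ P])

text \<open>The coefficients c supply the scaling of the cone, so \<open>Z\<close> can consist of
  products of minors without a scalar; this keeps its points multiplicative.\<close>

definition secants :: "('v \<Rightarrow> 'k::field_char_0) set \<Rightarrow> nat \<Rightarrow> ('v \<Rightarrow> 'k) set" where
  "secants Z r = {x. \<exists>c z. (\<forall>t<r. z t \<in> Z) \<and> x = (\<lambda>J. \<Sum>t<r. c t * z t J)}"

lemma vanishes_tensor_poly:
  assumes S: "finite S" "S \<subseteq> R" and r: "0 < r" and F: "vanishes X Z r R S F"
  shows "tensor_poly X R S F \<in> vanishing_ideal X (secants Z r)"
  unfolding vanishing_ideal_def
proof (intro CollectI conjI ballI tensor_poly_in_ring S)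
  fix v assume "v \<in> secants Z r"
  then obtain c z where z: "\<And>t. t < r \<Longrightarrow> z t \<in> Z" and v: "v = (\<lambda>J. \<Sum>t<r. c t * z t J)"
    unfolding secants_def by blast
  have "(\<Sum>x\<in>PiE R (\<lambda>_. X). F x * (\<Prod>s\<in>S. z (\<tau> s) (x s))) = 0" if \<tau>: "\<tau> \<in> PiE S (\<lambda>_. {..<r})" for \<tau>
  proof -
    \<comment> \<open>\<open>vanishes\<close> speaks of total functions with values below r; outside
      \<open>S\<close> the default 0 is such a value because r is positive.\<close>
    let ?\<tau> = "\<lambda>s. if s \<in> S then \<tau> s else 0"
    have "?\<tau> s < r" for s using \<tau> r by auto
    from vanishesD[where z = z and \<tau> = ?\<tau>, OF F z this]
    have "(\<Sum>x\<in>PiE R (\<lambda>_. X). F x * (\<Prod>s\<in>S. z (?\<tau> s) (x s))) = 0" by simp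
    moreover have "(\<Prod>s\<in>S. z (?\<tau> s) (x s)) = (\<Prod>s\<in>S. z (\<tau> s) (x s))" for x
      by (intro prod.cong) auto
    ultimately show ?thesis by simp
  qed
  then show "mpoly_eval (tensor_poly X R S F) v = 0"
    unfolding mpoly_eval_tensor_poly v prod_linear_combination[OF S(1)] by simp
qed

lemma generated_tensor_poly:
  assumes r: "0 < r" and R: "finite R" and F: "generated X Z r C R F"
  shows "tensor_poly X R R F \<in>
    ideal_gen_in X {g \<in> vanishing_ideal X (secants Z r). mpoly_total_degree g \<le> C}"
  using F
proof induction
  case (generated_zero F)
  then have "tensor_poly X R R F = 0" by (simp add: tensor_poly_def)
  then show ?case by (simp add: ideal_gen_in_0)
next
  case (generated_step F S c G H)
  let ?G = "{g \<in> vanishing_ideal X (secants Z r). mpoly_total_degree g \<le> C}"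
  have fS: "finite S" using finite_subset[OF generated_step.hyps(2) R] .
  have "tensor_poly X R R G \<in> ideal_gen_in X ?G"
  \<comment> \<open>If \<open>G\<close> vanishes, nothing forces the constants c to lie in
    \<open>X\<close>; otherwise an assignment in the support shows that they do.\<close>
  proof (cases "\<forall>x\<in>PiE R (\<lambda>_. X). G x = 0")
    case True
    then have "tensor_poly X R R G = 0" by (simp add: tensor_poly_def)
    then show ?thesis by (simp add: ideal_gen_in_0)
  next
    case False
    then obtain x where x: "x \<in> PiE R (\<lambda>_. X)" "G x \<noteq> 0" by blast
    have "c s \<in> X" if s: "s \<in> R - S" for s
    proof -
      have "x s = c s" using generated_step.hyps(4) x s unfolding constant_off_def by blast
      then show ?thesis using x(1) s PiE_mem[of x R "\<lambda>_. X" s] by simp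
    qed
    then have "Poly_Mapping.single (row_monom (R - S) c) 1 \<in> poly_ring X"
      using keys_row_monom[of "R - S" c] by (intro poly_ring_single) blast
    moreover have "tensor_poly X R S G \<in> ?G"
      using vanishes_tensor_poly[OF fS generated_step.hyps(2) r generated_step.hyps(5)]
        mpoly_total_degree_tensor_poly[OF fS, of X R G] generated_step.hyps(3) by simp
    ultimately show ?thesis
      unfolding tensor_poly_factor[OF R generated_step.hyps(2,4)] by (rule ideal_gen_in_mult)
  qed
  moreover have "tensor_poly X R R H = tensor_poly X R R F + tensor_poly X R R G"
    unfolding tensor_poly_def sum.distrib[symmetric] using generated_step.hyps(6)
    by (intro sum.cong) (simp_all add: single_add)
  ultimately show ?case using generated_step.IH by (simp add: ideal_gen_in_add)
qed

lemma permutes_row_monom: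
  assumes "\<rho> permutes {..<m}"
  shows "row_monom {..<m} (x \<circ> \<rho>) = row_monom {..<m} x"
  unfolding row_monom_def o_def
  by (rule sum.reindex_bij_betw[OF permutes_imp_bij[OF assms]])

lemma permutes_tensor:
  assumes "\<rho> permutes {..<m}" "x \<in> PiE {..<m} (\<lambda>_. X)"
  shows "x \<circ> \<rho> \<in> PiE {..<m} (\<lambda>_. X)"
proof (rule PiE_I)
  fix s assume "s \<in> {..<m}"
  then show "(x \<circ> \<rho>) s \<in> X"
    using permutes_in_image[OF assms(1), of s] PiE_mem[OF assms(2), of "\<rho> s"] by simp
next
  fix s assume "s \<notin> {..<m}"
  then show "(x \<circ> \<rho>) s = undefined"
    using permutes_not_in[OF assms(1)] PiE_arb[OF assms(2)] by simp
qed

text \<open>Equal fibre sizes mean equal multisets of values, hence lists that differ by a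
  permutation.\<close>

lemma permutation_of_counts:
  fixes \<tau> \<tau>' :: "nat \<Rightarrow> nat"
  assumes "\<And>t. card {s. s < m \<and> \<tau> s = t} = card {s. s < m \<and> \<tau>' s = t}"
  obtains \<rho> where "\<rho> permutes {..<m}" "\<And>s. s < m \<Longrightarrow> \<tau> s = \<tau>' (\<rho> s)"
proof -
  have count: "count (mset (map f [0..<m])) t = card {s. s < m \<and> f s = t}" for f :: "nat \<Rightarrow> nat" and t
  proof -
    have "count (mset (map f [0..<m])) t = length (filter (\<lambda>s. f s = t) [0..<m])"
      by (induction m) auto
    also have "\<dots> = card (set (filter (\<lambda>s. f s = t) [0..<m]))"
      by (rule distinct_card[symmetric]) simp
    also have "set (filter (\<lambda>s. f s = t) [0..<m]) = {s. s < m \<and> f s = t}" by auto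
    finally show ?thesis .
  qed
  have "mset (map \<tau> [0..<m]) = mset (map \<tau>' [0..<m])"
    by (rule multiset_eqI) (simp only: count assms)
  then obtain \<rho> where \<rho>: "\<rho> permutes {..<length (map \<tau>' [0..<m])}"
    "permute_list \<rho> (map \<tau>' [0..<m]) = map \<tau> [0..<m]"
    by (rule mset_eq_permutation)
  have \<rho>m: "\<rho> permutes {..<m}" using \<rho>(1) by simp
  have "\<tau> s = \<tau>' (\<rho> s)" if s: "s < m" for s
  proof -
    have "\<rho> s < m" using permutes_in_image[OF \<rho>m, of s] s by simp
    have "map \<tau> [0..<m] ! s = map \<tau>' [0..<m] ! \<rho> s"
      unfolding \<rho>(2)[symmetric] using s by (intro permute_list_nth[OF \<rho>(1)]) simp
    then show ?thesis using s \<open>\<rho> s < m\<close> by simp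
  qed
  with \<rho>m show ?thesis by (rule that)
qed

text \<open>For the hard inclusion, each coefficient of p is spread evenly over the row orders of
  its monomial, which gives symmetric tensors. Evaluating p at sums with varying coefficients c
  separates their values by the number of times each point is used.\<close>

theorem generated_in_degree_le_secants:
  fixes Z :: "('v \<Rightarrow> 'k::field_char_0) set"
  assumes X: "finite X" and r: "0 < r" and bounded: "bounded_gen X Z r C"
  shows "generated_in_degree_le X (vanishing_ideal X (secants Z r)) C"
proof -
  let ?I = "vanishing_ideal X (secants Z r)"
  let ?G = "{g \<in> ?I. mpoly_total_degree g \<le> C}"
  have "ideal_gen_in X ?G \<subseteq> ?I"
  proof
    fix p assume "p \<in> ideal_gen_in X ?G"
    then obtain A q where A: "p = (\<Sum>g\<in>A. q g * g)" "A \<subseteq> ?G" "\<forall>g\<in>A. q g \<in> poly_ring X"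
      unfolding ideal_gen_in_def by blast
    have "p \<in> poly_ring X"
      unfolding A(1) using A(2,3) by (intro poly_ring_sum poly_ring_mult) (auto simp: vanishing_ideal_def)
    moreover have "mpoly_eval p v = 0" if "v \<in> secants Z r" for v
      unfolding A(1) mpoly_eval_sum mpoly_eval_mult
      using A(2) that by (intro sum.neutral) (auto simp: vanishing_ideal_def)
    ultimately show "p \<in> ?I" by (simp add: vanishing_ideal_def)
  qed
  moreover have "?I \<subseteq> ideal_gen_in X ?G"
  proof
    fix p assume p: "p \<in> ?I"
    define M where "M = Max (insert 0 (monom_degree ` Poly_Mapping.keys p))"
    have degM: "monom_degree \<mu> \<le> M" if "\<mu> \<in> Poly_Mapping.keys p" for \<mu>
      unfolding M_def using that by (intro Max_ge) auto
    have keysX: "Poly_Mapping.keys \<mu> \<subseteq> X" if "\<mu> \<in> Poly_Mapping.keys p" for \<mu>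
      using p that by (auto simp: vanishing_ideal_def poly_ring_def mpoly_vars_def)
    let ?\<Omega> = "\<lambda>m :: nat. PiE {..<m} (\<lambda>_. X)"
    have fin: "finite (?\<Omega> m)" for m by (rule finite_PiE) (simp_all add: X)
    define fib where "fib m \<mu> = {x \<in> ?\<Omega> m. row_monom {..<m} x = \<mu>}" for m \<mu>
    \<comment> \<open>Division by the number of row orders of the monomial, which characteristic 0
      permits.\<close>
    define F where "F m x = Poly_Mapping.lookup p (row_monom {..<m} x) /
      of_nat (card (fib m (row_monom {..<m} x)))" for m x
    have p_eq: "p = (\<Sum>m\<le>M. tensor_poly X {..<m} {..<m} (F m))"
    proof (rule poly_mapping_eqI)
      fix \<mu>
      have lk: "Poly_Mapping.lookup (tensor_poly X {..<m} {..<m} (F m)) \<mu> =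
          (if m = monom_degree \<mu> then Poly_Mapping.lookup p \<mu> else 0)" for m
      proof -
        have "Poly_Mapping.lookup (tensor_poly X {..<m} {..<m} (F m)) \<mu> = (\<Sum>x\<in>fib m \<mu>. F m x)"
          unfolding tensor_poly_def lookup_sum fib_def
          using fin by (simp add: lookup_single when_def sum.If_cases Int_def)
        also have "\<dots> = (\<Sum>x\<in>fib m \<mu>. Poly_Mapping.lookup p \<mu> / of_nat (card (fib m \<mu>)))"
          by (rule sum.cong) (auto simp: F_def fib_def)
        also have "\<dots> = (if fib m \<mu> = {} then 0 else Poly_Mapping.lookup p \<mu>)"
          using fin by (simp add: fib_def)
        also have "\<dots> = (if m = monom_degree \<mu> then Poly_Mapping.lookup p \<mu> else 0)"
        proof (cases "m = monom_degree \<mu>")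
          case True
          then show ?thesis
            using row_monom_surj[of \<mu> X m] keysX[of \<mu>] by (auto simp: fib_def in_keys_iff)
        next
          case False
          have "row_monom {..<m} x \<noteq> \<mu>" for x
            using False monom_degree_row_monom[of "{..<m}" x] by auto
          then have "fib m \<mu> = {}" by (simp add: fib_def)
          with False show ?thesis by simp
        qed
        finally show ?thesis .
      qed
      have "\<not> monom_degree \<mu> \<le> M \<Longrightarrow> Poly_Mapping.lookup p \<mu> = 0"
        using degM[of \<mu>] by (auto simp: in_keys_iff)
      then show "Poly_Mapping.lookup p \<mu> =
          Poly_Mapping.lookup (\<Sum>m\<le>M. tensor_poly X {..<m} {..<m} (F m)) \<mu>"
        by (auto simp: lookup_sum lk)
    qed
    have "vanishes X Z r {..<m} {..<m} (F m)" if m: "m \<le> M" for m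
    proof (rule vanishesI)
      fix z and \<tau>0 :: "nat \<Rightarrow> nat" assume z: "\<And>t. t < r \<Longrightarrow> z t \<in> Z" and \<tau>0: "\<And>s. \<tau>0 s < r"
      define \<Phi> where "\<Phi> k \<tau> = (\<Sum>x\<in>?\<Omega> k. F k x * (\<Prod>s<k. z (\<tau> s) (x s)))" for k and \<tau> :: "nat \<Rightarrow> nat"
      let ?T = "\<lambda>k :: nat. PiE {..<k} (\<lambda>_. {..<r})"
      \<comment> \<open>The exponent of \<open>c t\<close> in the term of i, that is, how many rows
        use the point t.\<close>
      define \<nu> where "\<nu> i t = card {s. s < fst i \<and> snd i s = t}" for i :: "nat \<times> (nat \<Rightarrow> nat)" and t
      define \<tau> where "\<tau> = restrict \<tau>0 {..<m}"
      have \<tau>T: "\<tau> \<in> ?T m" using \<tau>0 by (simp add: \<tau>_def)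
      let ?II = "Sigma {..M} ?T"
      have finT: "finite (?T k)" for k by (auto intro: finite_PiE)
      have "(\<Sum>i\<in>?II. \<Phi> (fst i) (snd i) * (\<Prod>t\<in>{..<r}. c t ^ \<nu> i t)) = 0" for c
      proof -
        have "(\<lambda>J. \<Sum>t<r. c t * z t J) \<in> secants Z r" using z unfolding secants_def by blast
        then have "0 = mpoly_eval p (\<lambda>J. \<Sum>t<r. c t * z t J)"
          using p by (simp add: vanishing_ideal_def)
        also have "\<dots> = (\<Sum>k\<le>M. \<Sum>\<tau>\<in>?T k. (\<Prod>s<k. c (\<tau> s)) * \<Phi> k \<tau>)"
          unfolding p_eq mpoly_eval_sum mpoly_eval_tensor_poly prod_linear_combination[OF finite_lessThan] \<Phi>_def ..
        also have "\<dots> = (\<Sum>k\<le>M. \<Sum>\<tau>\<in>?T k. \<Phi> k \<tau> * (\<Prod>t\<in>{..<r}. c t ^ \<nu> (k, \<tau>) t))"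
        proof (intro sum.cong refl)
          fix k \<tau> assume \<tau>: "\<tau> \<in> ?T k"
          have "(\<Prod>s<k. c (\<tau> s)) = (\<Prod>t\<in>{..<r}. \<Prod>s | s \<in> {..<k} \<and> \<tau> s = t. c (\<tau> s))"
            by (rule prod.group[symmetric]) (use \<tau> in auto)
          also have "\<dots> = (\<Prod>t\<in>{..<r}. c t ^ \<nu> (k, \<tau>) t)" by (simp add: \<nu>_def)
          finally show "(\<Prod>s<k. c (\<tau> s)) * \<Phi> k \<tau> = \<Phi> k \<tau> * (\<Prod>t\<in>{..<r}. c t ^ \<nu> (k, \<tau>) t)"
            by simp
        qed
        also have "\<dots> = (\<Sum>i\<in>?II. \<Phi> (fst i) (snd i) * (\<Prod>t\<in>{..<r}. c t ^ \<nu> i t))"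
          using finT by (simp add: sum.Sigma split_def)
        finally show ?thesis by simp
      qed
      from multi_power_sum_vanish[OF _ _ this, of "\<nu> (m, \<tau>)"]
      have 0: "(\<Sum>i | i \<in> ?II \<and> (\<forall>t\<in>{..<r}. \<nu> i t = \<nu> (m, \<tau>) t). \<Phi> (fst i) (snd i)) = 0"
        using finT by simp
      \<comment> \<open>The terms with the same monomial in c as the one for
        \<open>(m, \<tau>)\<close>. They differ from it only by a permutation of the rows, so by the
        symmetry of \<open>F m\<close> all have the same value, and a positive multiple of that
        value is 0.\<close>
      let ?E = "{i. i \<in> ?II \<and> (\<forall>t\<in>{..<r}. \<nu> i t = \<nu> (m, \<tau>) t)}"
      have "\<Phi> (fst i) (snd i) = \<Phi> m \<tau>" if i: "i \<in> ?E" for i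
      proof -
        obtain k \<sigma> where k: "i = (k, \<sigma>)" "\<sigma> \<in> ?T k" using i by auto
        have \<nu>_ge: "\<nu> (k, \<sigma>) t = 0" if "\<sigma> \<in> ?T k" "t \<notin> {..<r}" for k \<sigma> t
          using that by (auto simp: \<nu>_def)
        have \<nu>_sum: "(\<Sum>t<r. \<nu> (k, \<sigma>) t) = k" if "\<sigma> \<in> ?T k" for k \<sigma>
        proof -
          have "(\<Sum>t<r. \<nu> (k, \<sigma>) t) = (\<Sum>t<r. \<Sum>s | s \<in> {..<k} \<and> \<sigma> s = t. 1)"
            by (simp add: \<nu>_def)
          also have "\<dots> = (\<Sum>s\<in>{..<k}. 1)" by (rule sum.group) (use that in auto)
          finally show ?thesis by simp
        qed
        have eq: "\<nu> (k, \<sigma>) t = \<nu> (m, \<tau>) t" for t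
          using i \<nu>_ge[OF k(2)] \<nu>_ge[OF \<tau>T] k(1) by (cases "t \<in> {..<r}") auto
        \<comment> \<open>The exponents add up to the number of rows, which separates the
          homogeneous components of p.\<close>
        have km: "k = m" using \<nu>_sum[OF k(2)] \<nu>_sum[OF \<tau>T] by (simp add: eq)
        obtain \<rho> where \<rho>: "\<rho> permutes {..<m}" "\<And>s. s < m \<Longrightarrow> \<sigma> s = \<tau> (\<rho> s)"
          using permutation_of_counts[of m \<sigma> \<tau>] eq unfolding \<nu>_def km by auto
        have "\<Phi> m \<sigma> = (\<Sum>x\<in>?\<Omega> m. F m x * (\<Prod>s<m. z (\<tau> (\<rho> s)) (x s)))"
          unfolding \<Phi>_def using \<rho>(2) by simp
        also have "\<dots> = (\<Sum>x\<in>?\<Omega> m. F m (x \<circ> \<rho>) * (\<Prod>s<m. z (\<tau> (\<rho> s)) ((x \<circ> \<rho>) s)))"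
        proof (rule sum.reindex_bij_witness[of _ "\<lambda>x. x \<circ> \<rho>" "\<lambda>x. x \<circ> inv \<rho>"])
          fix x :: "nat \<Rightarrow> 'v"
          show inv1: "(x \<circ> inv \<rho>) \<circ> \<rho> = x" and "(x \<circ> \<rho>) \<circ> inv \<rho> = x"
            using permutes_inv_o[OF \<rho>(1)] by (simp_all add: comp_assoc)
          show "F m ((x \<circ> inv \<rho>) \<circ> \<rho>) * (\<Prod>s<m. z (\<tau> (\<rho> s)) (((x \<circ> inv \<rho>) \<circ> \<rho>) s)) =
            F m x * (\<Prod>s<m. z (\<tau> (\<rho> s)) (x s))" unfolding inv1 ..
        next
          fix x assume "x \<in> ?\<Omega> m"
          then show "x \<circ> inv \<rho> \<in> ?\<Omega> m" "x \<circ> \<rho> \<in> ?\<Omega> m"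
            by (rule permutes_tensor[OF permutes_inv[OF \<rho>(1)]], rule permutes_tensor[OF \<rho>(1)])
        qed
        also have "\<dots> = \<Phi> m \<tau>"
          unfolding \<Phi>_def
        proof (rule sum.cong[OF refl])
          fix x
          have "(\<Prod>s<m. z (\<tau> (\<rho> s)) ((x \<circ> \<rho>) s)) = (\<Prod>s<m. z (\<tau> s) (x s))"
            unfolding o_def by (rule prod.reindex_bij_betw[OF permutes_imp_bij[OF \<rho>(1)]])
          then show "F m (x \<circ> \<rho>) * (\<Prod>s<m. z (\<tau> (\<rho> s)) ((x \<circ> \<rho>) s)) = F m x * (\<Prod>s<m. z (\<tau> s) (x s))"
            by (simp only: F_def permutes_row_monom[OF \<rho>(1)])
        qed
        finally show ?thesis by (simp add: k(1) km)
      qed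
      then have "of_nat (card ?E) * \<Phi> m \<tau> = 0" using 0 by simp
      moreover have "(m, \<tau>) \<in> ?E" using m \<tau>T by simp
      moreover have "finite ?E" using finT by simp
      ultimately have "\<Phi> m \<tau> = 0" by (auto simp: card_eq_0_iff)
      then show "(\<Sum>x\<in>?\<Omega> m. F m x * (\<Prod>s<m. z (\<tau>0 s) (x s))) = 0"
        by (simp add: \<Phi>_def \<tau>_def)
    qed
    then show "p \<in> ideal_gen_in X ?G"
      using bounded unfolding p_eq bounded_gen_def
      by (intro ideal_gen_in_sum generated_tensor_poly r) auto
  qed
  ultimately have "ideal_gen_in X ?G = ?I" by (rule subset_antisym)
  then show ?thesis unfolding generated_in_degree_le_def by (intro exI[of _ ?G]) simp
qed

section \<open>Flag varieties\<close>

text \<open>A minor whose row indices are listed in any order and may repeat, as the letters of a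
  word do.\<close>

definition alternant :: "(nat \<Rightarrow> nat \<Rightarrow> 'k::field_char_0) \<Rightarrow> (nat \<Rightarrow> nat) \<Rightarrow> nat \<Rightarrow> 'k" where
  "alternant M u m = (\<Sum>\<pi> | \<pi> permutes {..<m}. of_int (sign \<pi>) * (\<Prod>k<m. M (u k) (\<pi> k)))"

lemma minor_eq_alternant: "minor M I m = alternant M (\<lambda>k. sorted_list_of_set I ! k) m"
  by (simp add: minor_def alternant_def)

lemma alternant_cong: "(\<And>k. k < m \<Longrightarrow> u k = v k) \<Longrightarrow> alternant M u m = alternant M v m"
  unfolding alternant_def by (intro sum.cong arg_cong2[of _ _ _ _ "(*)"] prod.cong) auto

lemma alternant_permute:
  assumes \<rho>: "\<rho> permutes {..<m}"
  shows "alternant M (\<lambda>k. u (\<rho> k)) m = of_int (sign \<rho>) * alternant M u m"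
proof -
  have "alternant M (\<lambda>k. u (\<rho> k)) m = (\<Sum>\<pi> | \<pi> permutes {..<m}.
      of_int (sign (\<pi> \<circ> \<rho>)) * (\<Prod>k<m. M (u (\<rho> k)) ((\<pi> \<circ> \<rho>) k)))"
    unfolding alternant_def by (rule sum_permutations_compose_right[OF \<rho>])
  also have "\<dots> = (\<Sum>\<pi> | \<pi> permutes {..<m}.
      of_int (sign \<rho>) * (of_int (sign \<pi>) * (\<Prod>k<m. M (u k) (\<pi> k))))"
  proof (rule sum.cong[OF refl])
    fix \<pi> assume "\<pi> \<in> {\<pi>. \<pi> permutes {..<m}}"
    then have "permutation \<pi>" "permutation \<rho>"
      using \<rho> permutation_permutes finite_lessThan by blast+
    then have "sign (\<pi> \<circ> \<rho>) = sign \<pi> * sign \<rho>" by (rule sign_compose)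
    moreover have "(\<Prod>k<m. M (u (\<rho> k)) ((\<pi> \<circ> \<rho>) k)) = (\<Prod>k<m. M (u k) (\<pi> k))"
      unfolding o_def by (rule prod.reindex_bij_betw[OF permutes_imp_bij[OF \<rho>]])
    ultimately show "of_int (sign (\<pi> \<circ> \<rho>)) * (\<Prod>k<m. M (u (\<rho> k)) ((\<pi> \<circ> \<rho>) k)) =
      of_int (sign \<rho>) * (of_int (sign \<pi>) * (\<Prod>k<m. M (u k) (\<pi> k)))" by simp
  qed
  finally show ?thesis by (simp add: alternant_def sum_distrib_left)
qed

text \<open>Exchanging two equal rows changes the sign but not the value.\<close>

lemma alternant_not_inj:
  assumes "\<not> inj_on u {..<m}"
  shows "alternant M u m = 0"
proof -
  obtain a b where ab: "a < m" "b < m" "a \<noteq> b" "u a = u b"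
    using assms by (auto simp: inj_on_def)
  let ?t = "transpose a b"
  have "?t permutes {..<m}" using ab by (intro permutes_swap_id) auto
  from alternant_permute[OF this, of M u]
  have "alternant M (\<lambda>k. u (?t k)) m = - alternant M u m" using ab(3) by (simp add: sign_swap_id)
  moreover have "(\<lambda>k. u (?t k)) = u" using ab(4) by (auto simp: fun_eq_iff transpose_def)
  ultimately show ?thesis by (simp add: equal_neg_zero)
qed

text \<open>The sign relating a list of row indices to its sorted version. For distinct indices the
  sorting permutation is unique, so the choice is harmless; a repetition gives 0, matching the
  vanishing minor.\<close>

definition sorting_sign :: "(nat \<Rightarrow> nat) \<Rightarrow> nat \<Rightarrow> 'k::field_char_0" where
  "sorting_sign u m = (if inj_on u {..<m} then of_int (sign (SOME \<rho>. \<rho> permutes {..<m} \<and>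
     (\<forall>k<m. u k = sorted_list_of_set (u ` {..<m}) ! \<rho> k))) else 0)"

lemma sorting_sign_nonzero: "sorting_sign u m \<noteq> (0 :: 'k::field_char_0) \<longleftrightarrow> inj_on u {..<m}"
  by (simp add: sorting_sign_def sign_def)

lemma alternant_eq_minor: "alternant M u m = sorting_sign u m * minor M (u ` {..<m}) m"
proof (cases "inj_on u {..<m}")
  case True
  let ?s = "sorted_list_of_set (u ` {..<m})"
  let ?P = "\<lambda>\<rho>. \<rho> permutes {..<m} \<and> (\<forall>k<m. u k = ?s ! \<rho> k)"
  have len: "length ?s = m" using True by (simp add: card_image)
  have "distinct (map u [0..<m])" using True by (simp add: distinct_map lessThan_atLeast0)
  moreover have "set (map u [0..<m]) = set ?s" by (simp add: lessThan_atLeast0)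
  ultimately have "mset (map u [0..<m]) = mset ?s"
    by (subst set_eq_iff_mset_eq_distinct[symmetric]) auto
  then obtain \<rho> where \<rho>: "\<rho> permutes {..<length ?s}" "permute_list \<rho> ?s = map u [0..<m]"
    by (rule mset_eq_permutation)
  have uk: "u k = ?s ! \<rho> k" if k: "k < m" for k
  proof -
    have "map u [0..<m] ! k = ?s ! \<rho> k"
      unfolding \<rho>(2)[symmetric] using k len by (intro permute_list_nth[OF \<rho>(1)]) simp
    then show ?thesis using k by simp
  qed
  have "?P \<rho>" using \<rho>(1) uk unfolding len by blast
  then have "\<exists>\<rho>. ?P \<rho>" by blast
  define \<rho>' where "\<rho>' = (SOME \<rho>. ?P \<rho>)"
  have P: "?P \<rho>'" unfolding \<rho>'_def by (rule someI_ex[of ?P]) fact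
  have \<rho>': "\<rho>' permutes {..<m}" "\<And>k. k < m \<Longrightarrow> u k = ?s ! \<rho>' k" using P by blast+
  have "alternant M u m = alternant M (\<lambda>k. ?s ! \<rho>' k) m" using \<rho>'(2) by (rule alternant_cong)
  also have "\<dots> = of_int (sign \<rho>') * minor M (u ` {..<m}) m"
    unfolding minor_eq_alternant by (rule alternant_permute[OF \<rho>'(1)])
  finally show ?thesis using True by (simp add: sorting_sign_def \<rho>'_def)
next
  case False
  then show ?thesis by (simp add: alternant_not_inj sorting_sign_def)
qed

section \<open>Flag coordinates indexed by words\<close>

text \<open>A triple (i, j, k) is the k-th index in the j-th factor of block i.\<close>

definition positions :: "nat list \<Rightarrow> nat list \<Rightarrow> (nat \<times> nat \<times> nat) set" where
  "positions e d = (SIGMA i:{..<length e}. {..<d ! i} \<times> {..<e ! i})"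

text \<open>The point expanded in a full tensor power of V instead of exterior powers. This
  redundant system has one letter per position, the form on which polarization acts.\<close>

definition flag_coord :: "nat list \<Rightarrow> nat list \<Rightarrow> (nat \<Rightarrow> nat \<Rightarrow> 'k::field_char_0) \<Rightarrow>
    (nat \<times> nat \<times> nat \<Rightarrow> nat) \<Rightarrow> 'k" where
  "flag_coord e d M w = (\<Prod>i<length e. \<Prod>j<d ! i. alternant M (\<lambda>k. w (i, j, k)) (e ! i))"

abbreviation flag_words :: "nat list \<Rightarrow> nat list \<Rightarrow> nat set \<Rightarrow> (nat \<times> nat \<times> nat \<Rightarrow> nat) set" where
  "flag_words e d L \<equiv> PiE (positions e d) (\<lambda>_. L)"

lemma finite_positions: "finite (positions e d)"
  by (simp add: positions_def)

lemma prod_positions: "(\<Prod>q\<in>positions e d. f q) = (\<Prod>i<length e. \<Prod>j<d ! i. \<Prod>k<e ! i. f (i, j, k))"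
proof -
  have "(\<Prod>i<length e. \<Prod>j<d ! i. \<Prod>k<e ! i. f (i, j, k)) =
      (\<Prod>i<length e. \<Prod>p\<in>{..<d ! i} \<times> {..<e ! i}. f (i, p))"
    by (simp add: prod.cartesian_product')
  also have "\<dots> = (\<Prod>q\<in>positions e d. f q)"
    unfolding positions_def by (subst prod.Sigma) (auto simp: split_def)
  finally show ?thesis by simp
qed

text \<open>When all determinants are expanded, a term chooses one permutation per factor, and the
  column at a position is a value of that permutation. It stays below the largest flag dimension
  whatever \<open>d\<close> is.\<close>

lemma bounded_gen_flag_words:
  assumes E: "\<And>i. i < length e \<Longrightarrow> e ! i \<le> E"
    and base: "\<And>L. L \<subseteq> {..<n} \<Longrightarrow> card L \<le> r * E \<Longrightarrow>
      bounded_gen (flag_words e d L) (range (flag_coord e d :: (nat \<Rightarrow> nat \<Rightarrow> 'k::field_char_0) \<Rightarrow> _)) r C"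
    and C: "r * E + 1 \<le> C"
  shows "bounded_gen (flag_words e d {..<n}) (range (flag_coord e d :: (nat \<Rightarrow> nat \<Rightarrow> 'k) \<Rightarrow> _)) r C"
proof -
  define IJ where "IJ = (SIGMA i:{..<length e}. {..<d ! i})"
  define K where "K = PiE IJ (\<lambda>p. {\<pi>. \<pi> permutes {..<e ! fst p}})"
  define g :: "(nat \<times> nat \<Rightarrow> nat \<Rightarrow> nat) \<Rightarrow> 'k" where "g \<kappa> = (\<Prod>p\<in>IJ. of_int (sign (\<kappa> p)))" for \<kappa>
  define h :: "(nat \<times> nat \<Rightarrow> nat \<Rightarrow> nat) \<Rightarrow> nat \<times> nat \<times> nat \<Rightarrow> nat"
    where "h = (\<lambda>\<kappa> (i, j, k). \<kappa> (i, j) k)"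
  have fIJ: "finite IJ" by (simp add: IJ_def)
  have prod_IJ: "(\<Prod>p\<in>IJ. f p) = (\<Prod>i<length e. \<Prod>j<d ! i. f (i, j))" for f :: "nat \<times> nat \<Rightarrow> 'k"
    unfolding IJ_def by (subst prod.Sigma) (auto simp: split_def)
  interpret word_points "positions e d" K g h E
  proof
    show "finite K" unfolding K_def using fIJ by (auto intro!: finite_PiE finite_permutations)
    fix \<kappa> q assume \<kappa>: "\<kappa> \<in> K" and q: "q \<in> positions e d"
    obtain i j k where q': "q = (i, j, k)" "i < length e" "j < d ! i" "k < e ! i"
      using q by (auto simp: positions_def)
    have "(i, j) \<in> IJ" using q' by (simp add: IJ_def)
    then have "\<kappa> (i, j) permutes {..<e ! i}" 
      using PiE_mem[OF \<kappa>[unfolded K_def], of "(i, j)"] by simp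
    then have "\<kappa> (i, j) k < e ! i" using permutes_in_image[of "\<kappa> (i, j)" "{..<e ! i}" k] q' by simp
    then show "h \<kappa> q < E" using E[OF q'(2)] by (simp add: h_def q')
  qed (rule finite_positions)
  have word_coord: "word_coord = flag_coord e d"
  proof (intro ext)
    fix M :: "nat \<Rightarrow> nat \<Rightarrow> 'k" and w
    have "flag_coord e d M w = (\<Prod>p\<in>IJ. \<Sum>\<pi> | \<pi> permutes {..<e ! fst p}.
        of_int (sign \<pi>) * (\<Prod>k<e ! fst p. M (w (fst p, snd p, k)) (\<pi> k)))"
      unfolding prod_IJ by (simp add: flag_coord_def alternant_def)
    also have "\<dots> = (\<Sum>\<kappa>\<in>K. \<Prod>p\<in>IJ. of_int (sign (\<kappa> p)) *
        (\<Prod>k<e ! fst p. M (w (fst p, snd p, k)) (\<kappa> p k)))"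
      unfolding K_def by (rule prod_sum_PiE) (use fIJ in \<open>auto intro: finite_permutations\<close>)
    also have "\<dots> = word_coord M w"
      unfolding word_coord_def g_def by (simp add: prod.distrib prod_IJ prod_positions h_def)
    finally show "word_coord M w = flag_coord e d M w" by simp
  qed
  show ?thesis
    using bounded_gen_words[of n r C] base C by (simp add: word_coord words_def)
qed

lemma flag_coord_relabel:
  assumes "\<And>q. q \<in> positions e d \<Longrightarrow> v q = f (w q)"
  shows "flag_coord e d M v = flag_coord e d (\<lambda>c. M (f c)) w"
proof -
  have "alternant M (\<lambda>k. v (i, j, k)) (e ! i) = alternant (\<lambda>c. M (f c)) (\<lambda>k. w (i, j, k)) (e ! i)"
    if "i < length e" "j < d ! i" for i j
  proof -
    have "alternant M (\<lambda>k. v (i, j, k)) (e ! i) = alternant M (\<lambda>k. f (w (i, j, k))) (e ! i)"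
      by (rule alternant_cong) (use assms that in \<open>simp add: positions_def\<close>)
    then show ?thesis by (simp add: alternant_def)
  qed
  then show ?thesis unfolding flag_coord_def by (intro prod.cong refl) simp
qed

text \<open>Using only the letters of \<open>L\<close> is the same as working in a space of
  dimension \<open>card L\<close>: a renaming of letters is absorbed by renaming the rows of the
  matrices.\<close>

lemma bounded_gen_relabel:
  assumes L: "finite L" and "1 \<le> C"
    and bounded: "bounded_gen (flag_words e d {..<card L})
      (range (flag_coord e d :: (nat \<Rightarrow> nat \<Rightarrow> 'k::field_char_0) \<Rightarrow> _)) r C"
  shows "bounded_gen (flag_words e d L) (range (flag_coord e d :: (nat \<Rightarrow> nat \<Rightarrow> 'k) \<Rightarrow> _)) r C"
proof -
  let ?Q = "positions e d"
  obtain g where g: "bij_betw g L {..<card L}"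
    using ex_bij_betw_finite_nat[OF L] by (auto simp: lessThan_atLeast0)
  define g' where "g' = inv_into L g"
  have gL: "g a < card L" if "a \<in> L" for a using bij_betw_apply[OF g that] by simp
  have g'L: "g' a \<in> L" if "a < card L" for a
    using bij_betw_apply[OF bij_betw_inv_into[OF g], of a] that by (simp add: g'_def)
  have g'g: "g' (g a) = a" if "a \<in> L" for a
    unfolding g'_def by (rule bij_betw_inv_into_left[OF g that])
  have gg': "g (g' a) = a" if "a < card L" for a
    unfolding g'_def using that by (intro bij_betw_inv_into_right[OF g]) simp
  interpret index_transfer "flag_words e d L" "flag_words e d {..<card L}"
    "range (flag_coord e d :: (nat \<Rightarrow> nat \<Rightarrow> 'k) \<Rightarrow> _)" "range (flag_coord e d)" "\<lambda>w. \<lambda>q\<in>?Q. g (w q)" "\<lambda>_. 1" "\<lambda>w. \<lambda>q\<in>?Q. g' (w q)"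
  proof
    show "finite (flag_words e d L)" "finite (flag_words e d {..<card L})"
      using L finite_positions by (auto intro!: finite_PiE)
    fix w assume "w \<in> flag_words e d L"
    then show "(\<lambda>q\<in>?Q. g (w q)) \<in> flag_words e d {..<card L}" using gL by (auto simp: PiE_iff)
  next
    fix w assume w: "w \<in> flag_words e d {..<card L}"
    then show "(\<lambda>q\<in>?Q. g' (w q)) \<in> flag_words e d L" using g'L by (auto simp: PiE_iff)
    show "(\<lambda>q\<in>?Q. g ((\<lambda>q\<in>?Q. g' (w q)) q)) = w"
    proof
      fix q
      show "(\<lambda>q\<in>?Q. g ((\<lambda>q\<in>?Q. g' (w q)) q)) q = w q"
        using PiE_mem[OF w, of q] PiE_arb[OF w, of q] gg'[of "w q"] by auto
    qed
  next
    fix z' :: "_ \<Rightarrow> 'k" assume "z' \<in> range (flag_coord e d)"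
    then obtain M where M: "z' = flag_coord e d M" by blast
    show "\<exists>z\<in>range (flag_coord e d). \<forall>w\<in>flag_words e d L. z w = 1 * z' (\<lambda>q\<in>?Q. g (w q))"
      unfolding M by (intro bexI[of _ "flag_coord e d (\<lambda>c. M (g c))"] ballI)
        (simp_all add: flag_coord_relabel[of e d _ g])
  next
    fix z :: "_ \<Rightarrow> 'k" assume "z \<in> range (flag_coord e d)"
    then obtain M where M: "z = flag_coord e d M" by blast
    have "flag_coord e d M w = flag_coord e d (\<lambda>c. M (g' c)) (\<lambda>q\<in>?Q. g (w q))"
      if w: "w \<in> flag_words e d L" for w
      by (rule flag_coord_relabel) (use PiE_mem[OF w] g'g in simp)
    then show "\<exists>z'\<in>range (flag_coord e d). \<forall>w\<in>flag_words e d L. z w = 1 * z' (\<lambda>q\<in>?Q. g (w q))"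
      unfolding M by (intro bexI[of _ "flag_coord e d (\<lambda>c. M (g' c))"] ballI) simp_all
  qed simp
  show ?thesis using bounded_gen_preimage[OF bounded \<open>1 \<le> C\<close>] .
qed

definition flag_sign :: "nat list \<Rightarrow> nat list \<Rightarrow> (nat \<times> nat \<times> nat \<Rightarrow> nat) \<Rightarrow> 'k::field_char_0" where
  "flag_sign e d w = (\<Prod>i<length e. \<Prod>j<d ! i. sorting_sign (\<lambda>k. w (i, j, k)) (e ! i))"

definition factor_set :: "nat list \<Rightarrow> (nat \<times> nat \<times> nat \<Rightarrow> nat) \<Rightarrow> nat \<Rightarrow> nat \<Rightarrow> nat set" where
  "factor_set e w i j = (\<lambda>k. w (i, j, k)) ` {..<e ! i}"

lemma flag_coord_eq_minors:
  "flag_coord e d M w = flag_sign e d w * (\<Prod>i<length e. \<Prod>j<d ! i. minor M (factor_set e w i j) (e ! i))"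
  by (simp add: flag_coord_def flag_sign_def factor_set_def alternant_eq_minor prod.distrib)

lemma flag_sign_nonzero:
  "flag_sign e d w \<noteq> (0 :: 'k::field_char_0) \<longleftrightarrow>
   (\<forall>i<length e. \<forall>j<d ! i. inj_on (\<lambda>k. w (i, j, k)) {..<e ! i})"
  by (simp add: flag_sign_def sorting_sign_nonzero[where ?'k = 'k, symmetric] Ball_def)

definition sorted_word :: "nat list \<Rightarrow> nat list \<Rightarrow> (nat \<Rightarrow> nat \<Rightarrow> nat set) \<Rightarrow> nat \<times> nat \<times> nat \<Rightarrow> nat" where
  "sorted_word e d J = (\<lambda>(i, j, k)\<in>positions e d. sorted_list_of_set (J i j) ! k)"

lemma sorted_word:
  assumes J: "\<And>i j. i < length e \<Longrightarrow> j < d ! i \<Longrightarrow> finite (J i j) \<and> card (J i j) = e ! i"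
  shows "i < length e \<Longrightarrow> j < d ! i \<Longrightarrow> factor_set e (sorted_word e d J) i j = J i j"
    and "flag_sign e d (sorted_word e d J) \<noteq> (0 :: 'k::field_char_0)"
    and "(\<And>i j. i < length e \<Longrightarrow> j < d ! i \<Longrightarrow> J i j \<subseteq> L) \<Longrightarrow> sorted_word e d J \<in> flag_words e d L"
proof -
  have w: "sorted_word e d J (i, j, k) = sorted_list_of_set (J i j) ! k"
    if "i < length e" "j < d ! i" "k < e ! i" for i j k
    using that by (simp add: sorted_word_def positions_def)
  have len: "length (sorted_list_of_set (J i j)) = e ! i" if "i < length e" "j < d ! i" for i j
    using J[OF that] by simp
  have nth: "bij_betw (\<lambda>k. sorted_list_of_set (J i j) ! k) {..<e ! i} (J i j)"
    if "i < length e" "j < d ! i" for i j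
    using J[OF that] len[OF that] by (intro bij_betw_nth) auto
  show fs: "factor_set e (sorted_word e d J) i j = J i j" if "i < length e" "j < d ! i" for i j
  proof -
    have "factor_set e (sorted_word e d J) i j = (\<lambda>k. sorted_list_of_set (J i j) ! k) ` {..<e ! i}"
      unfolding factor_set_def by (intro image_cong) (use w that in auto)
    then show ?thesis using nth[OF that] by (simp add: bij_betw_def)
  qed
  show "flag_sign e d (sorted_word e d J) \<noteq> (0 :: 'k)"
    unfolding flag_sign_nonzero
  proof (intro allI impI)
    fix i j assume ij: "i < length e" "j < d ! i"
    have "inj_on (\<lambda>k. sorted_list_of_set (J i j) ! k) {..<e ! i}"
      using nth[OF ij] by (simp add: bij_betw_def)
    then show "inj_on (\<lambda>k. sorted_word e d J (i, j, k)) {..<e ! i}"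
      by (rule inj_on_cong[THEN iffD1, rotated]) (use w ij in auto)
  qed
  show "sorted_word e d J \<in> flag_words e d L"
    if sub: "\<And>i j. i < length e \<Longrightarrow> j < d ! i \<Longrightarrow> J i j \<subseteq> L"
  proof (rule PiE_I)
    fix q assume "q \<in> positions e d"
    then obtain i j k where q: "q = (i, j, k)" "i < length e" "j < d ! i" "k < e ! i"
      by (auto simp: positions_def)
    have "sorted_word e d J q \<in> factor_set e (sorted_word e d J) i j"
      using q(4) by (auto simp: q(1) factor_set_def)
    then show "sorted_word e d J q \<in> L" using fs[OF q(2,3)] sub[OF q(2,3)] by blast
  qed (simp add: sorted_word_def)
qed

section \<open>From words to Pluecker coordinates\<close>

definition plucker_points :: "nat list \<Rightarrow> nat list \<Rightarrow> ((nat \<Rightarrow> nat \<Rightarrow> nat set) \<Rightarrow> 'k::field_char_0) set" where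
  "plucker_points e d = range (\<lambda>M J. \<Prod>i<length e. \<Prod>j<d ! i. minor M (J i j) (e ! i))"

lemma secant_set_eq:
  "secant_set e d r = (secants (plucker_points e d) r :: (_ \<Rightarrow> 'k::field_char_0) set)"
proof (rule set_eqI)
  fix x :: "(nat \<Rightarrow> nat \<Rightarrow> nat set) \<Rightarrow> 'k"
  let ?z = "\<lambda>M J. \<Prod>i<length e. \<Prod>j<d ! i. minor M (J i j) (e ! i)"
  have "x \<in> secants (plucker_points e d) r \<longleftrightarrow>
      (\<exists>c M. x = (\<lambda>J. \<Sum>t<r. c t * ?z (M t) J))"
  proof
    assume "x \<in> secants (plucker_points e d) r"
    then obtain c z where z: "\<forall>t. \<exists>M. t < r \<longrightarrow> z t = ?z M" and x: "x = (\<lambda>J. \<Sum>t<r. c t * z t J)"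
      unfolding secants_def plucker_points_def by blast
    from choice[OF z] obtain M where "\<forall>t<r. z t = ?z (M t)" by blast
    then have "x = (\<lambda>J. \<Sum>t<r. c t * ?z (M t) J)" unfolding x by (intro ext sum.cong) auto
    then show "\<exists>c M. x = (\<lambda>J. \<Sum>t<r. c t * ?z (M t) J)" by blast
  next
    assume "\<exists>c M. x = (\<lambda>J. \<Sum>t<r. c t * ?z (M t) J)"
    then obtain c M where x: "x = (\<lambda>J. \<Sum>t<r. c t * ?z (M t) J)" by blast
    show "x \<in> secants (plucker_points e d) r"
      unfolding secants_def plucker_points_def
      by (intro CollectI exI[of _ c] exI[of _ "\<lambda>t. ?z (M t)"]) (simp add: x)
  qed
  then show "x \<in> secant_set e d r \<longleftrightarrow> x \<in> secants (plucker_points e d) r"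
    by (simp add: secant_set_def cone_point_def)
qed

text \<open>A word determines its Pluecker index up to the order inside each factor, at the cost of
  a sign. A repeated letter inside a factor makes the coordinate 0, which is the case of vanishing
  \<open>flag_sign\<close>.\<close>

lemma plucker_transfer:
  "index_transfer (flag_words e d {..<n}) (plucker_idx e d n) (range (flag_coord e d))
     (plucker_points e d :: (_ \<Rightarrow> 'k::field_char_0) set)
     (\<lambda>w i j. if i < length e \<and> j < d ! i then factor_set e w i j else {}) (flag_sign e d) (sorted_word e d)"
proof -
  let ?\<phi> = "\<lambda>w i j. if i < length e \<and> j < d ! i then factor_set e w i j else {}"
  have J: "finite (J i j) \<and> card (J i j) = e ! i" "J i j \<subseteq> {..<n}"
    if "J \<in> plucker_idx e d n" "i < length e" "j < d ! i" for J i j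
    using that by (auto simp: plucker_idx_def intro: finite_subset)
  have in_words: "sorted_word e d J \<in> flag_words e d {..<n}" if "J \<in> plucker_idx e d n" for J
    by (rule sorted_word(3)) (use J[OF that] in auto)
  have split: "?\<phi> (sorted_word e d J) = J" if "J \<in> plucker_idx e d n" for J
  proof (intro ext)
    fix i j
    have "J i j = {}" if "\<not> (i < length e \<and> j < d ! i)"
      using \<open>J \<in> plucker_idx e d n\<close> that unfolding plucker_idx_def by blast
    then show "?\<phi> (sorted_word e d J) i j = J i j"
      using sorted_word(1)[of e d J i j] J(1)[OF that] by auto
  qed
  have finW: "finite (flag_words e d {..<n})" using finite_positions by (auto intro!: finite_PiE)
  have compat: "flag_coord e d M w = flag_sign e d w *
      (\<Prod>i<length e. \<Prod>j<d ! i. minor M (?\<phi> w i j) (e ! i))" for M :: "nat \<Rightarrow> nat \<Rightarrow> 'k" and w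
    unfolding flag_coord_eq_minors by simp
  show ?thesis
  proof
    have "plucker_idx e d n \<subseteq> ?\<phi> ` flag_words e d {..<n}"
    proof
      fix J assume "J \<in> plucker_idx e d n"
      from split[OF this, symmetric] in_words[OF this]
      show "J \<in> ?\<phi> ` flag_words e d {..<n}" by (rule image_eqI)
    qed
    then show "finite (plucker_idx e d n)" using finW finite_surj by blast
    fix w assume w: "w \<in> flag_words e d {..<n}" and nz: "flag_sign e d w \<noteq> (0 :: 'k)"
    have "factor_set e w i j \<subseteq> {..<n} \<and> card (factor_set e w i j) = e ! i"
      if ij: "i < length e" "j < d ! i" for i j
    proof
      show "factor_set e w i j \<subseteq> {..<n}"
      proof
        fix y assume "y \<in> factor_set e w i j"
        then obtain k where k: "k < e ! i" "y = w (i, j, k)" by (auto simp: factor_set_def)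
        then have "(i, j, k) \<in> positions e d" using ij by (simp add: positions_def)
        from PiE_mem[OF w this] show "y \<in> {..<n}" by (simp add: k(2))
      qed
      have "inj_on (\<lambda>k. w (i, j, k)) {..<e ! i}" using nz ij unfolding flag_sign_nonzero by blast
      then show "card (factor_set e w i j) = e ! i" unfolding factor_set_def by (simp add: card_image)
    qed
    then show "?\<phi> w \<in> plucker_idx e d n" unfolding plucker_idx_def by simp
  next
    fix J assume J': "J \<in> plucker_idx e d n"
    show "sorted_word e d J \<in> flag_words e d {..<n}" by (rule in_words[OF J'])
    show "?\<phi> (sorted_word e d J) = J" by (rule split[OF J'])
    show "flag_sign e d (sorted_word e d J) \<noteq> (0 :: 'k)" by (rule sorted_word(2)) (use J[OF J'] in auto)
  next
    fix z' :: "_ \<Rightarrow> 'k" assume "z' \<in> plucker_points e d"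
    then obtain M where M: "z' = (\<lambda>J. \<Prod>i<length e. \<Prod>j<d ! i. minor M (J i j) (e ! i))"
      unfolding plucker_points_def by blast
    show "\<exists>z\<in>range (flag_coord e d). \<forall>w\<in>flag_words e d {..<n}. z w = flag_sign e d w * z' (?\<phi> w)"
      unfolding M by (intro bexI[of _ "flag_coord e d M"] ballI compat) simp
  next
    fix z :: "_ \<Rightarrow> 'k" assume "z \<in> range (flag_coord e d)"
    then obtain M where M: "z = flag_coord e d M" by blast
    show "\<exists>z'\<in>plucker_points e d. \<forall>w\<in>flag_words e d {..<n}. z w = flag_sign e d w * z' (?\<phi> w)"
      unfolding M plucker_points_def
      by (intro bexI[of _ "\<lambda>J. \<Prod>i<length e. \<Prod>j<d ! i. minor M (J i j) (e ! i)"] ballI compat) simp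
  qed (rule finW)
qed

text \<open>Exponents of monomials in the Pluecker coordinates are multisets of naturals, each encoding a block i
  and a subset S, because multisets over a linear order are linearly ordered compatibly with addition.\<close>

definition encode_factor :: "nat \<Rightarrow> nat set \<Rightarrow> nat" where
  "encode_factor i S = to_nat (i, sorted_list_of_set S)"

definition factor_block :: "nat \<Rightarrow> nat" where
  "factor_block v = fst (from_nat v :: nat \<times> nat list)"

definition factor_support :: "nat \<Rightarrow> nat set" where
  "factor_support v = set (snd (from_nat v :: nat \<times> nat list))"

lemma factor_block_encode [simp]: "factor_block (encode_factor i S) = i"
  by (simp add: factor_block_def encode_factor_def)

lemma factor_support_encode [simp]: "finite S \<Longrightarrow> factor_support (encode_factor i S) = S"
  by (simp add: factor_support_def encode_factor_def)

text \<open>Monomials over l letters of multidegree \<open>d\<close>: \<open>d ! i\<close> Pluecker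
  coordinates from block i.\<close>

definition exponents :: "nat list \<Rightarrow> nat \<Rightarrow> nat list \<Rightarrow> nat multiset set" where
  "exponents e l d = {a. set_mset a \<subseteq> {encode_factor i S | i S. i < length e \<and> S \<subseteq> {..<l} \<and> card S = e ! i} \<and>
     (\<forall>i<length e. size (filter_mset (\<lambda>v. factor_block v = i) a) = d ! i)}"

text \<open>Independent of \<open>d\<close>: a point is one multiplicative function on all
  monomials, so that different \<open>d\<close> can be compared.\<close>

definition exponent_points :: "nat list \<Rightarrow> (nat multiset \<Rightarrow> 'k::field_char_0) set" where
  "exponent_points e = range (\<lambda>M a. \<Prod>v\<in>#a. minor M (factor_support v) (e ! factor_block v))"

lemma filter_mset_sum: "filter_mset P (\<Sum>i\<in>I. f i) = (\<Sum>i\<in>I. filter_mset P (f i))"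
  by (induction I rule: infinite_finite_induct) simp_all

lemma size_sum_mset: "size (\<Sum>i\<in>I. f i :: 'a multiset) = (\<Sum>i\<in>I. size (f i))"
  by (induction I rule: infinite_finite_induct) simp_all

lemma prod_mset_image_sum:
  "(\<Prod>v\<in>#(\<Sum>i\<in>I. f i). (g v :: 'k::comm_monoid_mult)) = (\<Prod>i\<in>I. \<Prod>v\<in>#f i. g v)"
  by (induction I rule: infinite_finite_induct) simp_all

lemma sum_mset_nth: "(\<Sum>j<length xs. {#xs ! j#}) = mset xs"
  by (induction xs rule: rev_induct) (simp_all add: nth_append)

text \<open>The same flag is used in all factors of a block, so also the order of these factors may
  be forgotten and the coordinate depends only on a multiset. The section lists the factors of a
  block in the order of their codes.\<close>

lemma exponent_transfer:
  "index_transfer (flag_words e d {..<l}) (exponents e l d) (range (flag_coord e d))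
     (exponent_points e :: (_ \<Rightarrow> 'k::field_char_0) set)
     (\<lambda>w. \<Sum>i<length e. \<Sum>j<d ! i. {#encode_factor i (factor_set e w i j)#}) (flag_sign e d)
     (\<lambda>a. sorted_word e d (\<lambda>i j. factor_support
        (sorted_list_of_multiset (filter_mset (\<lambda>v. factor_block v = i) a) ! j)))"
proof -
  let ?\<phi> = "\<lambda>w. \<Sum>i<length e. \<Sum>j<d ! i. {#encode_factor i (factor_set e w i j)#}"
  define xs where "xs a i = sorted_list_of_multiset (filter_mset (\<lambda>v. factor_block v = i) a)"
    for a :: "nat multiset" and i
  define J where "J a i j = factor_support (xs a i ! j)" for a i j
  have fin_fs: "finite (factor_set e w i j)" for w i j by (simp add: factor_set_def)
  have len: "length (xs a i) = d ! i" if "a \<in> exponents e l d" "i < length e" for a i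
  proof -
    have "length (xs a i) = size (mset (xs a i))" by (rule size_mset[symmetric])
    also have "\<dots> = d ! i" using that by (simp add: xs_def exponents_def)
    finally show ?thesis .
  qed
  have J: "J a i j \<subseteq> {..<l} \<and> card (J a i j) = e ! i \<and> finite (J a i j) \<and>
      encode_factor i (J a i j) = xs a i ! j"
    if a: "a \<in> exponents e l d" and ij: "i < length e" "j < d ! i" for a i j
  proof -
    let ?v = "xs a i ! j"
    have "?v \<in> set (xs a i)" using len[OF a ij(1)] ij(2) by simp
    also have "set (xs a i) = set_mset (filter_mset (\<lambda>v. factor_block v = i) a)"
      unfolding xs_def by (rule set_sorted_list_of_multiset)
    finally have v: "?v \<in># a" "factor_block ?v = i" by auto
    then obtain i' S where S: "?v = encode_factor i' S" "S \<subseteq> {..<l}" "card S = e ! i'"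
      using a unfolding exponents_def by blast
    have "finite S" using S(2) finite_subset by blast
    moreover have "i' = i" using v(2) S(1) by simp
    ultimately show ?thesis using S by (simp add: J_def)
  qed
  have in_words: "sorted_word e d (J a) \<in> flag_words e d {..<l}" if "a \<in> exponents e l d" for a
    by (rule sorted_word(3)) (use J[OF that] in auto)
  have split: "?\<phi> (sorted_word e d (J a)) = a" if a: "a \<in> exponents e l d" for a
  proof -
    have "?\<phi> (sorted_word e d (J a)) = (\<Sum>i<length e. \<Sum>j<d ! i. {#xs a i ! j#})"
    proof (intro sum.cong refl)
      fix i j assume ij: "i \<in> {..<length e}" "j \<in> {..<d ! i}"
      have "factor_set e (sorted_word e d (J a)) i j = J a i j"
        by (rule sorted_word(1)) (use J[OF a] ij in auto)
      then show "{#encode_factor i (factor_set e (sorted_word e d (J a)) i j)#} = {#xs a i ! j#}"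
        using J[OF a, of i j] ij by simp
    qed
    also have "\<dots> = (\<Sum>i<length e. mset (xs a i))"
      by (intro sum.cong refl) (simp add: len[OF a, symmetric] sum_mset_nth)
    also have "\<dots> = (\<Sum>i<length e. filter_mset (\<lambda>v. factor_block v = i) a)"
      by (simp add: xs_def)
    also have "\<dots> = a"
    proof (rule multiset_eqI)
      fix v
      have "count (\<Sum>i<length e. filter_mset (\<lambda>v. factor_block v = i) a) v =
          (\<Sum>i<length e. if i = factor_block v then count a v else 0)"
        unfolding count_sum by (intro sum.cong) auto
      also have "\<dots> = (if factor_block v < length e then count a v else 0)" by simp
      also have "\<dots> = count a v"
      proof (cases "v \<in># a")
        case True
        then have "factor_block v < length e" using a unfolding exponents_def by auto
        then show ?thesis by simp
      qed (simp add: not_in_iff)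
      finally show "count (\<Sum>i<length e. filter_mset (\<lambda>v. factor_block v = i) a) v = count a v" .
    qed
    finally show ?thesis .
  qed
  have finW: "finite (flag_words e d {..<l})" using finite_positions by (auto intro!: finite_PiE)
  have compat: "flag_coord e d M w = flag_sign e d w *
      (\<Prod>v\<in>#?\<phi> w. minor M (factor_support v) (e ! factor_block v))" for M :: "nat \<Rightarrow> nat \<Rightarrow> 'k" and w
    unfolding flag_coord_eq_minors prod_mset_image_sum by (simp add: fin_fs)
  have "index_transfer (flag_words e d {..<l}) (exponents e l d) (range (flag_coord e d))
     (exponent_points e :: (_ \<Rightarrow> 'k) set) ?\<phi> (flag_sign e d) (\<lambda>a. sorted_word e d (J a))"
  proof
    have "exponents e l d \<subseteq> ?\<phi> ` flag_words e d {..<l}"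
    proof
      fix a assume "a \<in> exponents e l d"
      from split[OF this, symmetric] in_words[OF this]
      show "a \<in> ?\<phi> ` flag_words e d {..<l}" by (rule image_eqI)
    qed
    then show "finite (exponents e l d)" using finW finite_surj by blast
    fix w assume w: "w \<in> flag_words e d {..<l}" and nz: "flag_sign e d w \<noteq> (0 :: 'k)"
    have fs: "factor_set e w i j \<subseteq> {..<l} \<and> card (factor_set e w i j) = e ! i"
      if ij: "i < length e" "j < d ! i" for i j
    proof
      show "factor_set e w i j \<subseteq> {..<l}"
      proof
        fix y assume "y \<in> factor_set e w i j"
        then obtain k where k: "k < e ! i" "y = w (i, j, k)" by (auto simp: factor_set_def)
        then have "(i, j, k) \<in> positions e d" using ij by (simp add: positions_def)
        from PiE_mem[OF w this] show "y \<in> {..<l}" by (simp add: k(2))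
      qed
      have "inj_on (\<lambda>k. w (i, j, k)) {..<e ! i}" using nz ij unfolding flag_sign_nonzero by blast
      then show "card (factor_set e w i j) = e ! i" unfolding factor_set_def by (simp add: card_image)
    qed
    have "v \<in> {encode_factor i S | i S. i < length e \<and> S \<subseteq> {..<l} \<and> card S = e ! i}"
      if "v \<in># ?\<phi> w" for v
    proof -
      from that obtain i j where "i < length e" "j < d ! i" "v = encode_factor i (factor_set e w i j)"
        by (auto simp: set_mset_sum)
      with fs show ?thesis by blast
    qed
    moreover have "size (filter_mset (\<lambda>v. factor_block v = i) (?\<phi> w)) = d ! i" if "i < length e" for i
    proof -
      have "size (filter_mset (\<lambda>v. factor_block v = i) (?\<phi> w)) =
         (\<Sum>i'<length e. \<Sum>j<d ! i'. if i' = i then 1 else 0)"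
        unfolding filter_mset_sum size_sum_mset by (intro sum.cong refl) simp
      also have "\<dots> = (\<Sum>i'<length e. if i' = i then d ! i' else 0)" by (intro sum.cong) auto
      finally show ?thesis using that by simp
    qed
    ultimately show "?\<phi> w \<in> exponents e l d" unfolding exponents_def by blast
  next
    fix a assume a: "a \<in> exponents e l d"
    show "sorted_word e d (J a) \<in> flag_words e d {..<l}" by (rule in_words[OF a])
    show "?\<phi> (sorted_word e d (J a)) = a" by (rule split[OF a])
    show "flag_sign e d (sorted_word e d (J a)) \<noteq> (0 :: 'k)" by (rule sorted_word(2)) (use J[OF a] in auto)
  next
    fix z' :: "_ \<Rightarrow> 'k" assume "z' \<in> exponent_points e"
    then obtain M where M: "z' = (\<lambda>a. \<Prod>v\<in>#a. minor M (factor_support v) (e ! factor_block v))"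
      unfolding exponent_points_def by blast
    show "\<exists>z\<in>range (flag_coord e d). \<forall>w\<in>flag_words e d {..<l}. z w = flag_sign e d w * z' (?\<phi> w)"
      unfolding M by (intro bexI[of _ "flag_coord e d M"] ballI compat) simp
  next
    fix z :: "_ \<Rightarrow> 'k" assume "z \<in> range (flag_coord e d)"
    then obtain M where M: "z = flag_coord e d M" by blast
    show "\<exists>z'\<in>exponent_points e. \<forall>w\<in>flag_words e d {..<l}. z w = flag_sign e d w * z' (?\<phi> w)"
      unfolding M exponent_points_def
      by (intro bexI[of _ "\<lambda>a. \<Prod>v\<in>#a. minor M (factor_support v) (e ! factor_block v)"] ballI compat) simp
  qed (rule finW)
  then show ?thesis unfolding J_def xs_def .
qed

text \<open>Multidegrees add, so a and c of equal multidegree stay so after adding b, which is the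
  shift condition; for fixed l there are only finitely many encoded factors.\<close>

lemma bounded_gen_exponents:
  "\<exists>C. \<forall>d. bounded_gen (exponents e l d) (exponent_points e :: (_ \<Rightarrow> 'k::field_char_0) set) r C"
proof -
  let ?A = "{encode_factor i S | i S. i < length e \<and> S \<subseteq> {..<l} \<and> card S = e ! i}"
  have "?A \<subseteq> (\<lambda>(i, S). encode_factor i S) ` ({..<length e} \<times> Pow {..<l})" by auto
  then have "finite ?A" by (rule finite_subset) simp
  moreover have "finite (exponents e l d)" for d
    using index_transfer.finY[OF exponent_transfer[where ?'k = 'k]] .
  moreover have "c + b \<in> exponents e l d'"
    if "a \<in> exponents e l d" "a + b \<in> exponents e l d'" "c \<in> exponents e l d" for d d' a b c
    using that by (simp add: exponents_def)
  moreover have "z (a + b) = z a * z b" if "z \<in> exponent_points e" for z :: "_ \<Rightarrow> 'k" and a b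
    using that by (auto simp: exponent_points_def)
  ultimately have "\<exists>C. \<forall>d\<in>UNIV. bounded_gen (exponents e l d) (exponent_points e :: (_ \<Rightarrow> 'k) set) r C"
    by (intro bounded_gen_multisets[of ?A]) (auto simp: exponents_def)
  then show ?thesis by simp
qed

text \<open>A set and its Zariski closure have the same vanishing ideal, so the secant variety can
  be represented by the set of sums itself.\<close>

theorem theorem1p3:
  fixes e :: "nat list" and r :: nat
  assumes "e \<noteq> []" and "sorted_wrt (<) e" and "\<forall>x\<in>set e. 0 < x" and "0 < r"
  shows "\<exists>C::nat. \<forall>(n::nat) (d::nat list). last e \<le> n \<longrightarrow> length d = length e \<longrightarrow>
           generated_in_degree_le (plucker_idx e d n)
             (vanishing_ideal (plucker_idx e d n)
                (secant_set e d r :: ((nat \<Rightarrow> nat \<Rightarrow> nat set) \<Rightarrow> 'k::field_char_0) set)) C"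
proof -
  define E where "E = Max (set e)"
  have E: "e ! i \<le> E" if "i < length e" for i using that by (simp add: E_def)
  let ?N = "r * E"
  let ?Z = "\<lambda>d. range (flag_coord e d :: (nat \<Rightarrow> nat \<Rightarrow> 'k) \<Rightarrow> _)"
  have "\<forall>l. \<exists>C. \<forall>d. bounded_gen (exponents e l d) (exponent_points e :: (_ \<Rightarrow> 'k) set) r C"
    using bounded_gen_exponents by blast
  then obtain c where c: "\<And>l d. bounded_gen (exponents e l d) (exponent_points e :: (_ \<Rightarrow> 'k) set) r (c l)"
    by metis
  \<comment> \<open>Only the numbers of letters up to \<open>?N\<close> contribute a bound from
    well-quasi-orders; \<open>?N + 1\<close> accounts for the alternating sums over one letter
    more.\<close>
  define C where "C = Max (insert (?N + 1) (c ` {..?N}))"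
  have C: "?N + 1 \<le> C" "\<And>l. l \<le> ?N \<Longrightarrow> c l \<le> C"
    unfolding C_def by (intro Max_ge; simp)+
  have "generated_in_degree_le (plucker_idx e d n)
     (vanishing_ideal (plucker_idx e d n) (secant_set e d r :: (_ \<Rightarrow> 'k) set)) C" for n d
  proof -
    interpret P: index_transfer "flag_words e d {..<n}" "plucker_idx e d n" "?Z d"
      "plucker_points e d :: (_ \<Rightarrow> 'k) set"
      "\<lambda>w i j. if i < length e \<and> j < d ! i then factor_set e w i j else {}" "flag_sign e d" "sorted_word e d"
      by (rule plucker_transfer)
    \<comment> \<open>A small set of letters is renamed to an initial segment, where words can be
      replaced by monomials and the bound \<open>c (card L)\<close> applies.\<close>
    have base: "bounded_gen (flag_words e d L) (?Z d) r C" if L: "L \<subseteq> {..<n}" "card L \<le> ?N" for L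
    proof (rule bounded_gen_relabel)
      show "finite L" using L(1) finite_subset by blast
      show "1 \<le> C" using C(1) by simp
      show "bounded_gen (flag_words e d {..<card L}) (?Z d) r C"
        by (rule index_transfer.bounded_gen_preimage[OF exponent_transfer])
          (use bounded_gen_mono[OF c C(2)[OF L(2)]] C(1) in auto)
    qed
    have "bounded_gen (flag_words e d {..<n}) (?Z d) r C"
    proof (rule bounded_gen_flag_words)
      show "e ! i \<le> E" if "i < length e" for i by (rule E[OF that])
      show "bounded_gen (flag_words e d L) (?Z d) r C" if "L \<subseteq> {..<n}" "card L \<le> ?N" for L
        by (rule base[OF that])
    qed (rule C(1))
    then have "bounded_gen (plucker_idx e d n) (plucker_points e d :: (_ \<Rightarrow> 'k) set) r C"
      by (rule P.bounded_gen_image)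
    then show ?thesis
      unfolding secant_set_eq using P.finY \<open>0 < r\<close> by (intro generated_in_degree_le_secants)
  qed
  then show ?thesis by blast
qed

end
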